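(* Let $n\ge 1$ and let $\lambda,\mu\in\mathcal P$ be partitions with at most $n$ parts. Then $$K_{\lambda\mu}(t)=\sum_{b\in B(\lambda)_\mu} t^{\mathrm{ch}(b)},$$ where $K_{\lambda\mu}(t)$ is the type A Kostka-Foulkes polynomial, $B(\lambda)_\mu$ is the set of column strict tableaux of shape $\lambda$ and weight $\mu$, and $\mathrm{ch}$ is the charge function.
   Context: Schur functions. Let $\delta=(n-1,n-2,\ldots,1,0)$ and let $S_n$ act on $\mathbb Z^n$ by permuting coordinates. For $\mu\in\mathbb Z^n$ put $a_\mu=\sum_{w\in S_n}\det(w)\,x^{w\mu}$ (with $x^\gamma=x_1^{\gamma_1}\cdots x_n^{\gamma_n}$) and $s_\mu=a_{\mu+\delta}/a_\delta$, a symmetric Laurent polynomial. One has $s_\mu=\det(w)\,s_{w\circ\mu}$ with $w\circ\mu=w(\mu+\delta)-\delta$, so each $s_\mu$ is $0$ or $\pm s_\lambda$ for a unique weakly decreasing $\lambda\in\mathbb Z^n$. Let $\mathcal P=\{(\lambda_1,\dots,\lambda_n)\in\mathbb Z^n: \lambda_1\ge\cdots\ge\lambda_n\ge 0\}$ (partitions, identified with Young diagrams having $\lambda_i$ boxes in row $i$, rows numbered from top to bottom). Kostka-Foulkes polynomials. For $1\le i<j\le n$ let $R_{ij}:\mathbb Z^n\to\mathbb Z^n$, $R_{ij}\mu=\mu+\varepsilon_i-\varepsilon_j$ ($\varepsilon_i$ the standard basis vectors), and set $(R_{i_1j_1}\cdots R_{i_\ell j_\ell})s_\mu=s_{R_{i_1j_1}\cdots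 R_{i_\ell j_\ell}\mu}$ (all raising operators act on the index before any straightening). Put $$Q_\mu=\Big(\prod_{1\le i<j\le n}\frac{1}{1-tR_{ij}}\Big)s_\mu,$$ where each factor is expanded as the geometric series $\sum_{k\ge0}t^kR_{ij}^k$. After straightening, $K_{\lambda\mu}(t)$ is the coefficient of $s_\lambda$ in $Q_\mu$, for $\lambda,\mu\in\mathcal P$. Tableaux. A column strict tableau of shape $\lambda$ and weight $\mu=(\mu_1,\ldots,\mu_n)$ is a filling of the boxes of $\lambda$ with $\mu_1$ 1s, $\mu_2$ 2s, ..., $\mu_n$ $n$s, weakly increasing along rows from left to right and strictly increasing down columns. For $\lambda,\mu\in\mathcal P$, $B(\lambda)_\mu$ is the set of those of shape $\lambda$ and weight $\mu$. The plactic product $T_1*T_2$ of column strict tableaux is the jeu de taquin rectification of the skew tableau obtained by placing $T_1$ below and to the left of $T_2$ (the top right corner of $T_1$'s bounding rectangle touching the bottom left corner of $T_2$'s). This is associative; a letter $x$ is regarded as a one-box tableau, so $T*x$ is row insertion and $x*T$ is column insertion of $x$ into $T$. Write $i^k$ for the one-row tableau with $k$ entries all equal to $i$. Charge. Let $B(\mathcal P)_{\ge i}$ be the set of column strict tableaux (of any partition shape) with weight $(\mu_1,\dots,\mu_n)$ satisfying $\mu_1=\cdots=\mu_{i-1}=0$ and $\mu_i\ge\cdots\ge\mu_n\ge0$, and let $B(\mathcal P)_{\ge}=\bigcup_{1\le i\le n}B(\mathcal P)_{\ge i}$. Charge is the (known to exist and be unique) function $\mathrm{ch}:B(\mathcal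 P)_\ge\to\mathbb Z_{\ge0}$ such that: (a) $\mathrm{ch}(\emptyset)=0$; (b) if $T\in B(\mathcal P)_{\ge(i+1)}$ and $T*i^{\mu_i}\in B(\mathcal P)_{\ge i}$ then $\mathrm{ch}(T*i^{\mu_i})=\mathrm{ch}(T)$; (c) if $T$ is a column strict tableau and $x$ is a letter with $x\ne i$ such that $x*T\in B(\mathcal P)_{\ge i}$ (equivalently $T*x\in B(\mathcal P)_{\ge i}$), then $\mathrm{ch}(T*x)=\mathrm{ch}(x*T)+1$. *)

theory Defs
  imports
    "HOL-Library.Poly_Mapping"
    "HOL-Combinatorics.Permutations"
    "HOL-Computational_Algebra.Polynomial_FPS"
begin

section \<open>Weights and Laurent polynomials\<close>

text \<open>
  An element of \<open>\<int>\<^sup>n\<close> is a finitely supported function on \<open>nat\<close> that vanishes outside \<open>{1..n}\<close>,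
  so that the \<open>i\<close>-th coordinate of \<open>\<mu>\<close> is \<open>lookup \<mu> i\<close> and \<open>\<epsilon>\<^sub>i\<close> is \<open>single i 1\<close>.
  Laurent polynomials in \<open>x\<^sub>1, \<dots>, x\<^sub>n\<close> over \<open>\<int>\<close> are elements of the group ring of these
  weights: \<open>single \<gamma> 1\<close> is the monomial \<open>x\<^sup>\<gamma>\<close>.
\<close>

type_synonym weight = "nat \<Rightarrow>\<^sub>0 int"
type_synonym laurent = "weight \<Rightarrow>\<^sub>0 int"

definition weights :: "nat \<Rightarrow> weight set" where
  "weights n = {\<mu>. Poly_Mapping.keys \<mu> \<subseteq> {1..n}}"

definition dominant :: "nat \<Rightarrow> weight set" where
  "dominant n = {\<mu> \<in> weights n. \<forall>i\<in>{1..<n}. Poly_Mapping.lookup \<mu> (i + 1) \<le> Poly_Mapping.lookup \<mu> i}"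

definition partitions :: "nat \<Rightarrow> weight set" where
  "partitions n = {\<mu> \<in> dominant n. \<forall>i\<in>{1..n}. 0 \<le> Poly_Mapping.lookup \<mu> i}"

definition delta :: "nat \<Rightarrow> weight" where
  "delta n = (\<Sum>i\<in>{1..n}. Poly_Mapping.single i (int (n - i)))"

text \<open>\<open>(w\<mu>)\<^sub>i = \<mu>\<^bsub>w\<^sup>-\<^sup>1(i)\<^esub>\<close>, i.e. \<open>w\<epsilon>\<^sub>i = \<epsilon>\<^bsub>w(i)\<^esub>\<close>.\<close>

definition perm_act :: "(nat \<Rightarrow> nat) \<Rightarrow> weight \<Rightarrow> weight" where
  "perm_act w \<mu> = Poly_Mapping.map_key (inv w) \<mu>"

definition alternant :: "nat \<Rightarrow> weight \<Rightarrow> laurent" where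
  "alternant n \<mu> = (\<Sum>w | w permutes {1..n}. Poly_Mapping.single (perm_act w \<mu>) (sign w))"

text \<open>
  The quotient \<open>a\<^bsub>\<mu>+\<delta>\<^esub> / a\<^sub>\<delta>\<close> in the integral domain \<^typ>\<open>laurent\<close>; uniqueness of the quotient
  is lemma \<open>schur_eqI\<close> below.
\<close>

definition schur :: "nat \<Rightarrow> weight \<Rightarrow> laurent" where
  "schur n \<mu> = (THE f. f * alternant n (delta n) = alternant n (\<mu> + delta n))"

text \<open>
  The coefficient of \<open>s\<^sub>\<lambda>\<close> in the expansion of \<open>f\<close> in the basis \<open>s\<^sub>\<nu>\<close>, \<open>\<nu>\<close> dominant, of the
  symmetric Laurent polynomials.
\<close>

definition schur_coeff :: "nat \<Rightarrow> laurent \<Rightarrow> weight \<Rightarrow> int" where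
  "schur_coeff n f lam =
     Poly_Mapping.lookup (THE c.
       Poly_Mapping.keys c \<subseteq> dominant n \<and>
       f = (\<Sum>\<nu>\<in>Poly_Mapping.keys c. of_int (Poly_Mapping.lookup c \<nu>) * schur n \<nu>)) lam"


section \<open>Kostka-Foulkes polynomials\<close>

definition raising :: "nat \<Rightarrow> nat \<Rightarrow> weight \<Rightarrow> weight" where
  "raising i j \<mu> = \<mu> + Poly_Mapping.single i 1 - Poly_Mapping.single j 1"

text \<open>
  Raising operators act on the index \<open>\<mu>\<close> of \<open>s\<^sub>\<mu>\<close>, before straightening. So they act on formal
  symbols indexed by weights, which are again modelled by the group ring of the weights, the
  symbol of \<open>\<mu>\<close> being \<open>single \<mu> 1\<close>. There \<open>R\<^sub>i\<^sub>j\<close> is multiplication by the following monomial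
  (lemma \<open>raising_monom_mult\<close>).
\<close>

definition raising_monom :: "nat \<Rightarrow> nat \<Rightarrow> weight \<Rightarrow>\<^sub>0 int" where
  "raising_monom i j = Poly_Mapping.single (Poly_Mapping.single i 1 - Poly_Mapping.single j 1) 1"

text \<open>The geometric series \<open>\<Sum>\<^sub>k t\<^sup>k R\<^sub>i\<^sub>j\<^sup>k = 1 / (1 - t R\<^sub>i\<^sub>j)\<close>.\<close>

definition raising_geom :: "nat \<Rightarrow> nat \<Rightarrow> (weight \<Rightarrow>\<^sub>0 int) fps" where
  "raising_geom i j = Abs_fps (\<lambda>k. raising_monom i j ^ k)"

text \<open>The linear map sending the formal symbol of \<open>\<nu>\<close> to \<open>s\<^sub>\<nu>\<close>.\<close>

definition eval_schur :: "nat \<Rightarrow> (weight \<Rightarrow>\<^sub>0 int) \<Rightarrow> laurent" where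
  "eval_schur n p = (\<Sum>\<nu>\<in>Poly_Mapping.keys p. of_int (Poly_Mapping.lookup p \<nu>) * schur n \<nu>)"

text \<open>
  \<open>Q\<^sub>\<mu>\<close> is in general not a polynomial in \<open>t\<close> (it involves \<open>s\<^sub>\<nu>\<close> for infinitely many dominant \<open>\<nu>\<close>
  with negative parts), but for each \<open>m\<close> its \<open>t\<^sup>m\<close>-coefficient is a finite sum of \<open>s\<^sub>\<nu>\<close>'s.
\<close>

definition hall_littlewood_Q :: "nat \<Rightarrow> weight \<Rightarrow> laurent fps" where
  "hall_littlewood_Q n \<mu> =
     Abs_fps (\<lambda>m. eval_schur n
       (fps_nth ((\<Prod>(i, j) | 1 \<le> i \<and> i < j \<and> j \<le> n. raising_geom i j)
                  * fps_const (Poly_Mapping.single \<mu> 1)) m))"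

definition kostka_foulkes :: "nat \<Rightarrow> weight \<Rightarrow> weight \<Rightarrow> int fps" where
  "kostka_foulkes n lam \<mu> = Abs_fps (\<lambda>m. schur_coeff n (fps_nth (hall_littlewood_Q n \<mu>) m) lam)"


section \<open>Column strict tableaux\<close>

text \<open>
  Boxes are pairs (row, column), both counted from 1, rows from top to bottom.
  A (possibly skew) tableau is the partial map sending each of its boxes to its entry.
\<close>

type_synonym tableau = "nat \<times> nat \<rightharpoonup> nat"

definition diagram :: "weight \<Rightarrow> (nat \<times> nat) set" where
  "diagram lam = {(r, c). 1 \<le> c \<and> int c \<le> Poly_Mapping.lookup lam r}"

definition column_strict :: "tableau \<Rightarrow> bool" where
  "column_strict T \<longleftrightarrow>
     (\<forall>r c c' x y. c < c' \<and> T (r, c) = Some x \<and> T (r, c') = Some y \<longrightarrow> x \<le> y) \<and>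
     (\<forall>r r' c x y. r < r' \<and> T (r, c) = Some x \<and> T (r', c) = Some y \<longrightarrow> x < y)"

definition wt :: "tableau \<Rightarrow> nat \<Rightarrow> nat" where
  "wt T i = card {b. T b = Some i}"

definition tableaux_of_shape :: "nat \<Rightarrow> weight \<Rightarrow> tableau set" where
  "tableaux_of_shape n lam = {T. dom T = diagram lam \<and> ran T \<subseteq> {1..n} \<and> column_strict T}"

definition tableaux :: "nat \<Rightarrow> tableau set" where
  "tableaux n = (\<Union>lam\<in>partitions n. tableaux_of_shape n lam)"

text \<open>The set \<open>B(\<lambda>)\<^sub>\<mu>\<close>.\<close>

definition tableaux_of_shape_weight :: "nat \<Rightarrow> weight \<Rightarrow> weight \<Rightarrow> tableau set" where
  "tableaux_of_shape_weight n lam \<mu> =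
     {T \<in> tableaux_of_shape n lam. \<forall>i\<in>{1..n}. int (wt T i) = Poly_Mapping.lookup \<mu> i}"


section \<open>Jeu de taquin and the plactic product\<close>

text \<open>
  \<open>jdt_slide h T T'\<close>: sliding the hole at box \<open>h\<close> outwards through \<open>T\<close> results in \<open>T'\<close>. The
  smaller of the entries to the right of and below the hole moves into it; of two equal entries
  the lower one moves.
\<close>

inductive jdt_slide :: "nat \<times> nat \<Rightarrow> tableau \<Rightarrow> tableau \<Rightarrow> bool" where
  stop: "T (r, c + 1) = None \<Longrightarrow> T (r + 1, c) = None \<Longrightarrow> jdt_slide (r, c) T T"
| up: "T (r + 1, c) = Some y \<Longrightarrow> (\<And>x. T (r, c + 1) = Some x \<Longrightarrow> y \<le> x) \<Longrightarrow>
    jdt_slide (r + 1, c) (T((r, c) \<mapsto> y, (r + 1, c) := None)) T' \<Longrightarrow> jdt_slide (r, c) T T'"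
| left: "T (r, c + 1) = Some x \<Longrightarrow> (\<And>y. T (r + 1, c) = Some y \<Longrightarrow> x < y) \<Longrightarrow>
    jdt_slide (r, c + 1) (T((r, c) \<mapsto> x, (r, c + 1) := None)) T' \<Longrightarrow> jdt_slide (r, c) T T'"

text \<open>
  A skew tableau of shape \<open>\<alpha>/\<beta>\<close> is a pair \<open>(I, T)\<close> of the diagram \<open>I\<close> of \<open>\<beta>\<close> and the filling \<open>T\<close>.
  The inner shape has to be recorded since the set of boxes of \<open>\<alpha>/\<beta>\<close> does not determine it.
\<close>

definition corner :: "(nat \<times> nat) set \<Rightarrow> nat \<times> nat \<Rightarrow> bool" where
  "corner I b \<longleftrightarrow> (case b of (r, c) \<Rightarrow> (r, c) \<in> I \<and> (r + 1, c) \<notin> I \<and> (r, c + 1) \<notin> I)"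

inductive jdt_step ::
  "(nat \<times> nat) set \<times> tableau \<Rightarrow> (nat \<times> nat) set \<times> tableau \<Rightarrow> bool" where
  "corner I b \<Longrightarrow> jdt_slide b T T' \<Longrightarrow> jdt_step (I, T) (I - {b}, T')"

text \<open>The result does not depend on the order in which the inner corners are chosen.\<close>

definition rectification :: "(nat \<times> nat) set \<Rightarrow> tableau \<Rightarrow> tableau" where
  "rectification I T = (THE T'. jdt_step\<^sup>*\<^sup>* (I, T) ({}, T'))"

definition height :: "tableau \<Rightarrow> nat" where
  "height T = card (fst ` dom T)"

definition width :: "tableau \<Rightarrow> nat" where
  "width T = card (snd ` dom T)"

text \<open>
  \<open>T\<^sub>2\<close> occupies the top \<open>height T\<^sub>2\<close> rows, to the right of the first \<open>width T\<^sub>1\<close> columns; \<open>T\<^sub>1\<close>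
  occupies these columns, below these rows.
\<close>

definition juxtapose :: "tableau \<Rightarrow> tableau \<Rightarrow> tableau" where
  "juxtapose T\<^sub>1 T\<^sub>2 = (\<lambda>(r, c).
     if r \<le> height T\<^sub>2
     then (if c \<le> width T\<^sub>1 then None else T\<^sub>2 (r, c - width T\<^sub>1))
     else T\<^sub>1 (r - height T\<^sub>2, c))"

definition plactic :: "tableau \<Rightarrow> tableau \<Rightarrow> tableau" (infixl \<open>\<star>\<close> 70) where
  "T\<^sub>1 \<star> T\<^sub>2 = rectification ({1..height T\<^sub>2} \<times> {1..width T\<^sub>1}) (juxtapose T\<^sub>1 T\<^sub>2)"

text \<open>The one-row tableau \<open>i\<^sup>k\<close>.\<close>

definition one_row :: "nat \<Rightarrow> nat \<Rightarrow> tableau" where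
  "one_row i k = (\<lambda>(r, c). if r = 1 \<and> 1 \<le> c \<and> c \<le> k then Some i else None)"

abbreviation letter :: "nat \<Rightarrow> tableau" where
  "letter x \<equiv> one_row x 1"


section \<open>Charge\<close>

text \<open>
  The set \<open>B(\<P>)\<^bsub>\<ge>i\<^esub>\<close>. For \<open>i = n + 1\<close>, which occurs in \<open>charge_row\<close> below, it consists of
  the empty tableau only.
\<close>

definition tableaux_ge :: "nat \<Rightarrow> nat \<Rightarrow> tableau set" where
  "tableaux_ge n i =
     {T \<in> tableaux n. (\<forall>j\<in>{1..<i}. wt T j = 0) \<and> (\<forall>j\<in>{i..<n}. wt T (j + 1) \<le> wt T j)}"

text \<open>
  The properties characterising the charge function. They only constrain the values of \<open>ch\<close> on
  \<open>\<Union>\<^bsub>1\<le>i\<le>n\<^esub> B(\<P>)\<^bsub>\<ge>i\<^esub>\<close>, which they determine uniquely; values elsewhere are irrelevant.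
\<close>

locale charge =
  fixes n :: nat and ch :: "tableau \<Rightarrow> nat"
  assumes charge_empty: "ch Map.empty = 0"
    and charge_row: "\<lbrakk>1 \<le> i; i \<le> n; T \<in> tableaux_ge n (i + 1); T \<star> one_row i k \<in> tableaux_ge n i\<rbrakk>
        \<Longrightarrow> ch (T \<star> one_row i k) = ch T"
    and charge_cyclage: "\<lbrakk>1 \<le> i; i \<le> n; 1 \<le> x; x \<le> n; x \<noteq> i; T \<in> tableaux n;
        letter x \<star> T \<in> tableaux_ge n i\<rbrakk>
        \<Longrightarrow> ch (T \<star> letter x) = ch (letter x \<star> T) + 1"


section \<open>Well-definedness of the above notions\<close>

lemma raising_monom_mult:
  "raising_monom i j * Poly_Mapping.single \<mu> 1 = Poly_Mapping.single (raising i j \<mu>) 1"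
  by (simp add: raising_monom_def raising_def mult_single algebra_simps)

lemma raising_geom_eq: "(1 - fps_X * fps_const (raising_monom i j)) * raising_geom i j = 1"
proof (rule fps_ext)
  fix m
  show "fps_nth ((1 - fps_X * fps_const (raising_monom i j)) * raising_geom i j) m = fps_nth 1 m"
    by (cases m) (simp_all add: raising_geom_def algebra_simps fps_mult_left_const_nth)
qed

lemma lookup_perm_act:
  assumes "w permutes {1..n}"
  shows "Poly_Mapping.lookup (perm_act w \<mu>) i = Poly_Mapping.lookup \<mu> (inv w i)"
  using permutes_inj[OF permutes_inv[OF assms]] by (simp add: perm_act_def map_key.rep_eq)

lemma lookup_delta:
  "Poly_Mapping.lookup (delta n) i = (if i \<in> {1..n} then int (n - i) else 0)"
  by (simp add: delta_def lookup_sum lookup_single when_def)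

lemma perm_act_delta:
  assumes w: "w permutes {1..n}" and eq: "perm_act w (delta n) = delta n"
  shows "w = id"
proof -
  have v: "inv w permutes {1..n}" using w by (rule permutes_inv)
  have "inv w i = i" if i: "i \<in> {1..n}" for i
  proof -
    have "inv w i \<in> {1..n}" using v i by (metis permutes_in_image)
    moreover have "Poly_Mapping.lookup (delta n) (inv w i) = Poly_Mapping.lookup (delta n) i"
      by (metis eq lookup_perm_act w)
    ultimately show ?thesis using i by (auto simp: lookup_delta)
  qed
  then have "inv w = id" using v by (auto simp: fun_eq_iff permutes_def)
  then show ?thesis by (metis inv_id permutes_inv_inv w)
qed

lemma alternant_delta_nonzero: "alternant n (delta n) \<noteq> 0"
proof -
  have "Poly_Mapping.lookup (alternant n (delta n)) (delta n) =
      (\<Sum>w | w permutes {1..n}. if w = id then 1 else 0)"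
    unfolding alternant_def lookup_sum
  proof (rule sum.cong[OF refl])
    fix w assume "w \<in> {w. w permutes {1..n}}"
    then have w: "w permutes {1..n}" by simp
    have "perm_act id (delta n) = delta n"
      by (rule poly_mapping_eqI) (simp add: lookup_perm_act[OF permutes_id[of "{1..n}"]])
    then show "Poly_Mapping.lookup (Poly_Mapping.single (perm_act w (delta n)) (sign w)) (delta n)
        = (if w = id then 1 else 0)"
      using perm_act_delta[OF w] by (auto simp: lookup_single when_def)
  qed
  also have "\<dots> = 1" by (simp add: finite_permutations permutes_id)
  finally show ?thesis by auto
qed

lemma schur_eqI:
  assumes "f * alternant n (delta n) = alternant n (\<mu> + delta n)"
  shows "schur n \<mu> = f"
  unfolding schur_def using assms alternant_delta_nonzero[of n]
  by (intro the_equality) (auto simp flip: assms)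

lemma finite_diagram: "finite (diagram lam)"
proof -
  have "diagram lam \<subseteq> (\<Union>r\<in>Poly_Mapping.keys lam. {r} \<times> {1..nat (Poly_Mapping.lookup lam r)})"
    by (auto simp: diagram_def in_keys_iff)
  then show ?thesis by (rule finite_subset) auto
qed

lemma finite_tableaux_of_shape_weight: "finite (tableaux_of_shape_weight n lam \<mu>)"
  by (rule finite_subset[OF _ finite_set_of_finite_maps[OF finite_diagram[of lam], of "{1..n}"]])
    (auto simp: tableaux_of_shape_weight_def tableaux_of_shape_def)

end

theory Submission
  imports Defs
begin

text \<open>
  The charge formula is proved by induction, adding the smallest letter \<open>i\<close> to tableaux in the
      letters
  \<open>i + 1, \<dots>, n\<close>. The factors \<open>1 / (1 - t R\<^sub>i\<^sub>j)\<close> with this fixed \<open>i\<close> turn \<open>s\<^sub>\<lambda>\<close> into the sum of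
  \<open>t\<^sup>r s\<^bsub>(\<mu>\<^sub>i+r,\<nu>)\<^esub>\<close> over the horizontal strips \<open>\<lambda>/\<nu>\<close> of size \<open>r\<close>. By the Pieri bijection, a
  tableau \<open>b\<close> of shape \<open>\<lambda>\<close> together with such a \<open>\<nu>\<close> is a factorisation \<open>b = u * T\<close> into a row \<open>u\<close>
      and a
  tableau \<open>T\<close> of shape \<open>\<nu>\<close>, and cyclage gives \<open>ch (T * i\<^sup>k * u) = ch (u * T) + r\<close>
      for \<open>k = \<mu>\<^sub>i\<close>. If the row
  \<open>i\<^sup>k u\<close> is not shorter than the first row of \<open>T * u\<close>, then \<open>T * i\<^sup>k * u\<close> is this row placed
  on top of \<open>T\<close>, and every tableau with smallest letter \<open>i\<close> arises once. The other terms cancel: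
  exchanging the length of the row \<open>i\<^sup>k u\<close> with one row of \<open>\<nu>\<close> (after adding \<open>\<delta>\<close>),
      for fixed \<open>T * u\<close>,
  changes the sign but not the tableau \<open>T * i\<^sup>k * u\<close>. For the latter,
      Greene's invariants show that the shape of
  \<open>T * i\<^sup>k * u\<close> does not change, and a tableau is determined by its shape and the class of its
  letters greater than \<open>i\<close>. Greene's theorem also yields the uniqueness of the tableau in a Knuth
      class, and with
  it that rectification is well defined.
\<close>

section \<open>Knuth equivalence\<close>

text \<open>The coefficient of \<open>s_\<lambda>\<close> is treated as a linear functional of the
  index, evaluated after adding \<delta>. The dot action then becomes a permutation of coordinates
  and straightening becomes the statement that the functional is alternating. The induction must
  admit arbitrary functionals \<open>G\<close>, because the operators with first index
  \<open>i\<close> replace \<open>G\<close> by a sum of its translates, which is only known to be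
  alternating in the coordinates after \<open>i\<close>. A second property is carried along:
  \<open>G\<close> vanishes at indices with a negative entry, which holds at the start because
  \<lambda> has no negative parts. It disposes of the terms in which the last coordinate is lowered
  too far, the one place where no neighbour is available for a cancellation.

  The detour through \<open>T * i^k * u\<close> comes from the charge axioms: cyclage moves every
  letter of \<open>u\<close> but none of the letters \<open>i\<close>.\<close>

inductive kstep :: "nat list \<Rightarrow> nat list \<Rightarrow> bool" where
  k1: "x < y \<Longrightarrow> y \<le> z \<Longrightarrow> kstep (a @ [y, z, x] @ b) (a @ [y, x, z] @ b)"
| k2: "x \<le> y \<Longrightarrow> y < z \<Longrightarrow> kstep (a @ [x, z, y] @ b) (a @ [z, x, y] @ b)"

definition knuth :: "nat list \<Rightarrow> nat list \<Rightarrow> bool" (infix \<open>\<approx>\<close> 50) where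
  "knuth = equivclp kstep"

lemma knuth_refl [simp]: "u \<approx> u"
  by (simp add: knuth_def)

lemma knuth_sym: "u \<approx> v \<Longrightarrow> v \<approx> u"
  by (simp add: knuth_def equivclp_sym)

lemma knuth_trans [trans]: "u \<approx> v \<Longrightarrow> v \<approx> w \<Longrightarrow> u \<approx> w"
  unfolding knuth_def by (rule equivclp_trans)

lemma knuth_step: "kstep u v \<Longrightarrow> u \<approx> v"
  by (simp add: knuth_def r_into_equivclp)

text \<open>The closure also contains the converses of \<open>kstep\<close>, so the side condition
  \<open>I\<close> has to pass along a step in both directions. It is used for the bound on the
  letters in \<open>knuth_star\<close>.\<close>

lemma knuth_lift:
  assumes "u \<approx> v" and "\<And>a b. kstep a b \<Longrightarrow> I a \<Longrightarrow> f a \<approx> f b"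
    and I: "\<And>a b. kstep a b \<Longrightarrow> I a \<longleftrightarrow> I b" and "I u"
  shows "f u \<approx> f v"
  using assms(1) unfolding knuth_def
proof (induction rule: equivclp_induct)
  case base
  then show ?case by (metis knuth_def knuth_refl)
next
  case (step y z)
  have "I y" using step(1)
  proof (induction rule: equivclp_induct)
    case base
    then show ?case by (rule assms(4))
  next
    case (step y z)
    then show ?case using I by blast
  qed
  then have "f y \<approx> f z" using step(2) assms(2) I knuth_sym by blast
  then show ?case using step(3) knuth_trans unfolding knuth_def by blast
qed

lemma knuth_invariant:
  assumes "u \<approx> v" and "\<And>a b. kstep a b \<Longrightarrow> f a = f b"
  shows "f u = f v"
  using assms(1) unfolding knuth_def
  by (induction rule: equivclp_induct) (auto dest: assms(2))

lemma kstep_app: "kstep u v \<Longrightarrow> kstep (a @ u @ b) (a @ v @ b)"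
proof (induction rule: kstep.induct)
  case (k1 x y z c d)
  show ?case using kstep.k1[OF k1, of "a @ c" "d @ b"] by simp
next
  case (k2 x y z c d)
  show ?case using kstep.k2[OF k2, of "a @ c" "d @ b"] by simp
qed

lemma knuth_app: "u \<approx> v \<Longrightarrow> a @ u @ b \<approx> a @ v @ b"
  by (rule knuth_lift[where I = "\<lambda>_. True"]) (auto intro: knuth_step kstep_app)

lemma knuth_append: "u \<approx> v \<Longrightarrow> u' \<approx> v' \<Longrightarrow> u @ u' \<approx> v @ v'"
  using knuth_app[of u v "[]" u'] knuth_app[of u' v' v "[]"] knuth_trans[of "u @ u'" "v @ u'"]
  by simp

lemma knuth_Cons: "u \<approx> v \<Longrightarrow> x # u \<approx> x # v"
  using knuth_app[of u v "[x]" "[]"] by simp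

lemma knuth_mset: "u \<approx> v \<Longrightarrow> mset u = mset v"
  by (erule knuth_invariant, erule kstep.cases) auto

lemma knuth_set: "u \<approx> v \<Longrightarrow> set u = set v"
  by (metis knuth_mset set_mset_mset)

lemma knuth_length: "u \<approx> v \<Longrightarrow> length u = length v"
  by (metis knuth_mset size_mset)

text \<open>The two sides of a Knuth relation differ in the order of \<open>x\<close> and
  \<open>z\<close> only. Convexity excludes the one harmful case, in which these two letters stay
  while the middle letter \<open>y\<close> is removed.\<close>

lemma kstep_filter:
  assumes "kstep u v" and convex: "\<And>x y z. x \<le> y \<Longrightarrow> y \<le> z \<Longrightarrow> Q x \<Longrightarrow> Q z \<Longrightarrow> Q y"
  shows "filter Q u \<approx> filter Q v"
  using assms(1)
proof (induction rule: kstep.induct)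
  case (k1 x y z a b)
  show ?case
  proof (cases "Q x \<and> Q z")
    case True
    then have "Q y" using convex[of x y z] k1 by auto
    then show ?thesis using True knuth_step[OF kstep.k1[OF k1]] by auto
  qed auto
next
  case (k2 x y z a b)
  show ?case
  proof (cases "Q x \<and> Q z")
    case True
    then have "Q y" using convex[of x y z] k2 by auto
    then show ?thesis using True knuth_step[OF kstep.k2[OF k2]] by auto
  qed auto
qed

lemma knuth_filter:
  assumes "u \<approx> v" and "\<And>x y z. x \<le> y \<Longrightarrow> y \<le> z \<Longrightarrow> Q x \<Longrightarrow> Q z \<Longrightarrow> Q y"
  shows "filter Q u \<approx> filter Q v"
  by (rule knuth_lift[where I = "\<lambda>_. True", OF assms(1)]) (auto intro: kstep_filter assms(2))

section \<open>Reversal and complement of words\<close>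

definition star :: "nat \<Rightarrow> nat list \<Rightarrow> nat list" where
  "star n w = rev (map (\<lambda>x. n - x) w)"

lemma star_star: "set w \<subseteq> {..n} \<Longrightarrow> star n (star n w) = w"
  by (induction w) (auto simp: star_def)

lemma star_append: "star n (u @ v) = star n v @ star n u"
  by (simp add: star_def)

lemma set_star: "set (star n w) \<subseteq> {..n}"
  by (auto simp: star_def)

lemma length_star [simp]: "length (star n w) = length w"
  by (simp add: star_def)

text \<open>Reversal and complement together exchange the relations \<open>k1\<close> and
  \<open>k2\<close>, including their weak and strict inequalities. Truncated subtraction respects
  strict inequalities only up to \<open>n\<close>, whence the bound on the letters.\<close>

lemma star_kstep:
  assumes "kstep u v" "set u \<subseteq> {..n}"
  shows "kstep (star n v) (star n u)"
  using assms
proof (induction rule: kstep.induct)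
  case (k1 x y z a b)
  show ?case using kstep.k2[of "n - z" "n - y" "n - x" "star n b" "star n a"] k1
    by (auto simp: star_def)
next
  case (k2 x y z a b)
  show ?case using kstep.k1[of "n - z" "n - y" "n - x" "star n b" "star n a"] k2
    by (auto simp: star_def)
qed

lemma knuth_star:
  assumes "u \<approx> v" "set u \<subseteq> {..n}"
  shows "star n u \<approx> star n v"
  by (rule knuth_lift[where I = "\<lambda>w. set w \<subseteq> {..n}", OF assms(1)])
    (use assms(2) in \<open>auto intro!: knuth_sym[OF knuth_step] star_kstep dest: knuth_set[OF
        knuth_step]\<close>)

lemma sorted_star: "sorted w \<Longrightarrow> sorted (star n w)"
  unfolding star_def sorted_wrt_rev by (induction w) auto

section \<open>Row insertion expressed by Knuth relations\<close>

lemma knuth_move_left: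
  assumes "sorted B" "\<forall>b\<in>set B. y \<le> b" "x < y"
  shows "y # B @ [x] \<approx> y # x # B"
  using assms
proof (induction B rule: rev_induct)
  case (snoc b B)
  \<comment> \<open>The left neighbour of \<open>b\<close>, be it in \<open>B\<close> or
    \<open>y\<close> itself, is the middle letter that \<open>k1\<close> needs in order to exchange
    \<open>b\<close> and \<open>x\<close>.\<close>
  have "\<exists>C c. y # B = C @ [c] \<and> x < c \<and> c \<le> b"
  proof (cases B rule: rev_cases)
    case Nil
    then show ?thesis using snoc by auto
  next
    case (snoc B' b')
    have "x < b'" "b' \<le> b" using snoc snoc.prems by (auto simp: sorted_append)
    then show ?thesis using snoc by (intro exI[of _ "y # B'"] exI[of _ b']) auto
  qed
  then obtain C c where C: "y # B = C @ [c]" "x < c" "c \<le> b" by blast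
  have "y # (B @ [b]) @ [x] = C @ [c, b, x] @ []" using C(1) by simp
  also have "C @ [c, b, x] @ [] \<approx> C @ [c, x, b] @ []" using C by (intro knuth_step kstep.k1)
  also have "C @ [c, x, b] @ [] = (y # B @ [x]) @ [b]" using C(1) by simp
  also have "(y # B @ [x]) @ [b] \<approx> (y # x # B) @ [b]"
    by (rule knuth_append) (use snoc in \<open>auto simp: sorted_append\<close>)
  finally show ?case by simp
qed auto

text \<open>Mirror image of \<open>knuth_move_left\<close>: the bumped letter leaves the row to the
  left by \<open>k2\<close>, the right neighbour of each \<open>a\<close> being the middle
  letter.\<close>

lemma knuth_move_right:
  assumes "sorted A" "\<forall>a\<in>set A. a \<le> x" "x < z"
  shows "A @ [z, x] \<approx> z # A @ [x]"
  using assms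
proof (induction A)
  case (Cons a A)
  have "\<exists>C c. A @ [x] = c # C \<and> a \<le> c \<and> c < z"
    by (cases A) (use Cons in auto)
  then obtain C c where C: "A @ [x] = c # C" "a \<le> c" "c < z" by blast
  have "(a # A) @ [z, x] \<approx> a # z # A @ [x]"
    using Cons knuth_Cons by simp
  also have "a # z # A @ [x] = [] @ [a, z, c] @ C" using C by simp
  also have "[] @ [a, z, c] @ C \<approx> [] @ [z, a, c] @ C"
    using C by (intro knuth_step kstep.k2)
  also have "[] @ [z, a, c] @ C = z # (a # A) @ [x]" using C by simp
  finally show ?case .
qed auto

text \<open>Insertion of \<open>x\<close> into a row: \<open>x\<close> moves left up to its place
  behind \<open>z\<close>, then \<open>z\<close> moves left out of the row.\<close>

lemma knuth_bump:
  assumes "sorted (A @ z # B)" "\<forall>a\<in>set A. a \<le> x" "x < z"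
  shows "A @ z # B @ [x] \<approx> z # A @ x # B"
proof -
  have "A @ (z # B @ [x]) \<approx> A @ (z # x # B)"
    by (rule knuth_append[OF knuth_refl knuth_move_left]) (use assms in \<open>auto simp: sorted_append\<close>)
  also have "A @ (z # x # B) = (A @ [z, x]) @ B" by simp
  also have "(A @ [z, x]) @ B \<approx> (z # A @ [x]) @ B"
    by (rule knuth_append[OF knuth_move_right knuth_refl]) (use assms in \<open>auto simp: sorted_append\<close>)
  finally show ?thesis by simp
qed

text \<open>A sorted word inserted into a row bumps the letters of \<open>p\<close> one after the
  other. Each inserted letter joins the part \<open>A\<close> in front, so the induction has to run
  over all \<open>A\<close>.\<close>

lemma knuth_row_bump:
  assumes "list_all2 (<) u p" "sorted (A @ p @ S)" "sorted (A @ u)"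
  shows "A @ p @ S @ u \<approx> p @ A @ u @ S"
  using assms
proof (induction arbitrary: A rule: list_all2_induct)
  case (Cons x u z p)
  have "A @ (z # p) @ S @ (x # u) = (A @ z # (p @ S) @ [x]) @ u" by simp
  also have "(A @ z # (p @ S) @ [x]) @ u \<approx> (z # A @ x # (p @ S)) @ u"
    by (rule knuth_append[OF knuth_bump knuth_refl]) (use Cons in \<open>auto simp: sorted_append\<close>)
  also have "(z # A @ x # (p @ S)) @ u = z # ((A @ [x]) @ p @ S @ u)" by simp
  also have "z # ((A @ [x]) @ p @ S @ u) \<approx> z # (p @ (A @ [x]) @ u @ S)"
  proof (rule knuth_Cons, rule Cons.IH)
    have "\<forall>b\<in>set p \<union> set S. z \<le> b" using Cons.prems by (auto simp: sorted_append)
    then have "\<forall>b\<in>set p \<union> set S. x \<le> b" by (meson Cons.hyps(1) less_imp_le order.trans)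
    then show "sorted ((A @ [x]) @ p @ S)" using Cons.prems by (auto simp: sorted_append)
    show "sorted ((A @ [x]) @ u)" using Cons.prems by simp
  qed
  finally show ?case by simp
qed auto

text \<open>The vertical move of a jeu de taquin slide: \<open>y\<close> moves from the lower row into the hole
  between \<open>u\<close> and \<open>v\<close> of the upper row. Both sides bump to the same pair of rows.\<close>

lemma knuth_vertical_move:
  assumes "list_all2 (<) u p" "list_all2 (<) v q" "sorted (p @ y # q)" "sorted (u @ y # v)"
  shows "p @ y # q @ u @ v \<approx> p @ q @ u @ y # v"
proof -
  have "p @ y # q @ u @ v = ([] @ p @ (y # q) @ u) @ v" by simp
  also have "([] @ p @ (y # q) @ u) @ v \<approx> (p @ [] @ u @ (y # q)) @ v"
    by (rule knuth_append[OF knuth_row_bump knuth_refl]) (use assms in \<open>auto simp: sorted_append\<close>)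
  also have "(p @ [] @ u @ (y # q)) @ v = p @ ((u @ [y]) @ q @ [] @ v)" by simp
  \<comment> \<open>Now \<open>v\<close> bumps \<open>q\<close> out of the row
    \<open>u @ y # q\<close>.\<close>
  also have "p @ ((u @ [y]) @ q @ [] @ v) \<approx> p @ (q @ (u @ [y]) @ v @ [])"
  proof (rule knuth_append[OF knuth_refl knuth_row_bump])
    have "a \<le> y" if "a \<in> set u" for a using assms(4) that by (auto simp: sorted_append)
    then show "sorted ((u @ [y]) @ q @ [])" using assms(3,4)
      by (auto simp: sorted_append) (meson order_trans)
  qed (use assms in \<open>auto simp: sorted_append\<close>)
  finally show ?thesis by simp
qed

section \<open>Greene's invariants\<close>

text \<open>A union of \<open>k\<close> weakly increasing subsequences, given by its set of
  positions and a colouring of them. With colours, exchanging the ends of two subsequences is a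
  change of \<open>c\<close> alone.\<close>

definition kinc :: "nat \<Rightarrow> nat list \<Rightarrow> nat set \<Rightarrow> (nat \<Rightarrow> nat) \<Rightarrow> bool" where
  "kinc k w A c \<longleftrightarrow> A \<subseteq> {..<length w} \<and> (\<forall>p\<in>A. c p < k) \<and>
     (\<forall>p\<in>A. \<forall>q\<in>A. p < q \<longrightarrow> c p = c q \<longrightarrow> w ! p \<le> w ! q)"

definition greene :: "nat \<Rightarrow> nat list \<Rightarrow> nat" where
  "greene k w = Max {card A |A. \<exists>c. kinc k w A c}"

lemma greene_finite: "finite {card A |A. \<exists>c. kinc k w A c}"
  by (rule finite_subset[of _ "card ` Pow {..<length w}"]) (auto simp: kinc_def)

lemma kinc_le_greene: "kinc k w A c \<Longrightarrow> card A \<le> greene k w"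
  unfolding greene_def by (rule Max_ge[OF greene_finite]) auto

lemma greene_le:
  assumes "\<And>A c. kinc k w A c \<Longrightarrow> card A \<le> m"
  shows "greene k w \<le> m"
proof -
  have "kinc k w {} (\<lambda>_. 0)" by (simp add: kinc_def)
  then show ?thesis unfolding greene_def
    by (subst Max_le_iff[OF greene_finite]) (use assms in auto)
qed

lemma greene_leI:
  assumes "\<And>A c. kinc k w A c \<Longrightarrow> \<exists>A' c'. kinc k' w' A' c' \<and> card A = card A'"
  shows "greene k w \<le> greene k' w'"
  by (rule greene_le) (use assms kinc_le_greene in fastforce)

lemma kinc_finite: "kinc k w A c \<Longrightarrow> finite A"
  unfolding kinc_def by (metis finite_lessThan finite_subset)

section \<open>Knuth invariance of Greene's numbers\<close>

lemma greene_star_le: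
  assumes "set w \<subseteq> {..n}"
  shows "greene k w \<le> greene k (star n w)"
proof (rule greene_leI)
  fix A c assume A: "kinc k w A c"
  define f where "f p = length w - 1 - p" for p
  have len: "\<forall>p\<in>A. p < length w" using A by (auto simp: kinc_def)
  have inj: "inj_on f A"
  proof (rule inj_onI)
    fix p q assume "p \<in> A" "q \<in> A" "f p = f q"
    then show "p = q" using len[rule_format, of p] len[rule_format, of q] by (simp add: f_def)
  qed
  have nth: "star n w ! (f p) = n - w ! p" if "p \<in> A" for p
    using that len by (auto simp: star_def f_def rev_nth)
  have "kinc k (star n w) (f ` A) (c \<circ> f)"
    unfolding kinc_def
  proof (intro conjI ballI impI)
    fix p q assume "p \<in> f ` A" "q \<in> f ` A" "p < q" "(c \<circ> f) p = (c \<circ> f) q"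
    then obtain p' q' where pq: "p = f p'" "q = f q'" "p' \<in> A" "q' \<in> A" by auto
    moreover have "f (f p') = p'" "f (f q') = q'" using pq len by (auto simp: f_def)
    ultimately have "c p' = c q'" using \<open>(c \<circ> f) p = (c \<circ> f) q\<close> by simp
    moreover have "q' < p'" using \<open>p < q\<close> pq len by (auto simp: f_def)
    ultimately have "w ! q' \<le> w ! p'" using A pq by (auto simp: kinc_def)
    then show "star n w ! p \<le> star n w ! q" using pq nth by auto
  next
    fix p assume "p \<in> f ` A"
    then obtain p' where p: "p = f p'" "p' \<in> A" by auto
    then have "f p = p'" using len by (auto simp: f_def)
    then show "(c \<circ> f) p < k" using A p by (auto simp: kinc_def)
  next
    show "f ` A \<subseteq> {..<length (star n w)}" using len by (auto simp: f_def)
  qed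
  then show "\<exists>A' c'. kinc k (star n w) A' c' \<and> card A = card A'"
    using card_image[OF inj] by metis
qed

lemma greene_star:
  assumes "set w \<subseteq> {..n}"
  shows "greene k (star n w) = greene k w"
proof (rule order.antisym)
  show "greene k (star n w) \<le> greene k w"
    using greene_star_le[OF set_star[of n w], of k] star_star[OF assms] by simp
qed (rule greene_star_le[OF assms])

text \<open>Transposing two neighbouring positions reverses the order of this one pair only, so a
  coloured set survives unless the pair shares a colour.\<close>

lemma kinc_swap:
  assumes K: "kinc k (a @ [u, v] @ b) A c"
    and ne: "\<not> (length a \<in> A \<and> Suc (length a) \<in> A \<and> c (length a) = c (Suc (length a)))"
  shows "\<exists>A' c'. kinc k (a @ [v, u] @ b) A' c' \<and> card A = card A'"
proof -
  define s where "s = length a"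
  define f where "f = Transposition.transpose s (Suc s)"
  have ff: "f (f q) = q" for q by (simp add: f_def)
  have nth: "(a @ [v, u] @ b) ! f q = (a @ [u, v] @ b) ! q" for q
    by (auto simp: f_def s_def nth_append nth_Cons transpose_def split: nat.splits)
  have less: "f p < f q" if "p < q" "(p, q) \<noteq> (s, Suc s)" for p q
    using that by (auto simp: f_def transpose_def)
  have "kinc k (a @ [v, u] @ b) (f ` A) (c \<circ> f)"
    unfolding kinc_def
  proof (intro conjI ballI impI)
    have "f p < length (a @ [v, u] @ b)" if "p < length (a @ [u, v] @ b)" for p
      using that by (auto simp: f_def transpose_def s_def)
    then show "f ` A \<subseteq> {..<length (a @ [v, u] @ b)}" using K unfolding kinc_def by blast
  next
    fix p assume "p \<in> f ` A"
    then show "(c \<circ> f) p < k" using K by (auto simp: kinc_def ff)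
  next
    fix p q assume "p \<in> f ` A" "q \<in> f ` A" and pq: "p < q" "(c \<circ> f) p = (c \<circ> f) q"
    then have A: "f p \<in> A" "f q \<in> A" by (auto simp: ff)
    have "(p, q) \<noteq> (s, Suc s)"
      using A pq ne by (auto simp: f_def s_def)
    then have "f p < f q" using less pq by blast
    then have "(a @ [u, v] @ b) ! f p \<le> (a @ [u, v] @ b) ! f q"
      using A pq K by (auto simp: kinc_def)
    then show "(a @ [v, u] @ b) ! p \<le> (a @ [v, u] @ b) ! q"
      using nth[of "f p"] nth[of "f q"] ff by simp
  qed
  moreover have "card (f ` A) = card A"
    by (rule card_image) (metis ff inj_onI)
  ultimately show ?thesis by metis
qed

text \<open>If \<open>x\<close> and \<open>z\<close> have the same colour, then \<open>y\<close> replaces \<open>x\<close>, or, if \<open>y\<close> is in use already, the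
  ends of the two colour classes are exchanged.\<close>

lemma kinc_k1:
  assumes xyz: "x < y" "y \<le> z" and K: "kinc k (a @ [y, x, z] @ b) A c"
  shows "\<exists>A' c'. kinc k (a @ [y, z, x] @ b) A' c' \<and> card A = card A'"
proof -
  define p where "p = length a"
  let ?w = "a @ [y, x, z] @ b" and ?w' = "a @ [y, z, x] @ b"
  have nth: "?w ! p = y" "?w ! Suc p = x" "?w ! Suc (Suc p) = z"
    "?w' ! p = y" "?w' ! Suc p = z" "?w' ! Suc (Suc p) = x"
    by (simp_all add: p_def nth_append)
  have nth': "?w' ! q = ?w ! q" if "q < p \<or> Suc (Suc p) < q" for q
    using that by (auto simp: p_def nth_append nth_Cons split: nat.splits)
  have len: "length ?w' = length ?w" by simp
  have inc: "?w ! q \<le> ?w ! r" if "q \<in> A" "r \<in> A" "q < r" "c q = c r" for q r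
    using that K by (auto simp: kinc_def)
  have AL: "A \<subseteq> {..<length ?w}" and ck: "\<And>q. q \<in> A \<Longrightarrow> c q < k"
    using K by (auto simp: kinc_def)
  have fin: "finite A" using K by (rule kinc_finite)
  have tri: "q < p \<or> q = p \<or> q = Suc p \<or> q = Suc (Suc p) \<or> Suc (Suc p) < q" for q
    by linarith
  show ?thesis
  proof (cases "Suc p \<in> A \<and> Suc (Suc p) \<in> A \<and> c (Suc p) = c (Suc (Suc p))")
    case False
    then show ?thesis using kinc_swap[of k "a @ [y]" x z b A c] K by (simp add: p_def)
  next
    case True
    show ?thesis
    proof (cases "p \<in> A")
      case False
      \<comment> \<open>\<open>y\<close> is free and takes over from \<open>x\<close>: in the new
        word the positions \<open>p\<close> and \<open>Suc p\<close> carry \<open>y\<close> and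
        \<open>z\<close>, while \<open>x\<close> has moved to the position that is given up.\<close>
      define A' where "A' = insert p (A - {Suc (Suc p)})"
      define c' where "c' = c(p := c (Suc p))"
      have "kinc k ?w' A' c'"
        unfolding kinc_def
      proof (intro conjI ballI impI)
        show "A' \<subseteq> {..<length ?w'}" using AL by (auto simp: A'_def p_def)
        show "c' q < k" if "q \<in> A'" for q using that ck True by (auto simp: A'_def c'_def)
        fix q r assume qr: "q \<in> A'" "r \<in> A'" "q < r" "c' q = c' r"
        consider "q < p" "r < p" | "q < p" "r = p \<or> r = Suc p" | "q = p" "r = Suc p"
          | "q = p \<or> q = Suc p" "Suc (Suc p) < r" | "q < p" "Suc (Suc p) < r"
          | "Suc (Suc p) < q" "Suc (Suc p) < r"
          using qr by (force simp: A'_def)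
        then show "?w' ! q \<le> ?w' ! r"
        proof cases
          case 1
          then show ?thesis using qr inc[of q r] nth' by (auto simp: A'_def c'_def)
        next
          case 2
          then have "?w ! q \<le> x" using qr inc[of q "Suc p"] True nth by (auto simp: A'_def c'_def)
          then show ?thesis using 2 nth nth' xyz by auto
        next
          case 3
          then show ?thesis using nth xyz by auto
        next
          case 4
          then have "z \<le> ?w ! r" using qr inc[of "Suc (Suc p)" r] True nth
            by (auto simp: A'_def c'_def)
          then show ?thesis using 4 nth nth' xyz by auto
        next
          case 5
          then show ?thesis using qr inc[of q r] nth' by (auto simp: A'_def c'_def)
        next
          case 6
          then show ?thesis using qr inc[of q r] nth' by (auto simp: A'_def c'_def)
        qed
      qed
      moreover have "card A = card A'"
        using fin True False card.remove[of A "Suc (Suc p)"] by (simp add: A'_def)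
      ultimately show ?thesis by blast
    next
      case p: True
      define C where "C = c (Suc p)"
      define D where "D = c p"
      have CD: "C \<noteq> D"
        using inc[OF p conjunct1[OF True]] nth xyz by (auto simp: C_def D_def)
      \<comment> \<open>Colour \<open>D\<close> now runs through its old beginning,
        \<open>y\<close>, \<open>z\<close> and the old end of \<open>C\<close>; colour
        \<open>C\<close> runs through its old beginning, \<open>x\<close> and the old end of
        \<open>D\<close>.\<close>
      define c' where "c' q = (if q < p then c q else if q \<le> Suc p then D
        else if q = Suc (Suc p) then C else Transposition.transpose C D (c q))" for q
      have Ck: "C < k" "D < k" using ck True p by (auto simp: C_def D_def)
      have "kinc k ?w' A c'"
        unfolding kinc_def
      proof (intro conjI ballI impI)
        show "A \<subseteq> {..<length ?w'}" using AL by auto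
        show "c' q < k" if "q \<in> A" for q using that ck Ck by (auto simp: c'_def transpose_def)
        fix q r assume qr: "q \<in> A" "r \<in> A" "q < r" "c' q = c' r"
        have lo: "?w ! q \<le> x" if "q < p" "c q = C"
          using inc[of q "Suc p"] that True qr nth by (auto simp: C_def)
        have lo': "?w ! q \<le> y" if "q < p" "c q = D"
          using inc[of q p] that p qr nth by (auto simp: D_def)
        have hi: "z \<le> ?w ! r" if "Suc (Suc p) < r" "c r = C"
          using inc[of "Suc (Suc p)" r] that True qr nth by (auto simp: C_def)
        have hi': "y \<le> ?w ! r" if "Suc (Suc p) < r" "c r = D"
          using inc[of p r] that p qr nth by (auto simp: D_def)
        have "q < p \<and> r < p \<or> q < p \<and> (r = p \<or> r = Suc p) \<or> q < p \<and> r = Suc (Suc p)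
          \<or> q = p \<and> r = Suc p \<or> (q = p \<or> q = Suc p) \<and> r = Suc (Suc p)
          \<or> (q = p \<or> q = Suc p) \<and> Suc (Suc p) < r
          \<or> q = Suc (Suc p) \<and> Suc (Suc p) < r \<or> q < p \<and> Suc (Suc p) < r
          \<or> Suc (Suc p) < q \<and> Suc (Suc p) < r"
          using tri[of q] tri[of r] qr(3) by (elim disjE) simp_all
        then consider "q < p" "r < p" | "q < p" "r = p \<or> r = Suc p" | "q < p" "r = Suc (Suc p)"
          | "q = p" "r = Suc p" | "q = p \<or> q = Suc p" "r = Suc (Suc p)"
          | "q = p \<or> q = Suc p" "Suc (Suc p) < r"
          | "q = Suc (Suc p)" "Suc (Suc p) < r" | "q < p" "Suc (Suc p) < r"
          | "Suc (Suc p) < q" "Suc (Suc p) < r"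
          by blast
        then show "?w' ! q \<le> ?w' ! r"
        proof cases
          case 1
          then show ?thesis using qr inc[of q r] nth' by (auto simp: c'_def)
        next
          case 2
          then have "?w ! q \<le> y" using lo' qr by (auto simp: c'_def)
          then show ?thesis using 2 nth nth' xyz by auto
        next
          case 3
          then have "?w ! q \<le> x" using lo qr by (auto simp: c'_def)
          then show ?thesis using 3 nth nth' xyz by auto
        next
          case 4
          then show ?thesis using nth xyz by auto
        next
          case 5
          then show ?thesis using qr CD by (auto simp: c'_def)
        next
          case 6
          then have "c r = C" using qr CD by (auto simp: c'_def transpose_def split: if_splits)
          then show ?thesis using 6 hi nth nth' xyz by auto
        next
          case 7
          then have "c r = D" using qr CD by (auto simp: c'_def transpose_def split: if_splits)
          then show ?thesis using 7 hi' nth nth' xyz by auto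
        next
          case 8
          then consider "c q = c r" "c r \<noteq> C" "c r \<noteq> D" | "c q = D" "c r = C" | "c q = C" "c r = D"
            using qr CD by (auto simp: c'_def transpose_def split: if_splits)
          then show ?thesis
          proof cases
            case 1
            then show ?thesis using 8 qr inc[of q r] nth' by auto
          next
            case 2
            then show ?thesis using 8 lo' hi nth' xyz by auto
          next
            case 3
            then show ?thesis using 8 lo hi' nth' xyz by auto
          qed
        next
          case 9
          then have "c q = c r" using qr by (auto simp: c'_def dest: injD[OF inj_transpose])
          then show ?thesis using 9 qr inc[of q r] nth' by auto
        qed
      qed
      then show ?thesis by blast
    qed
  qed
qed

text \<open>One inequality is \<open>kinc_k1\<close>. For the other a transposition suffices,
  because the descent \<open>z\<close>, \<open>x\<close> never lies in one colour class.\<close>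

lemma greene_k1:
  assumes "x < y" "y \<le> z"
  shows "greene k (a @ [y, z, x] @ b) = greene k (a @ [y, x, z] @ b)"
proof (rule order.antisym; rule greene_leI)
  fix A c assume K: "kinc k (a @ [y, z, x] @ b) A c"
  define p where "p = Suc (length a)"
  have "\<not> (p \<in> A \<and> Suc p \<in> A \<and> c p = c (Suc p))"
  proof
    assume "p \<in> A \<and> Suc p \<in> A \<and> c p = c (Suc p)"
    then have "(a @ [y, z, x] @ b) ! p \<le> (a @ [y, z, x] @ b) ! Suc p"
      using K by (auto simp: kinc_def)
    then show False using assms by (simp add: p_def nth_append)
  qed
  then show "\<exists>A' c'. kinc k (a @ [y, x, z] @ b) A' c' \<and> card A = card A'"
    using kinc_swap[of k "a @ [y]" z x b A c] K by (simp add: p_def)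
qed (use assms kinc_k1 in blast)

lemma greene_kstep:
  assumes "kstep u v"
  shows "greene k u = greene k v"
  using assms
proof cases
  case (k1 x y z a b)
  then show ?thesis using greene_k1 by simp
next
  case (k2 x y z a b)
  define n where "n = Max (set u)"
  have "set v = set u" using k2 by auto
  then have n: "set u \<subseteq> {..n}" "set v \<subseteq> {..n}" by (auto simp: n_def)
  \<comment> \<open>\<open>star\<close> turns this instance of \<open>k2\<close> into one of
    \<open>k1\<close>, so a single exchange argument covers both relations.\<close>
  have "greene k (star n b @ [n - y, n - z, n - x] @ star n a) =
      greene k (star n b @ [n - y, n - x, n - z] @ star n a)"
    using k2 n by (intro greene_k1[symmetric]) auto
  then have "greene k (star n u) = greene k (star n v)"
    using k2 by (simp add: star_def)
  then show ?thesis using n by (simp add: greene_star)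
qed

lemma greene_knuth: "u \<approx> v \<Longrightarrow> greene k u = greene k v"
  by (erule knuth_invariant) (rule greene_kstep)

section \<open>Greene's numbers of products\<close>

lemma greene_append_le: "greene k (u @ v) \<le> greene k u + greene k v"
proof (rule greene_le)
  fix A c assume K: "kinc k (u @ v) A c"
  define B where "B = {p \<in> A. p < length u}"
  define C where "C = {p. p + length u \<in> A}"
  have "kinc k u B c"
    unfolding kinc_def
  proof (intro conjI ballI impI)
    fix p q assume pq: "p \<in> B" "q \<in> B" "p < q" "c p = c q"
    then have "(u @ v) ! p \<le> (u @ v) ! q" using K by (auto simp: kinc_def B_def)
    then show "u ! p \<le> u ! q" using pq by (auto simp: nth_append B_def)
  qed (use K in \<open>auto simp: kinc_def B_def\<close>)
  moreover have "kinc k v C (\<lambda>p. c (p + length u))"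
    unfolding kinc_def
  proof (intro conjI ballI impI)
    fix p q assume pq: "p \<in> C" "q \<in> C" "p < q" "c (p + length u) = c (q + length u)"
    then have "(u @ v) ! (p + length u) \<le> (u @ v) ! (q + length u)"
      using K by (auto simp: kinc_def C_def)
    then show "v ! p \<le> v ! q" by (simp add: nth_append)
  qed (use K in \<open>auto simp: kinc_def C_def\<close>)
  moreover have "A = B \<union> (\<lambda>p. p + length u) ` C"
  proof -
    have "p \<in> (\<lambda>p. p + length u) ` C" if "p \<in> A" "\<not> p < length u" for p
      by (rule image_eqI[of _ _ "p - length u"]) (use that in \<open>auto simp: C_def\<close>)
    then show ?thesis by (auto simp: B_def C_def)
  qed
  then have "card A \<le> card B + card ((\<lambda>p. p + length u) ` C)" by (simp add: card_Un_le)
  moreover have "card ((\<lambda>p. p + length u) ` C) = card C"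
    by (rule card_image) (auto simp: inj_on_def)
  ultimately show "card A \<le> greene k u + greene k v"
    using kinc_le_greene by (metis add_mono order_trans)
qed

lemma greene_le_length: "greene k w \<le> length w"
  by (rule greene_le) (metis kinc_def card_lessThan card_mono finite_lessThan)

lemma greene_decreasing:
  assumes "sorted_wrt (>) w"
  shows "greene k w \<le> min k (length w)"
proof (rule greene_le)
  fix A c assume K: "kinc k w A c"
  have "inj_on c A"
  proof (rule inj_onI)
    fix p q assume pq: "p \<in> A" "q \<in> A" "c p = c q"
    have "\<not> r < s" if "r \<in> A" "s \<in> A" "c r = c s" for r s
    proof
      assume "r < s"
      moreover have "s < length w" using K that by (auto simp: kinc_def)
      ultimately have "w ! s < w ! r" using assms by (auto simp: sorted_wrt_iff_nth_less)
      moreover have "w ! r \<le> w ! s" using K that \<open>r < s\<close> by (auto simp: kinc_def)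
      ultimately show False by simp
    qed
    then show "p = q" using pq by (metis nat_neq_iff)
  qed
  moreover have "c ` A \<subseteq> {..<k}" using K by (auto simp: kinc_def)
  ultimately have "card A \<le> k" by (metis card_image card_lessThan card_mono finite_lessThan)
  moreover have "card A \<le> length w"
    using K by (metis kinc_def card_lessThan card_mono finite_lessThan)
  ultimately show "card A \<le> min k (length w)" by simp
qed

lemma kinc_exists: "\<exists>A c. kinc k w A c \<and> card A = greene k w"
proof -
  have "kinc k w {} (\<lambda>_. 0)" by (simp add: kinc_def)
  then have "{card A |A. \<exists>c. kinc k w A c} \<noteq> {}" by auto
  then show ?thesis using Max_in[OF greene_finite[of k w]] unfolding greene_def by auto
qed

text \<open>The whole of \<open>u\<close> becomes one further class, with the new colour
  \<open>k\<close>.\<close>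

lemma greene_append_row:
  assumes "sorted u"
  shows "greene k w + length u \<le> greene (Suc k) (w @ u)"
proof -
  obtain A c where K: "kinc k w A c" "card A = greene k w" using kinc_exists by blast
  define A' where "A' = A \<union> {length w..<length w + length u}"
  define c' where "c' p = (if p < length w then c p else k)" for p
  have A: "p < length w" "c p < k" if "p \<in> A" for p using K that by (auto simp: kinc_def)
  have "kinc (Suc k) (w @ u) A' c'"
    unfolding kinc_def
  proof (intro conjI ballI impI)
    have "p < length w + length u" if "p \<in> A'" for p using that A[of p] by (auto simp: A'_def)
    then show "A' \<subseteq> {..<length (w @ u)}" by auto
    show "c' p < Suc k" if "p \<in> A'" for p
      using A[of p] that by (auto simp: A'_def c'_def)
    fix p q assume pq: "p \<in> A'" "q \<in> A'" "p < q" "c' p = c' q"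
    show "(w @ u) ! p \<le> (w @ u) ! q"
    proof (cases "p < length w")
      case True
      then have "p \<in> A" "q < length w" using pq A[of p]
          by (auto simp: A'_def c'_def split: if_splits)
      then show ?thesis using True pq K by (auto simp: A'_def c'_def kinc_def nth_append)
    next
      case False
      then show ?thesis using pq A[of p] A[of q] assms
        by (auto simp: A'_def nth_append intro!: sorted_nth_mono)
    qed
  qed
  moreover have "card A' = greene k w + length u"
    unfolding A'_def using A K kinc_finite[OF K(1)] by (subst card_Un_disjoint) force+
  ultimately show ?thesis by (metis kinc_le_greene)
qed

lemma greene_mono_insert: "greene k (u @ v) \<le> greene k (u @ x @ v)"
proof (rule greene_leI)
  fix A c assume K: "kinc k (u @ v) A c"
  define f where "f p = (if p < length u then p else p + length x)" for p
  define g where "g p = (if p < length u then p else p - length x)" for p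
  have gf: "g (f p) = p" for p by (auto simp: f_def g_def)
  have less: "f p < f q \<longleftrightarrow> p < q" for p q by (auto simp: f_def)
  have nth: "(u @ x @ v) ! f p = (u @ v) ! p" for p by (auto simp: f_def nth_append)
  have "kinc k (u @ x @ v) (f ` A) (c \<circ> g)"
    unfolding kinc_def
  proof (intro conjI ballI impI)
    show "f ` A \<subseteq> {..<length (u @ x @ v)}" using K by (auto simp: kinc_def f_def)
  qed (use K in \<open>auto simp: kinc_def gf less nth\<close>)
  moreover have "card (f ` A) = card A" by (rule card_image) (metis gf inj_onI)
  ultimately show "\<exists>A' c'. kinc k (u @ x @ v) A' c' \<and> card A = card A'" by metis
qed

text \<open>A colour class that uses one of the letters \<open>i\<close> cannot use a letter of \<open>t\<close>.\<close>

lemma greene_insert_small: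
  assumes t: "\<forall>x\<in>set t. i < x" and u: "\<forall>x\<in>set u. i < x" "sorted u"
  shows "greene (Suc k) (t @ replicate m i @ u) =
    max (greene (Suc k) (t @ u)) (greene k t + m + length u)"
proof (rule order.antisym)
  let ?w = "t @ replicate m i @ u"
  have "sorted (replicate m i @ u)" using u by (auto simp: sorted_append)
  then show "max (greene (Suc k) (t @ u)) (greene k t + m + length u) \<le> greene (Suc k) ?w"
    using greene_append_row[of "replicate m i @ u" k t] greene_mono_insert[of "Suc k" t u] by simp
  show "greene (Suc k) ?w \<le> max (greene (Suc k) (t @ u)) (greene k t + m + length u)"
  proof (rule greene_le)
    fix A c assume K: "kinc (Suc k) ?w A c"
    have fin: "finite A" using K by (rule kinc_finite)
    define Z where "Z = {length t..<length t + m}"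
    show "card A \<le> max (greene (Suc k) (t @ u)) (greene k t + m + length u)"
    proof (cases "A \<inter> Z = {}")
      case True
      define f where "f p = (if p < length t then p else p - m)" for p
      define g where "g p = (if p < length t then p else p + m)" for p
      have gf: "g (f p) = p" if "p \<in> A" for p
        using True that by (auto simp: f_def g_def Z_def)
      have nth: "(t @ u) ! f p = ?w ! p" if "p \<in> A" for p
        using True that by (auto simp: f_def nth_append Z_def add.commute)
      have less: "p < q" if "f p < f q" "p \<in> A" for p q
        using that True by (auto simp: f_def Z_def split: if_splits)
      have "kinc (Suc k) (t @ u) (f ` A) (c \<circ> g)"
        unfolding kinc_def
      proof (intro conjI ballI impI)
        show "f ` A \<subseteq> {..<length (t @ u)}" using K True by (fastforce simp: kinc_def f_def Z_def)
      qed (use K less in \<open>auto simp: kinc_def gf nth\<close>)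
      moreover have "card (f ` A) = card A" by (rule card_image) (metis gf inj_onI)
      ultimately show ?thesis by (metis kinc_le_greene le_max_iff_disj)
    next
      case False
      then obtain p where p: "p \<in> A" "p \<in> Z" by blast
      define B where "B = {q \<in> A. q < length t}"
      \<comment> \<open>No letter of \<open>t\<close> has the colour of \<open>p\<close>, so this
        colour is free to replace colour \<open>k\<close> there, and \<open>k\<close> colours are
        enough on \<open>t\<close>.\<close>
      define c' where "c' q = (if c q = k then c p else c q)" for q
      have ne: "c q \<noteq> c p" if "q \<in> B" for q
      proof
        assume "c q = c p"
        moreover have "q < p" using that p by (auto simp: B_def Z_def)
        ultimately have "?w ! q \<le> ?w ! p" using K p that by (auto simp: kinc_def B_def)
        moreover have "?w ! p = i" using p by (auto simp: Z_def nth_append)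
        moreover have "?w ! q > i" using t that by (auto simp: B_def nth_append)
        ultimately show False by simp
      qed
      have cp: "c p < Suc k" using K p by (auto simp: kinc_def)
      have "kinc k t B c'"
        unfolding kinc_def
      proof (intro conjI ballI impI)
        show "B \<subseteq> {..<length t}" by (auto simp: B_def)
        fix q assume q: "q \<in> B"
        then have "c q < Suc k" using K by (auto simp: kinc_def B_def)
        then show "c' q < k" using ne[OF q] cp by (auto simp: c'_def)
      next
        fix q r assume qr: "q \<in> B" "r \<in> B" "q < r" "c' q = c' r"
        then have "c q = c r" using ne by (auto simp: c'_def split: if_splits)
        then have "?w ! q \<le> ?w ! r" using K qr by (auto simp: kinc_def B_def)
        then show "t ! q \<le> t ! r" using qr by (auto simp: B_def nth_append)
      qed
      then have "card B \<le> greene k t" by (rule kinc_le_greene)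
      moreover have "A \<subseteq> B \<union> {length t..<length t + m + length u}"
        using K by (auto simp: B_def kinc_def)
      moreover have "finite B" using fin by (simp add: B_def)
      ultimately have "card A \<le> greene k t + card {length t..<length t + m + length u}"
        by (meson add_mono card_Un_le card_mono finite_UnI finite_atLeastLessThan order.trans
            order.refl)
      then show ?thesis by simp
    qed
  qed
qed

section \<open>Tableaux as lists of rows\<close>

definition over :: "nat list \<Rightarrow> nat list \<Rightarrow> bool" where
  "over R S \<longleftrightarrow> length S \<le> length R \<and> (\<forall>j<length S. R ! j < S ! j)"

definition first_row :: "nat list list \<Rightarrow> nat list" where
  "first_row L = (if L = [] then [] else hd L)"

text \<open>Empty rows at the bottom are permitted in \<open>wtab\<close>, so that restricting the entries of all
  rows, or deleting the first column, stays within \<open>wtab\<close>.\<close>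

fun wtab :: "nat list list \<Rightarrow> bool" where
  "wtab [] = True"
| "wtab (R # L) = (sorted R \<and> over R (first_row L) \<and> wtab L)"

definition tab :: "nat list list \<Rightarrow> bool" where
  "tab L \<longleftrightarrow> wtab L \<and> [] \<notin> set L"

definition word :: "nat list list \<Rightarrow> nat list" where
  "word L = concat (rev L)"

text \<open>Rows of \<open>L\<close> are counted from 0, unlike the rows of a \<^typ>\<open>tableau\<close>.\<close>

definition sh :: "nat list list \<Rightarrow> nat \<Rightarrow> nat" where
  "sh L i = (if i < length L then length (L ! i) else 0)"

lemma sh_simps [simp]: "sh [] i = 0" "sh (R # L) 0 = length R" "sh (R # L) (Suc i) = sh L i"
  by (simp_all add: sh_def)

lemma first_row_simps [simp]: "first_row [] = []" "first_row (R # L) = R"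
  by (simp_all add: first_row_def)

lemma length_first_row: "length (first_row L) = sh L 0"
  by (cases L) simp_all

lemma word_simps [simp]: "word [] = []" "word (R # L) = word L @ R" "word (L @ [R]) = R @ word L"
  by (simp_all add: word_def)

lemma set_word: "set (word L) = (\<Union>R\<in>set L. set R)"
  by (simp add: word_def)

lemma over_Nil [simp]: "over R []" "over [] S \<longleftrightarrow> S = []"
  by (auto simp: over_def)

lemma wtab_empty: "wtab (R # L) \<Longrightarrow> R = [] \<Longrightarrow> S \<in> set L \<Longrightarrow> S = []"
  by (induction L arbitrary: R) auto

lemma wtab_snoc: "wtab (L @ [R]) \<longleftrightarrow> wtab L \<and> sorted R \<and> (L \<noteq> [] \<longrightarrow> over (last L) R)"
  by (induction L) (auto simp: first_row_def hd_append)

lemma wtab_sorted: "wtab L \<Longrightarrow> R \<in> set L \<Longrightarrow> sorted R"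
  by (induction L) auto

lemma wtab_sh_antimono: "wtab L \<Longrightarrow> sh L (Suc i) \<le> sh L i"
proof (induction L arbitrary: i)
  case (Cons R L)
  then show ?case by (cases i) (auto simp: over_def length_first_row)
qed simp

lemma filter_le_sorted: "sorted R \<Longrightarrow> filter (\<lambda>x. x \<le> k) R = takeWhile (\<lambda>x. x \<le> (k::nat)) R"
proof (induction R)
  case (Cons x R)
  then have "takeWhile (\<lambda>x. x \<le> k) R = []" if "k < x" using that by (cases R) auto
  then show ?case using Cons by auto
qed simp

text \<open>In sorted rows the letters up to \<open>k\<close> form a prefix, and the entry above a
  kept entry is smaller, hence kept as well.\<close>

lemma over_filter:
  assumes "over R S" "sorted R" "sorted S"
  shows "over (filter (\<lambda>x. x \<le> k) R) (filter (\<lambda>x. x \<le> k) S)"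
proof -
  let ?t = "takeWhile (\<lambda>x. x \<le> k)"
  have S: "?t S ! j = S ! j" "S ! j \<le> k" "j < length S" if "j < length (?t S)" for j
    using that length_takeWhile_le[of "\<lambda>x. x \<le> k" S] nth_mem[OF that]
    by (auto simp: takeWhile_nth dest: set_takeWhileD)
  have R: "R ! j < S ! j" if "j < length (?t S)" for j
    using S(3)[OF that] assms by (auto simp: over_def)
  have le: "length (?t S) \<le> length (?t R)"
  proof (rule length_takeWhile_less_P_nth)
    show "R ! i \<le> k" if "i < length (?t S)" for i using R[OF that] S(2)[OF that] by simp
    show "length (?t S) \<le> length R"
      using assms length_takeWhile_le[of "\<lambda>x. x \<le> k" S] by (auto simp: over_def)
  qed
  then have "?t R ! j < ?t S ! j" if "j < length (?t S)" for j
    using R[OF that] S(1)[OF that] that by (simp add: takeWhile_nth)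
  then show ?thesis using le assms by (simp add: filter_le_sorted over_def)
qed

lemma first_row_map: "f [] = [] \<Longrightarrow> first_row (map f L) = f (first_row L)"
  by (cases L) auto

lemma wtab_filter: "wtab L \<Longrightarrow> wtab (map (filter (\<lambda>x. x \<le> k)) L)"
proof (induction L)
  case (Cons R L)
  have "sorted (first_row L)" using Cons.prems by (cases L) auto
  then show ?case using Cons by (auto simp: first_row_map over_filter sorted_filter[where f = id,
      simplified])
qed simp

lemma word_filter: "word (map (filter Q) L) = filter Q (word L)"
  by (induction L) auto

section \<open>Peeling off the first column\<close>

definition heads :: "nat list list \<Rightarrow> nat list" where
  "heads L = map hd (filter (\<lambda>R. R \<noteq> []) L)"

lemma wtab_tl: "wtab L \<Longrightarrow> wtab (map tl L)"
proof (induction L)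
  case (Cons R L)
  have "over (tl R) (tl (first_row L))"
    using Cons.prems by (auto simp: over_def nth_tl less_diff_conv)
  then show ?case using Cons by (auto simp: first_row_map sorted_tl)
qed simp

lemma heads_Cons [simp]: "heads ([] # L) = heads L" "heads ((x # R) # L) = x # heads L"
  by (simp_all add: heads_def)

lemma heads_strict: "wtab L \<Longrightarrow> sorted_wrt (<) (heads L)"
proof (induction L)
  case (Cons R L)
  show ?case
  proof (cases R)
    case Nil
    then have "heads L = []" using wtab_empty[OF Cons.prems]
        by (auto simp: heads_def filter_empty_conv)
    then show ?thesis using Nil by simp
  next
    case (Cons x R')
    have IH: "sorted_wrt (<) (heads L)" using Cons.IH Cons.prems by simp
    have "x < y" if "y \<in> set (heads L)" for y
    proof (cases L)
      case Nil
      then show ?thesis using that by (simp add: heads_def)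
    next
      case L: (Cons S L')
      show ?thesis
      proof (cases S)
        case Nil
        then have "heads L = []"
          using wtab_empty[of S L'] Cons.prems L by (auto simp: heads_def filter_empty_conv)
        then show ?thesis using that by simp
      next
        case (Cons z S')
        then have "x < z" using Cons.prems \<open>R = x # R'\<close> L by (auto simp: over_def)
        then show ?thesis using that IH Cons L by auto
      qed
    qed
    then show ?thesis using IH Cons by simp
  qed
qed (simp add: heads_def)

text \<open>The letters of the decreasing word \<open>C\<close> jump over the row \<open>R\<close>
  one at a time. The letter in front of \<open>R\<close> makes the jump possible; once
  \<open>x\<close> has jumped, it plays this part for the next letter.\<close>

lemma knuth_move_column:
  assumes "sorted R" "\<forall>b\<in>set R. y \<le> b" "sorted_wrt (>) (y # C)"
  shows "y # R @ C \<approx> y # C @ R"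
  using assms
proof (induction C arbitrary: y)
  case (Cons x C)
  have "(y # R @ [x]) @ C \<approx> (y # x # R) @ C"
    using Cons.prems by (intro knuth_append knuth_move_left) auto
  also have "(y # x # R) @ C = y # (x # R @ C)" by simp
  also have "y # (x # R @ C) \<approx> y # (x # C @ R)"
    using Cons.prems by (intro knuth_Cons Cons.IH) force+
  finally show ?case by simp
qed simp

lemma knuth_column: "wtab L \<Longrightarrow> word L \<approx> rev (heads L) @ word (map tl L)"
proof (induction L rule: rev_induct)
  case (snoc R L)
  have w: "wtab L" "sorted R" "L \<noteq> [] \<longrightarrow> over (last L) R" using snoc.prems by (auto simp: wtab_snoc)
  show ?case
  proof (cases R)
    case Nil
    then show ?thesis using snoc w by (simp add: heads_def)
  next
    case (Cons y R')
    have h: "heads (L @ [R]) = heads L @ [y]" using Cons by (simp add: heads_def)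
    then have "sorted_wrt (<) (heads L @ [y])" using heads_strict[OF snoc.prems] by simp
    then have dec: "sorted_wrt (>) (y # rev (heads L))"
        by (auto simp: sorted_wrt_append sorted_wrt_rev)
    have "word (L @ [R]) = (y # R') @ word L" using Cons by simp
    also have "(y # R') @ word L \<approx> (y # R') @ (rev (heads L) @ word (map tl L))"
      using snoc.IH w by (intro knuth_append) auto
    also have "(y # R') @ (rev (heads L) @ word (map tl L)) = (y # R' @ rev (heads L)) @
        word (map tl L)"
      by simp
    also have "(y # R' @ rev (heads L)) @ word (map tl L) \<approx> (y # rev (heads L) @ R') @
        word (map tl L)"
      using w Cons dec by (intro knuth_append knuth_move_column) auto
    finally show ?thesis using h Cons by simp
  qed
qed (simp add: heads_def)

lemma sum_sh_column:
  "wtab L \<Longrightarrow> min k (length (heads L)) + (\<Sum>i<k. sh (map tl L) i) = (\<Sum>i<k. sh L i)"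
proof (induction L arbitrary: k)
  case (Cons R L)
  show ?case
  proof (cases R)
    case Nil
    then have "\<forall>S\<in>set L. S = []" using wtab_empty[OF Cons.prems] by auto
    then have "heads (R # L) = []" using Nil by (auto simp: heads_def filter_empty_conv)
    moreover have nth: "L ! j = []" if "j < length L" for j
      using that \<open>\<forall>S\<in>set L. S = []\<close> nth_mem by blast
    moreover have "sh (R # L) i = 0" for i
      using Nil nth by (cases i) (simp_all add: sh_def)
    moreover have "sh (map tl (R # L)) i = 0" for i
      using Nil nth by (cases i) (simp_all add: sh_def)
    ultimately show ?thesis by simp
  next
    case R: (Cons x R')
    show ?thesis
    proof (cases k)
      case (Suc k')
      then show ?thesis using Cons.IH[of k'] Cons.prems R
        by (simp add: sum.lessThan_Suc_shift del: sum.lessThan_Suc)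
    qed simp
  qed
qed (simp add: heads_def)

text \<open>Greene's theorem for tableau words. The first \<open>k\<close> rows are increasing and
  give the lower bound. For the upper bound the columns are peeled off: a strictly decreasing word
  meets each class at most once, so a column of height \<open>h\<close> contributes at most
  \<open>min k h\<close>.\<close>

lemma greene_word:
  assumes "wtab L"
  shows "greene k (word L) = (\<Sum>i<k. sh L i)"
proof (rule order.antisym)
  show "greene k (word L) \<le> (\<Sum>i<k. sh L i)"
    using assms
  proof (induction "length (word L)" arbitrary: L rule: less_induct)
    case less
    show ?case
    proof (cases "heads L = []")
      case True
      then have "word L = []" by (auto simp: heads_def filter_empty_conv word_def)
      then show ?thesis using greene_le_length[of k "word L"] by simp
    next
      case False
      have kn: "word L \<approx> rev (heads L) @ word (map tl L)" using less.prems by (rule knuth_column)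
      then have "length (word (map tl L)) < length (word L)"
        using knuth_length[OF kn] False by simp
      then have "greene k (word (map tl L)) \<le> (\<Sum>i<k. sh (map tl L) i)"
        using less by (simp add: wtab_tl)
      moreover have "greene k (rev (heads L)) \<le> min k (length (heads L))"
        using greene_decreasing[of "rev (heads L)" k] heads_strict[OF less.prems]
        by (simp add: sorted_wrt_rev del: min.bounded_iff)
      moreover have "greene k (word L) \<le> greene k (rev (heads L)) + greene k (word (map tl L))"
        using greene_knuth[OF kn] greene_append_le by simp
      ultimately show ?thesis using sum_sh_column[OF less.prems, of k] by linarith
    qed
  qed
  show "(\<Sum>i<k. sh L i) \<le> greene k (word L)"
    using assms
  proof (induction L arbitrary: k)
    case (Cons R L)
    show ?case
    proof (cases k)
      case (Suc k')
      then show ?thesis using Cons.IH[of k'] Cons.prems greene_append_row[of R k' "word L"]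
        by (simp add: sum.lessThan_Suc_shift del: sum.lessThan_Suc)
    qed simp
  qed simp
qed

lemma sh_eqI:
  assumes "wtab L" "wtab L'" "\<And>k. greene k (word L) = greene k (word L')"
  shows "sh L = sh L'"
proof
  fix i
  show "sh L i = sh L' i"
    using assms(3)[of "Suc i"] assms(3)[of i] by (simp add: greene_word assms(1,2))
qed

lemma sh_knuth: "wtab L \<Longrightarrow> wtab L' \<Longrightarrow> word L \<approx> word L' \<Longrightarrow> sh L = sh L'"
  by (rule sh_eqI) (auto intro: greene_knuth)

section \<open>Uniqueness of the tableau in a Knuth class\<close>

lemma sorted_eqI:
  assumes "sorted xs" "sorted ys"
    "\<And>k::nat. length (filter (\<lambda>x. x \<le> k) xs) = length (filter (\<lambda>x. x \<le> k) ys)"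
  shows "xs = ys"
  using assms
proof (induction xs arbitrary: ys)
  case Nil
  show ?case
  proof (cases ys)
    case (Cons y ys')
    then show ?thesis using Nil(3)[of y] by simp
  qed simp
next
  case (Cons x xs)
  show ?case
  proof (cases ys)
    case Nil
    then show ?thesis using Cons.prems(3)[of x] by simp
  next
    case ys: (Cons y ys')
    have "filter (\<lambda>z. z \<le> x) ys \<noteq> []" "filter (\<lambda>z. z \<le> y) (x # xs) \<noteq> []"
      using Cons.prems(3)[of x] Cons.prems(3)[of y] ys by (auto simp del: filter.simps) auto
    then obtain a b where "a \<in> set ys" "a \<le> x" "b \<in> set (x # xs)" "b \<le> y"
      by (metis filter_empty_conv)
    then have "x = y" using Cons.prems(1,2) ys by fastforce
    moreover have "xs = ys'"
    proof (rule Cons.IH)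
      fix k show "length (filter (\<lambda>x. x \<le> k) xs) = length (filter (\<lambda>x. x \<le> k) ys')"
        using Cons.prems(3)[of k] ys \<open>x = y\<close> by (simp split: if_splits)
    qed (use Cons.prems ys in auto)
    ultimately show ?thesis using ys by simp
  qed
qed

lemma tab_wtab: "tab L \<Longrightarrow> wtab L"
  by (simp add: tab_def)

lemma tab_length: "tab L \<Longrightarrow> i < length L \<longleftrightarrow> 0 < sh L i"
  by (auto simp: tab_def sh_def) (metis nth_mem)

text \<open>The shapes of the restrictions to letters up to \<open>k\<close> determine a tableau,
  and Greene's numbers determine these shapes. The hypothesis speaks of numbers instead of Knuth
  classes, so that the lemma can also prove words equivalent, as in
  \<open>knuth_add_max\<close>.\<close>

lemma tab_eqI:
  assumes "tab L" "tab L'" and "sh L = sh L'"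
    and gr: "\<And>k j. greene j (filter (\<lambda>x. x \<le> k) (word L)) = greene j (filter (\<lambda>x. x \<le> k) (word L'))"
  shows "L = L'"
proof -
  have w: "wtab L" "wtab L'" using assms by (auto simp: tab_def)
  have len: "length L = length L'"
    using tab_length[OF assms(1)] tab_length[OF assms(2)] assms(3) by (metis nat_neq_iff)
  show ?thesis
  proof (rule nth_equalityI[OF len])
    fix i assume i: "i < length L"
    show "L ! i = L' ! i"
    proof (rule sorted_eqI)
      show "sorted (L ! i)" "sorted (L' ! i)" using w i len by (auto intro: wtab_sorted)
      fix k
      let ?f = "filter (\<lambda>x. x \<le> (k::nat))"
      have "sh (map ?f L) = sh (map ?f L')"
        using w gr by (intro sh_eqI wtab_filter) (auto simp: word_filter)
      then have "sh (map ?f L) i = sh (map ?f L') i" by simp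
      then show "length (?f (L ! i)) = length (?f (L' ! i))"
        using i len by (simp add: sh_def)
    qed
  qed
qed

lemma tab_unique:
  assumes "tab L" "tab L'" "word L \<approx> word L'"
  shows "L = L'"
proof (rule tab_eqI[OF assms(1,2)])
  show "sh L = sh L'" using assms by (intro sh_knuth tab_wtab)
  show "greene j (filter (\<lambda>x. x \<le> k) (word L)) = greene j (filter (\<lambda>x. x \<le> k) (word L'))" for j k
    using assms(3) by (intro greene_knuth knuth_filter) auto
qed

section \<open>Row insertion and the Pieri bijection\<close>

fun bump :: "nat \<Rightarrow> nat list \<Rightarrow> nat list \<times> nat option" where
  "bump x [] = ([x], None)"
| "bump x (y # R) = (if x < y then (x # R, Some y) else (case bump x R of (R', z) \<Rightarrow> (y # R', z)))"

fun rins :: "nat \<Rightarrow> nat list list \<Rightarrow> nat list list" where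
  "rins x [] = [[x]]"
| "rins x (R # L) = (case bump x R of (R', None) \<Rightarrow> R' # L | (R', Some z) \<Rightarrow> R' # rins z L)"

text \<open>The row of the box by which insertion enlarges the shape, counted from 0 as in
  \<open>sh\<close>; see \<open>sh_rins\<close>.\<close>

fun box_row :: "nat \<Rightarrow> nat list list \<Rightarrow> nat" where
  "box_row x [] = 0"
| "box_row x (R # L) = (case bump x R of (R', None) \<Rightarrow> 0 | (R', Some z) \<Rightarrow> Suc (box_row z L))"

lemma bump_append: "\<forall>a\<in>set R. a \<le> x \<Longrightarrow> bump x R = (R @ [x], None)"
  by (induction R) auto

lemma bump_split: "\<forall>a\<in>set A. a \<le> x \<Longrightarrow> x < z \<Longrightarrow> bump x (A @ z # B) = (A @ x # B, Some z)"
  by (induction A) auto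

lemma split_greater:
  obtains "\<forall>a\<in>set R. a \<le> (x::nat)"
  | A z B where "R = A @ z # B" "\<forall>a\<in>set A. a \<le> x" "x < z"
proof (cases "\<forall>a\<in>set R. a \<le> x")
  case False
  then have "\<exists>z\<in>set R. \<not> z \<le> x" by auto
  then obtain A z B where "R = A @ z # B" "\<not> z \<le> x" "\<forall>a\<in>set A. \<not> \<not> a \<le> x"
    using split_list_first_prop[of R "\<lambda>z. \<not> z \<le> x"] by blast
  then show thesis using that(2) by auto
qed (use that in auto)

lemma first_row_rins: "first_row (rins x L) = fst (bump x (first_row L))"
  by (cases L) (auto split: prod.split option.split)

text \<open>The bumped letter \<open>z\<close> lands weakly left of the column it comes from, since
  an entry of \<open>S\<close> directly below its old place exceeds it. At its new place the entry
  above is at most \<open>x\<close>, hence smaller than \<open>z\<close>.\<close>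

lemma over_bump:
  assumes o: "over R S" and R: "R = A @ z # B" "\<forall>a\<in>set A. a \<le> x" "x < z"
  shows "over (A @ x # B) (fst (bump z S))"
proof -
  let ?p = "length A" and ?R' = "A @ x # B"
  have R': "?R' ! j \<le> R ! j" for j
    using R by (auto simp: nth_append nth_Cons split: nat.splits)
  have low: "?R' ! j < z" if "j \<le> ?p" for j
    using R that nth_mem[of j A] by (cases "j = ?p") (fastforce simp: nth_append)+
  have lenR: "length R = length ?R'" and Rp: "R ! ?p = z" using R by auto
  show ?thesis
  proof (cases rule: split_greater[of S z])
    case 1
    then have b: "fst (bump z S) = S @ [z]" by (simp add: bump_append)
    have "length S \<le> ?p"
    proof (rule ccontr)
      assume "\<not> length S \<le> ?p"
      then have "R ! ?p < S ! ?p" "S ! ?p \<in> set S" using o by (auto simp: over_def)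
      then show False using 1 Rp by auto
    qed
    then show ?thesis
      using o lenR R low unfolding b over_def
      by (auto simp: nth_append less_Suc_eq intro: le_less_trans[OF R'[simplified nth_append]])
  next
    case (2 C y D)
    then have b: "fst (bump z S) = C @ z # D" by (simp add: bump_split)
    have q: "length C \<le> ?p"
    proof (rule ccontr)
      assume "\<not> length C \<le> ?p"
      then have "?p < length S" "S ! ?p = C ! ?p" "C ! ?p \<in> set C"
        using 2 by (auto simp: nth_append)
      then have "R ! ?p < C ! ?p" "C ! ?p \<in> set C" using o unfolding over_def by metis+
      then show False using 2 Rp by auto
    qed
    have "?R' ! j < (C @ z # D) ! j" if "j < length S" for j
    proof (cases "j = length C")
      case True
      then show ?thesis using low[OF q] by simp
    next
      case False
      then have "(C @ z # D) ! j = S ! j" using 2 by (auto simp: nth_append nth_Cons split: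
          nat.splits)
      then show ?thesis using o that R'[of j] by (auto simp: over_def intro: le_less_trans)
    qed
    moreover have "length S = length (C @ z # D)" using 2 by simp
    ultimately show ?thesis using o lenR unfolding b over_def by simp
  qed
qed

lemma wtab_rins: "wtab L \<Longrightarrow> wtab (rins x L)"
proof (induction L arbitrary: x)
  case (Cons R L)
  show ?case
  proof (cases rule: split_greater[of R x])
    case 1
    then show ?thesis using Cons.prems
      by (auto simp: bump_append sorted_append over_def nth_append)
  next
    case (2 A z B)
    then have "over (A @ x # B) (first_row (rins z L))"
      using Cons.prems by (auto simp: first_row_rins intro: over_bump)
    moreover have "sorted (A @ x # B)" using 2 Cons.prems by (auto simp: sorted_append)
    ultimately show ?thesis using 2 Cons by (simp add: bump_split)
  qed
qed (simp add: over_def)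

lemma rins_nonempty: "[] \<notin> set L \<Longrightarrow> [] \<notin> set (rins x L)"
proof (induction L arbitrary: x)
  case (Cons R L)
  then show ?case by (cases rule: split_greater[of R x]) (auto simp: bump_append bump_split)
qed simp

lemma tab_rins: "tab L \<Longrightarrow> tab (rins x L)"
  by (simp add: tab_def wtab_rins rins_nonempty)

text \<open>In each row \<open>knuth_bump\<close> brings the bumped letter to the front, which is
  the end of the word of the rows below.\<close>

lemma word_rins: "wtab L \<Longrightarrow> word (rins x L) \<approx> word L @ [x]"
proof (induction L arbitrary: x)
  case (Cons R L)
  show ?case
  proof (cases rule: split_greater[of R x])
    case 1
    then show ?thesis by (simp add: bump_append)
  next
    case (2 A z B)
    have "word (rins z L) @ (A @ x # B) \<approx> (word L @ [z]) @ (A @ x # B)"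
      using Cons by (intro knuth_append) auto
    also have "(word L @ [z]) @ (A @ x # B) = word L @ (z # A @ x # B)" by simp
    also have "word L @ (z # A @ x # B) \<approx> word L @ (A @ z # B @ [x])"
      using 2 Cons.prems by (intro knuth_append knuth_sym[OF knuth_bump]) auto
    finally show ?thesis using 2 by (simp add: bump_split)
  qed
qed simp

lemma sh_rins: "sh (rins x L) = (sh L)(box_row x L := Suc (sh L (box_row x L)))"
proof (induction L arbitrary: x)
  case Nil
  show ?case by (rule ext) (simp add: sh_def)
next
  case (Cons R L)
  show ?case
  proof
    fix i
    show "sh (rins x (R # L)) i = ((sh (R # L))(box_row x (R # L) := Suc (sh (R # L) (box_row x (R
        # L))))) i"
    proof (cases rule: split_greater[of R x])
      case 1
      then show ?thesis by (cases i) (auto simp: bump_append)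
    next
      case (2 A z B)
      then show ?thesis using Cons.IH[of z] by (cases i) (auto simp: bump_split)
    qed
  qed
qed

text \<open>Row bumping lemma: in every row the second letter acts strictly to the right of the
  first, and what it bumps is again at least as large. So its route ends no lower.\<close>

lemma box_row_le: "wtab L \<Longrightarrow> x \<le> y \<Longrightarrow> box_row y (rins x L) \<le> box_row x L"
proof (induction L arbitrary: x y)
  case (Cons R L)
  show ?case
  proof (cases rule: split_greater[of R x])
    case 1
    then have "bump y (R @ [x]) = ((R @ [x]) @ [y], None)"
      using Cons.prems by (intro bump_append) auto
    then show ?thesis using 1 by (simp add: bump_append)
  next
    case (2 A z B)
    show ?thesis
    proof (cases rule: split_greater[of B y])
      case 1
      then have "bump y (A @ x # B) = ((A @ x # B) @ [y], None)"
        using 2 Cons.prems by (intro bump_append) auto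
      then show ?thesis using 2 by (simp add: bump_split)
    next
      case B: (2 C z' D)
      then have "bump y ((A @ x # C) @ z' # D) = ((A @ x # C) @ y # D, Some z')"
        using 2 Cons.prems by (intro bump_split) auto
      moreover have "z \<le> z'" using 2 B Cons.prems by (auto simp: sorted_append)
      ultimately show ?thesis using 2 B Cons.IH[of z z'] Cons.prems by (simp add: bump_split)
    qed
  qed
qed simp

text \<open>The other half of the row bumping lemma: a smaller second letter acts weakly left of the
  first and bumps something smaller, so its route continues strictly further down.\<close>

lemma box_row_less: "y < x \<Longrightarrow> box_row x L < box_row y (rins x L)"
proof (induction L arbitrary: x y)
  case (Cons R L)
  show ?case
  proof (cases rule: split_greater[of R x])
    case 1
    show ?thesis
    proof (cases rule: split_greater[of "R @ [x]" y])
      case 2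
      then show ?thesis using 1 by (simp add: bump_append bump_split)
    qed (use Cons.prems in auto)
  next
    case (2 A z B)
    show ?thesis
    proof (cases rule: split_greater[of "A @ [x]" y])
      case B: (2 C z' D)
      then have "A @ x # B = C @ z' # D @ B" by (metis append_Cons append_Nil append_assoc)
      then have "bump y (A @ x # B) = (C @ y # D @ B, Some z')"
        using B(2,3) by (metis bump_split)
      moreover have "z' \<in> set (A @ [x])" using B by simp
      then have "z' < z" using 2 by auto
      ultimately show ?thesis using 2 Cons.IH[of z' z] by (simp add: bump_split)
    qed (use Cons.prems in auto)
  qed
qed simp

section \<open>Reverse insertion\<close>

lemma rins_surj:
  assumes "tab X" "sh X (Suc k) < sh X k"
  shows "\<exists>L x. tab L \<and> rins x L = X \<and> box_row x L = k"
  using assms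
proof (induction X arbitrary: k)
  case (Cons R' Xs)
  have w: "sorted R'" "over R' (first_row Xs)" "wtab Xs" "R' \<noteq> []" "[] \<notin> set Xs"
    using Cons.prems by (auto simp: tab_def)
  show ?case
  proof (cases k)
    case 0
    obtain R x where R: "R' = R @ [x]" using w by (metis rev_exhaust)
    have bump: "bump x R = (R', None)" using R w by (auto simp: sorted_append intro!: bump_append)
    show ?thesis
    proof (cases "R = []")
      case True
      then have "sh Xs 0 = 0" using Cons.prems 0 R by simp
      then have "Xs = []" using w by (cases Xs) auto
      then show ?thesis using True R 0 by (intro exI[of _ "[]"] exI[of _ x]) (simp add: tab_def)
    next
      case False
      have "sh Xs 0 < length R'" using Cons.prems 0 by simp
      then have "over R (first_row Xs)"
        using w R by (auto simp: over_def nth_append length_first_row)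
      then have "tab (R # Xs)" using w R False by (auto simp: tab_def sorted_append)
      then show ?thesis using bump 0 by (intro exI[of _ "R # Xs"] exI[of _ x]) simp
    qed
  next
    case (Suc k')
    have "tab Xs" using w by (simp add: tab_def)
    then obtain Ts z where T: "tab Ts" "rins z Ts = Xs" "box_row z Ts = k'"
      using Cons.IH[of k'] Cons.prems Suc by auto
    define S where "S = first_row Ts"
    have S': "first_row Xs = fst (bump z S)" using T(2) by (auto simp: first_row_rins S_def)
    have S: "sorted S" using T(1) by (cases Ts) (auto simp: S_def tab_def)
    have "z \<in> set (first_row Xs)"
      unfolding S' by (cases rule: split_greater[of S z]) (auto simp: bump_append bump_split)
    then obtain j where j: "j < length (first_row Xs)" "first_row Xs ! j = z"
      by (metis in_set_conv_nth)
    then have jz: "R' ! j < z" "j < length R'" using w by (auto simp: over_def)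
    then have "\<exists>x\<in>set R'. x < z" by (meson nth_mem)
    \<comment> \<open>Reverse bumping: \<open>z\<close> re-enters this row in place of the last
      letter smaller than it. There is one, because \<open>z\<close> occurs in the row below and the
      entry above it is smaller.\<close>
    then obtain A x B where R': "R' = A @ x # B" "x < z" "\<forall>b\<in>set B. \<not> b < z"
      using split_list_last_prop[of R' "\<lambda>x. x < z"] by blast
    define R where "R = A @ z # B"
    have Ax: "\<forall>a\<in>set A. a \<le> x" using w R' by (auto simp: sorted_append)
    have bump: "bump x R = (R', Some z)" using R' Ax by (simp add: R_def bump_split)
    \<comment> \<open>All letters smaller than \<open>z\<close> lie weakly left of the exchanged
      box. This bounds the column in which \<open>z\<close> was inserted below.\<close>
    have p: "i \<le> length A" if "R' ! i < z" "i < length R'" for i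
    proof (rule ccontr)
      assume "\<not> i \<le> length A"
      then have "R' ! i = B ! (i - Suc (length A))" "i - Suc (length A) < length B"
        using R' that by (auto simp: nth_append nth_Cons split: nat.splits)
      then show False using R'(3) that(1) by (metis nth_mem)
    qed
    have Ri: "R ! i = R' ! i" if "i \<noteq> length A" for i
      using that R' by (auto simp: R_def nth_append nth_Cons split: nat.splits)
    have Rp: "R ! length A = z" by (simp add: R_def)
    have len: "length R = length R'" using R' by (simp add: R_def)
    have "over R S"
    proof (cases rule: split_greater[of S z])
      case 1
      then have "first_row Xs = S @ [z]" using S' by (simp add: bump_append)
      then have o: "over R' (S @ [z])" using w by simp
      then have "R' ! length S < z" "length S < length R'"
        unfolding over_def by (auto dest: spec[of _ "length S"])
      then have "length S \<le> length A" using p by blast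
      moreover have "R' ! i < S ! i" if "i < length S" for i
      proof -
        have "R' ! i < (S @ [z]) ! i" using o that unfolding over_def
            by (metis length_append_singleton less_SucI)
        then show ?thesis using that by (simp add: nth_append)
      qed
      ultimately show ?thesis using o Ri len by (auto simp: over_def)
    next
      case (2 C y D)
      then have "first_row Xs = C @ z # D" using S' by (simp add: bump_split)
      then have o: "over R' (C @ z # D)" using w by simp
      then have "R' ! length C < z" "length C < length R'"
        unfolding over_def by (auto dest: spec[of _ "length C"])
      then have q: "length C \<le> length A" using p by blast
      have "R ! i < S ! i" if i: "i < length S" for i
      proof (cases "i = length A")
        case True
        have "y \<le> S ! i" using S i q True 2 sorted_nth_mono[of S "length C" i] by simp
        then show ?thesis using True Rp 2 by simp
      next
        case False
        have "R' ! i < (C @ z # D) ! i" using o i 2 by (auto simp: over_def)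
        also have "\<dots> \<le> S ! i" using 2 by (auto simp: nth_append nth_Cons split: nat.splits)
        finally show ?thesis using Ri[OF False] by simp
      qed
      then show ?thesis using o len 2 by (auto simp: over_def)
    qed
    moreover have "sorted R" using w R' Ax by (fastforce simp: R_def sorted_append not_less)
    ultimately have "tab (R # Ts)" using T(1) by (simp add: tab_def S_def) (simp add: R_def)
    then show ?thesis using bump T Suc by (intro exI[of _ "R # Ts"] exI[of _ x]) simp
  qed
qed simp

text \<open>The bumped letter reveals where it stood: the letters of the new row below
  \<open>z\<close> end with the newly inserted \<open>x\<close>.\<close>

lemma takeWhile_bumped:
  "sorted (A @ z # B) \<Longrightarrow> \<forall>a\<in>set A. a \<le> x \<Longrightarrow> x < z \<Longrightarrow> takeWhile (\<lambda>a. a < z) (A @ x # B) = A @ [x]"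
  for z :: nat
proof -
  assume a: "sorted (A @ z # B)" "\<forall>a\<in>set A. a \<le> x" "x < z"
  then have "takeWhile (\<lambda>a. a < z) B = []" by (cases B) (auto simp: sorted_append)
  then show ?thesis using a by (subst takeWhile_append2) auto
qed

text \<open>As the shapes agree before and after, comparing row lengths shows that both insertions
  stop in the same row. Upwards from there, each bumped letter marks its former place by
  \<open>takeWhile_bumped\<close>.\<close>

lemma rins_inj:
  assumes "tab L" "tab L'" "sh L = sh L'" "rins x L = rins x' L'"
  shows "x = x' \<and> L = L'"
  using assms
proof (induction L arbitrary: x x' L')
  case Nil
  then have "sh L' 0 = 0" by (metis sh_simps(1))
  then have "L' = []" using Nil tab_length[of L' 0] by simp
  then show ?case using Nil by simp
next
  case (Cons R T)
  have "sh L' 0 > 0" using Cons.prems tab_length[of "R # T" 0] by auto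
  then obtain R' T' where L': "L' = R' # T'" by (cases L') auto
  have len: "length R = length R'" using fun_cong[OF Cons.prems(3), of 0] L' by simp
  have shT: "sh T = sh T'" using Cons.prems(3) L' by (metis ext sh_simps(3))
  have t: "tab T" "tab T'" "sorted R" "sorted R'" using Cons.prems L' by (auto simp: tab_def)
  show ?case
  proof (cases rule: split_greater[of R x])
    case 1
    then have r: "rins x (R # T) = (R @ [x]) # T" by (simp add: bump_append)
    show ?thesis
    proof (cases rule: split_greater[of R' x'])
      case 1
      then show ?thesis using r Cons.prems L' by (simp add: bump_append)
    next
      case (2 A z B)
      then have "R @ [x] = A @ x' # B" using r Cons.prems L' by (simp add: bump_split)
      then have "length (R @ [x]) = length (A @ x' # B)" by simp
      then show ?thesis using len 2 by simp
    qed
  next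
    case R: (2 A z B)
    then have r: "rins x (R # T) = (A @ x # B) # rins z T" by (simp add: bump_split)
    show ?thesis
    proof (cases rule: split_greater[of R' x'])
      case 1
      then have "R' @ [x'] = A @ x # B" using r Cons.prems L' by (simp add: bump_append)
      then have "length (R' @ [x']) = length (A @ x # B)" by simp
      then show ?thesis using len R by simp
    next
      case R': (2 A' z' B')
      then have eq: "A @ x # B = A' @ x' # B'" "rins z T = rins z' T'"
        using r Cons.prems L' by (simp_all add: bump_split)
      then have "z = z'" "T = T'" using Cons.IH t shT by blast+
      moreover have "A @ [x] = A' @ [x']"
        using takeWhile_bumped[of A z B x] takeWhile_bumped[of A' z' B' x'] eq R R' t \<open>z = z'\<close>
        by simp
      ultimately show ?thesis using eq R R' L' by simp
    qed
  qed
qed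

section \<open>The insertion tableau of a word\<close>

lemma tab_fold_rins: "tab L \<Longrightarrow> tab (fold rins u L)"
  by (induction u arbitrary: L) (auto simp: tab_rins)

lemma word_fold_rins: "tab L \<Longrightarrow> word (fold rins u L) \<approx> word L @ u"
proof (induction u rule: rev_induct)
  case (snoc x u)
  have "word (rins x (fold rins u L)) \<approx> word (fold rins u L) @ [x]"
    using tab_fold_rins[OF snoc.prems] by (intro word_rins) (rule tab_wtab)
  also have "word (fold rins u L) @ [x] \<approx> (word L @ u) @ [x]"
    using snoc by (intro knuth_append) auto
  finally show ?case by simp
qed simp

text \<open>Serves as normal form: words are Knuth equivalent exactly if their \<open>ptab\<close>
  agree, by \<open>ptab_cong\<close> and \<open>ptab_eqD\<close>.\<close>

definition ptab :: "nat list \<Rightarrow> nat list list" where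
  "ptab w = fold rins w []"

lemma tab_ptab [simp]: "tab (ptab w)"
  unfolding ptab_def by (rule tab_fold_rins) (simp add: tab_def)

lemma word_ptab: "word (ptab w) \<approx> w"
  unfolding ptab_def using word_fold_rins[of "[]" w] by (simp add: tab_def)

lemma ptab_eqI: "tab L \<Longrightarrow> word L \<approx> w \<Longrightarrow> ptab w = L"
  using tab_unique[of "ptab w" L] word_ptab[of w] knuth_trans knuth_sym by (metis tab_ptab)

lemma ptab_cong: "u \<approx> v \<Longrightarrow> ptab u = ptab v"
  by (rule ptab_eqI) (use word_ptab knuth_trans knuth_sym in \<open>blast intro: tab_ptab\<close>)+

lemma ptab_word: "tab L \<Longrightarrow> ptab (word L) = L"
  by (rule ptab_eqI) auto

lemma ptab_eqD: "ptab u = ptab v \<Longrightarrow> u \<approx> v"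
  using word_ptab knuth_trans knuth_sym by metis

lemma ptab_fold_rins: "tab L \<Longrightarrow> ptab (word L @ u) = fold rins u L"
  by (intro ptab_eqI tab_fold_rins word_fold_rins)

lemma greene_ptab: "greene k w = (\<Sum>i<k. sh (ptab w) i)"
  using greene_word[OF tab_wtab[OF tab_ptab[of w]]] greene_knuth[OF word_ptab] by metis

section \<open>The Pieri bijection\<close>

definition hstrip :: "(nat \<Rightarrow> nat) \<Rightarrow> (nat \<Rightarrow> nat) \<Rightarrow> bool" where
  "hstrip \<rho> \<nu> \<longleftrightarrow> (\<forall>i. \<nu> i \<le> \<rho> i \<and> \<rho> (Suc i) \<le> \<nu> i)"

text \<open>The second clause says that the last box lies in the highest row of the strip. It is the
  invariant that carries the induction, and later it tells which box has to be removed
  first.\<close>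

lemma pieri_forward:
  assumes "tab L" "sorted u"
  shows "hstrip (sh (fold rins u L)) (sh L) \<and>
    (\<forall>v x. u = v @ [x] \<longrightarrow>
      (\<forall>i < box_row x (fold rins v L). sh (fold rins u L) i = sh L i) \<and>
      sh L (box_row x (fold rins v L)) < sh (fold rins u L) (box_row x (fold rins v L)))"
  using assms(2)
proof (induction u rule: rev_induct)
  case Nil
  then show ?case using assms(1) by (auto simp: hstrip_def wtab_sh_antimono tab_def)
next
  case (snoc x u)
  define X where "X = fold rins u L"
  have X: "tab X" "tab (rins x X)" using assms(1) by (simp_all add: X_def tab_fold_rins tab_rins)
  have IH: "hstrip (sh X) (sh L)" using snoc by (simp add: X_def sorted_append)
  define a where "a = box_row x X"
  have shx: "sh (rins x X) = (sh X)(a := Suc (sh X a))" by (simp add: sh_rins a_def)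
  have below: "sh X i = sh L i" if "i < a" for i
  proof (cases u rule: rev_cases)
    case (snoc v y)
    have yx: "y \<le> x" using snoc.prems snoc by (auto simp: sorted_append)
    define b where "b = box_row y (fold rins v L)"
    have "\<forall>i<b. sh X i = sh L i"
      using snoc.IH snoc.prems snoc by (simp add: X_def b_def sorted_append)
    moreover have "a \<le> b"
      unfolding a_def b_def X_def snoc using yx assms(1)
      by (auto intro!: box_row_le tab_wtab tab_fold_rins)
    ultimately show ?thesis using that by simp
  qed (simp add: X_def)
  have "hstrip (sh (rins x X)) (sh L)"
    unfolding hstrip_def
  proof
    fix i
    have "sh (rins x X) (Suc i) \<le> sh L i"
    proof (cases "Suc i = a")
      case True
      \<comment> \<open>The row above the new box has not grown yet, so the interlacing follows from
        the new shape being a partition.\<close>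
      have "sh (rins x X) (Suc i) \<le> sh (rins x X) i" using X by (intro wtab_sh_antimono tab_wtab)
      also have "\<dots> = sh L i" using below[of i] True shx by simp
      finally show ?thesis .
    next
      case False
      then show ?thesis using IH shx by (simp add: hstrip_def)
    qed
    then show "sh L i \<le> sh (rins x X) i \<and> sh (rins x X) (Suc i) \<le> sh L i"
      using IH shx by (auto simp: hstrip_def le_SucI)
  qed
  moreover have "sh L a < sh (rins x X) a" "\<forall>i<a. sh (rins x X) i = sh L i"
    using IH shx below by (auto simp: hstrip_def less_Suc_eq_le)
  ultimately show ?case by (simp add: X_def a_def)
qed

lemma pieri_hstrip: "tab L \<Longrightarrow> sorted u \<Longrightarrow> hstrip (sh (ptab (word L @ u))) (sh L)"
  using pieri_forward[of L u] by (simp add: ptab_fold_rins)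

lemma pieri_inj:
  assumes "tab L" "tab L'" "sorted u" "sorted u'" "sh L = sh L'"
    and "word L @ u \<approx> word L' @ u'"
  shows "L = L' \<and> u = u'"
proof -
  have sz: "length (word L) = (\<Sum>R\<leftarrow>L. length R)" for L
    by (induction L) auto
  have "length (word L) = length (word L')"
  proof -
    have len: "length L = length L'"
      using tab_length[OF assms(1)] tab_length[OF assms(2)] assms(5) by (metis nat_neq_iff)
    have "map length L = map length L'"
    proof (rule nth_equalityI)
      fix i assume "i < length (map length L)"
      then show "map length L ! i = map length L' ! i"
        using len fun_cong[OF assms(5), of i] by (simp add: sh_def)
    qed (use len in simp)
    then show ?thesis by (simp add: sz)
  qed
  then have "length u = length u'" using knuth_length[OF assms(6)] by simp
  moreover have "fold rins u L = fold rins u' L'"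
    using ptab_cong[OF assms(6)] assms by (simp add: ptab_fold_rins)
  ultimately show ?thesis using assms(1-5)
  proof (induction u u' rule: rev_induct2)
    case (4 x u x' u')
    define X where "X = fold rins u L"
    define X' where "X' = fold rins u' L'"
    define a where "a = box_row x X"
    define b where "b = box_row x' X'"
    have tX: "tab X" "tab X'" using 4 by (simp_all add: X_def X'_def tab_fold_rins)
    have eq: "rins x X = rins x' X'" using 4 by (simp add: X_def X'_def)
    have a: "\<forall>i<a. sh (rins x X) i = sh L i" "sh L a < sh (rins x X) a"
      using pieri_forward[of L "u @ [x]"] 4 by (simp_all add: X_def a_def)
    have b: "\<forall>i<b. sh (rins x' X') i = sh L' i" "sh L' b < sh (rins x' X') b"
      using pieri_forward[of L' "u' @ [x']"] 4 by (simp_all add: X'_def b_def)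
    \<comment> \<open>Both are the first row in which the common outer shape exceeds the common
      inner shape.\<close>
    have "a = b" using a b eq 4 by (metis nat_neq_iff)
    moreover have "(sh X)(a := Suc (sh X a)) = (sh X')(b := Suc (sh X' b))"
      using eq sh_rins[of x X] sh_rins[of x' X'] by (simp add: a_def b_def)
    ultimately have "sh X = sh X'" by (metis Suc_inject fun_upd_same fun_upd_triv fun_upd_upd)
    then have "x = x'" "X = X'" using rins_inj[OF tX _ eq] by auto
    then show ?case using 4 by (simp add: X_def X'_def sorted_append)
  qed auto
qed

lemma pieri_surj:
  assumes "tab X" "hstrip (sh X) \<nu>"
  shows "\<exists>L u. tab L \<and> sh L = \<nu> \<and> sorted u \<and> word L @ u \<approx> word X"
  using assms
proof (induction "length (word X)" arbitrary: X rule: less_induct)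
  case less
  show ?case
  proof (cases "sh X = \<nu>")
    case True
    then show ?thesis using less.prems by (intro exI[of _ X] exI[of _ "[]"]) auto
  next
    case False
    have hs: "\<nu> i \<le> sh X i" "sh X (Suc i) \<le> \<nu> i" for i using less.prems by (auto simp: hstrip_def)
    have "\<exists>i. \<nu> i < sh X i" using False hs by (metis ext le_neq_implies_less)
    \<comment> \<open>The highest row that meets the strip: the last inserted letter must have
      created its box there, by the row bumping lemma.\<close>
    define a where "a = (LEAST i. \<nu> i < sh X i)"
    have a: "\<nu> a < sh X a" unfolding a_def using \<open>\<exists>i. \<nu> i < sh X i\<close> by (rule LeastI_ex)
    have least: "a \<le> i" if "\<nu> i < sh X i" for i unfolding a_def using that by (rule Least_le)
    have "sh X (Suc a) < sh X a" using hs(2)[of a] a by simp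
    then obtain X' x where X': "tab X'" "rins x X' = X" "box_row x X' = a"
      using rins_surj[OF less.prems(1)] by blast
    have shX: "sh X = (sh X')(a := Suc (sh X' a))" using sh_rins[of x X'] X' by simp
    have kn: "word X \<approx> word X' @ [x]" using word_rins[OF tab_wtab[OF X'(1)], of x] X' by simp
    have "hstrip (sh X') \<nu>"
      unfolding hstrip_def
    proof
      fix i show "\<nu> i \<le> sh X' i \<and> sh X' (Suc i) \<le> \<nu> i"
        using hs[of i] a shX by (cases "i = a"; cases "Suc i = a") auto
    qed
    moreover have "length (word X') < length (word X)" using knuth_length[OF kn] by simp
    ultimately obtain L u where L: "tab L" "sh L = \<nu>" "sorted u" "word L @ u \<approx> word X'"
      using less.hyps[OF _ X'(1)] by blast
    have "sorted (u @ [x])"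
    proof (cases u rule: rev_cases)
      case (snoc v y)
      define Y where "Y = fold rins v L"
      have "fold rins u L = X'" using ptab_cong[OF L(4)] L X'
          by (simp add: ptab_fold_rins ptab_word)
      then have Y: "rins y Y = X'" by (simp add: snoc Y_def)
      define b where "b = box_row y Y"
      have "sh L b < sh X' b" using pieri_forward[OF L(1,3)] snoc \<open>fold rins u L = X'\<close>
        by (simp add: b_def Y_def)
      then have "\<nu> b < sh X b" using L shX by (auto simp: less_Suc_eq)
      then have "a \<le> b" by (rule least)
      \<comment> \<open>Otherwise the box of \<open>x\<close> would lie strictly below that of
        \<open>y\<close>, although \<open>a\<close> is the highest row of the strip.\<close>
      have "y \<le> x"
      proof (rule ccontr)
        assume "\<not> y \<le> x"
        then have "b < a" using box_row_less[of x y Y] Y X' by (simp add: b_def)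
        then show False using \<open>a \<le> b\<close> by simp
      qed
      then show ?thesis using L snoc by (auto simp: sorted_append)
    qed simp
    moreover have "(word L @ u) @ [x] \<approx> word X' @ [x]"
      using L by (intro knuth_append) auto
    then have "word L @ u @ [x] \<approx> word X"
      using knuth_trans[OF _ knuth_sym[OF kn]] by simp
    ultimately show ?thesis using L by blast
  qed
qed

section \<open>Rows multiplied from the left, and adjoining an extreme letter\<close>

lemma sh_ptab_star:
  assumes "set w \<subseteq> {..n}"
  shows "sh (ptab (star n w)) = sh (ptab w)"
proof (rule sh_eqI)
  fix k
  have "greene k (word (ptab (star n w))) = greene k (star n w)"
    by (rule greene_knuth[OF word_ptab])
  also have "\<dots> = greene k (word (ptab w))"
    using greene_star[OF assms] greene_knuth[OF word_ptab[of w]] by simp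
  finally show "greene k (word (ptab (star n w))) = greene k (word (ptab w))" .
qed (simp_all add: tab_wtab)

lemma set_ptab: "set (word (ptab w)) = set w"
  by (rule knuth_set[OF word_ptab])

text \<open>Reversing and complementing words exchanges multiplication by a row from the right
    and from the left.\<close>

lemma pieri_left_hstrip:
  assumes "tab L" "sorted u"
  shows "hstrip (sh (ptab (u @ word L))) (sh L)"
proof -
  define n where "n = Max (set (u @ word L))"
  have n: "set (u @ word L) \<subseteq> {..n}" by (auto simp: n_def)
  have "ptab (star n (u @ word L)) = ptab (word (ptab (star n (word L))) @ star n u)"
    by (rule ptab_cong) (auto simp: star_append intro!: knuth_append knuth_sym[OF word_ptab])
  then have "hstrip (sh (ptab (star n (u @ word L)))) (sh (ptab (star n (word L))))"
    using pieri_hstrip[OF tab_ptab sorted_star[OF assms(2)]] by simp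
  then show ?thesis using n assms(1) by (simp add: sh_ptab_star ptab_word del: set_append) (simp
      add: sh_ptab_star ptab_word)
qed

lemma pieri_left_inj:
  assumes "tab L" "tab L'" "sorted u" "sorted u'" "sh L = sh L'"
    and "u @ word L \<approx> u' @ word L'"
  shows "L = L' \<and> u = u'"
proof -
  define n where "n = Max (set (u @ word L))"
  have n: "set (u @ word L) \<subseteq> {..n}" by (auto simp: n_def)
  then have n': "set (u' @ word L') \<subseteq> {..n}" using knuth_set[OF assms(6)] by metis
  have sub: "set (word L) \<subseteq> {..n}" "set (word L') \<subseteq> {..n}" "set u \<subseteq> {..n}" "set u' \<subseteq> {..n}"
    using n n' by auto
  have "word (ptab (star n (word L))) @ star n u \<approx> star n (word L) @ star n u"
    by (intro knuth_append word_ptab knuth_refl)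
  also have "\<dots> \<approx> star n (word L') @ star n u'"
    using knuth_star[OF assms(6) n] by (simp add: star_append)
  also have "\<dots> \<approx> word (ptab (star n (word L'))) @ star n u'"
    by (intro knuth_append knuth_sym[OF word_ptab] knuth_refl)
  finally have "ptab (star n (word L)) = ptab (star n (word L')) \<and> star n u = star n u'"
    using assms sub by (intro pieri_inj sorted_star) (simp_all add: sh_ptab_star ptab_word)
  then have "star n (word L) \<approx> star n (word L')" "star n u = star n u'"
    by (auto dest: ptab_eqD)
  then have "word L \<approx> word L'" "u = u'"
    using knuth_star[of "star n (word L)" "star n (word L')" n] set_star[of n] sub
    by (auto simp: star_star dest!: arg_cong[of "star n u" _ "star n"])
  then show ?thesis using tab_unique assms by blast
qed

lemma pieri_left_surj:
  assumes "tab X" "hstrip (sh X) \<nu>"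
  shows "\<exists>L u. tab L \<and> sh L = \<nu> \<and> sorted u \<and> u @ word L \<approx> word X"
proof -
  define n where "n = Max (set (word X))"
  have n: "set (word X) \<subseteq> {..n}" by (auto simp: n_def)
  have "hstrip (sh (ptab (star n (word X)))) \<nu>" using assms n by (simp add: sh_ptab_star ptab_word)
  then obtain L u where L: "tab L" "sh L = \<nu>" "sorted u" "word L @ u \<approx>
      word (ptab (star n (word X)))"
    using pieri_surj[OF tab_ptab] by blast
  then have kn: "word L @ u \<approx> star n (word X)" using word_ptab knuth_trans by blast
  then have sub: "set (word L @ u) \<subseteq> {..n}" using knuth_set[OF kn] set_star by simp
  have "star n u @ word (ptab (star n (word L))) \<approx> star n u @ star n (word L)"
    by (intro knuth_append word_ptab knuth_refl)
  also have "\<dots> \<approx> word X" using knuth_star[OF kn sub] n by (simp add: star_append star_star)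
  finally show ?thesis
    using L sub by (intro exI[of _ "ptab (star n (word L))"] exI[of _ "star n u"])
      (simp add: sorted_star sh_ptab_star ptab_word)
qed

text \<open>The restricted shapes for letters below \<open>N\<close> come from the filtered words.
  The only further shape in the chain is the full one, and that is what Greene's numbers of
  \<open>v\<close> and \<open>v'\<close> provide.\<close>

lemma knuth_add_max:
  assumes "filter (\<lambda>x. x < N) v \<approx> filter (\<lambda>x. x < N) v'"
    and "set v \<subseteq> {..N}" "set v' \<subseteq> {..N}"
    and gr: "\<And>k. greene k v = greene k v'"
  shows "v \<approx> v'"
proof -
  have "ptab v = ptab v'"
  proof (rule tab_eqI)
    have "greene k (word (ptab v)) = greene k (word (ptab v'))" for k
      using gr greene_knuth[OF word_ptab] by simp
    then show "sh (ptab v) = sh (ptab v')" by (intro sh_eqI) (simp_all add: tab_wtab)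
    fix j k
    have f: "greene j (filter (\<lambda>x. x \<le> k) (word (ptab w))) = greene j (filter (\<lambda>x. x \<le> k) w)" for w
      by (intro greene_knuth knuth_filter word_ptab) auto
    show "greene j (filter (\<lambda>x. x \<le> k) (word (ptab v))) = greene j (filter (\<lambda>x. x \<le>
        k) (word (ptab v')))"
    proof (cases "k < N")
      case True
      have e: "filter (\<lambda>x. x \<le> k) w = filter (\<lambda>x. x \<le> k) (filter (\<lambda>x. x < N) w)" for w
        using True by (auto intro!: filter_cong)
      have "filter (\<lambda>x. x \<le> k) v \<approx> filter (\<lambda>x. x \<le> k) v'"
        unfolding e[of v] e[of v'] using assms(1) by (rule knuth_filter) auto
      then show ?thesis unfolding f by (rule greene_knuth)
    next
      case False
      then have "filter (\<lambda>x. x \<le> k) v = v" "filter (\<lambda>x. x \<le> k) v' = v'"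
        using assms(2,3) by (auto intro!: filter_True)
      then show ?thesis using f gr by simp
    qed
  qed simp_all
  then show ?thesis by (rule ptab_eqD)
qed

text \<open>The larger letters do not form an initial part of a tableau, so the chain of shapes is
  of no direct use here. \<open>star\<close> turns the smallest letter into the largest.\<close>

lemma knuth_add_min:
  assumes "filter (\<lambda>x. i < x) w \<approx> filter (\<lambda>x. i < x) w'"
    and i: "\<forall>x\<in>set w. i \<le> x" "\<forall>x\<in>set w'. i \<le> x"
    and gr: "\<And>k. greene k w = greene k w'"
  shows "w \<approx> w'"
proof -
  define n where "n = Max (set (i # w @ w'))"
  have n: "set w \<subseteq> {..n}" "set w' \<subseteq> {..n}" "i \<le> n" by (auto simp: n_def)
  have f: "filter (\<lambda>x. x < n - i) (star n v) = star n (filter (\<lambda>x. i < x) v)" if "set v \<subseteq> {..n}"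
      for v
    using that n(3) by (induction v) (auto simp: star_def)
  have "star n w \<approx> star n w'"
  proof (rule knuth_add_max)
    show "filter (\<lambda>x. x < n - i) (star n w) \<approx> filter (\<lambda>x. x < n - i) (star n w')"
      unfolding f[OF n(1)] f[OF n(2)] using n(1) by (intro knuth_star assms(1)) auto
    show "set (star n w) \<subseteq> {..n - i}" "set (star n w') \<subseteq> {..n - i}"
      using i by (auto simp: star_def)
    show "greene k (star n w) = greene k (star n w')" for k
      using gr n by (simp add: greene_star)
  qed
  then have "star n (star n w) \<approx> star n (star n w')" by (rule knuth_star[OF _ set_star])
  then show ?thesis using n by (simp add: star_star)
qed

section \<open>Jeu de taquin\<close>

definition down_closed :: "(nat \<times> nat) set \<Rightarrow> bool" where
  "down_closed D \<longleftrightarrow> (\<forall>(r, c)\<in>D. 1 \<le> r \<and> 1 \<le> c \<and>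
     (\<forall>r' c'. 1 \<le> r' \<longrightarrow> r' \<le> r \<longrightarrow> 1 \<le> c' \<longrightarrow> c' \<le> c \<longrightarrow> (r', c') \<in> D))"

lemma down_closedD:
  "down_closed D \<Longrightarrow> (r, c) \<in> D \<Longrightarrow> 1 \<le> r' \<Longrightarrow> r' \<le> r \<Longrightarrow> 1 \<le> c' \<Longrightarrow> c' \<le> c \<Longrightarrow> (r', c') \<in> D"
  "down_closed D \<Longrightarrow> (r, c) \<in> D \<Longrightarrow> 1 \<le> r" "down_closed D \<Longrightarrow> (r, c) \<in> D \<Longrightarrow> 1 \<le> c"
  unfolding down_closed_def by fastforce+

text \<open>The state during a slide: \<open>J\<close> is the inner diagram already without the
  hole, whereas \<open>D\<close> still contains it. \<open>D\<close> stays fixed until the hole has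
  become an outer corner.\<close>

definition hole_state :: "(nat \<times> nat) set \<Rightarrow> (nat \<times> nat) set \<Rightarrow> nat \<times> nat \<Rightarrow> tableau \<Rightarrow> bool" where
  "hole_state D J h T \<longleftrightarrow> down_closed D \<and> down_closed J \<and> J \<subseteq> D \<and> h \<in> D \<and> h \<notin> J \<and>
     dom T = D - J - {h} \<and> column_strict T"

lemma column_strict_row: "column_strict T \<Longrightarrow> T (r, c) = Some x \<Longrightarrow> T (r, c') = Some y \<Longrightarrow> c \<le> c' \<Longrightarrow> x \<le> y"
  unfolding column_strict_def by (metis le_neq_implies_less option.inject order_refl)

lemma column_strict_column: "column_strict T \<Longrightarrow> T (r, c) = Some x \<Longrightarrow> T (r', c) = Some y \<Longrightarrow> r < r' \<Longrightarrow>
    x < y"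
  unfolding column_strict_def by blast

lemma column_strictI:
  assumes "\<And>r c c' x y. c < c' \<Longrightarrow> T (r, c) = Some x \<Longrightarrow> T (r, c') = Some y \<Longrightarrow> x \<le> y"
    and "\<And>r r' c x y. r < r' \<Longrightarrow> T (r, c) = Some x \<Longrightarrow> T (r', c) = Some y \<Longrightarrow> x < y"
  shows "column_strict T"
  unfolding column_strict_def using assms by blast

text \<open>Only the moved entry gets new neighbours. To its right the order holds by the choice of
  the move. An entry to its left is smaller than the one below it, which is at most \<open>y\<close>
  because it stands left of \<open>y\<close> in the lower row.\<close>

lemma hole_state_up:
  assumes h: "hole_state D J (r, c) T" and y: "T (r + 1, c) = Some y"
    and yx: "\<And>x. T (r, c + 1) = Some x \<Longrightarrow> y \<le> x"
  shows "hole_state D J (r + 1, c) (T((r, c) \<mapsto> y, (r + 1, c) := None))"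
    (is "hole_state D J _ ?T")
proof -
  have D: "down_closed D" "down_closed J" "(r, c) \<in> D" "(r, c) \<notin> J" "dom T = D - J - {(r, c)}"
    and cs: "column_strict T"
    using h by (simp_all add: hole_state_def)
  have rc: "1 \<le> r" "1 \<le> c" using down_closedD(2,3)[OF D(1,3)] by simp_all
  have y': "(r + 1, c) \<in> dom T" using y by blast
  have "column_strict ?T"
  proof (rule column_strictI)
    fix r0 c1 c2 x z assume c: "c1 < c2" and x: "?T (r0, c1) = Some x" and z: "?T (r0, c2) = Some z"
    consider "r0 = r" "c1 = c" | "r0 = r" "c2 = c" | "T (r0, c1) = Some x" "T (r0, c2) = Some z"
      using x z c by (auto split: if_splits)
    then show "x \<le> z"
    proof cases
      case 1
      then have z': "T (r, c2) = Some z" and "x = y" using x z c by (auto split: if_splits)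
      then have "(r, c2) \<in> D" using D(5) by blast
      then have "(r, c + 1) \<in> D" using down_closedD(1)[OF D(1), of r c2 r "c + 1"] c 1 rc by auto
      moreover have "(r, c + 1) \<notin> J" using down_closedD(1)[OF D(2), of r "c + 1" r c] D(4) rc
          by auto
      ultimately have "(r, c + 1) \<in> dom T" using D(5) by auto
      then obtain x' where x': "T (r, c + 1) = Some x'" by blast
      then have "x' \<le> z" using column_strict_row[OF cs x' z'] c 1 by simp
      then show ?thesis using yx[OF x'] \<open>x = y\<close> by simp
    next
      case 2
      then have x': "T (r, c1) = Some x" and "z = y" using x z c by (auto split: if_splits)
      then have x1: "(r, c1) \<in> dom T" by blast
      then have c1: "1 \<le> c1" using D(5) down_closedD(3)[OF D(1), of r c1] by simp
      have "(r + 1, c1) \<in> D" using down_closedD(1)[OF D(1), of "r + 1" c "r + 1" c1] y' D(5) c 2 c1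
          by auto
      moreover have "(r + 1, c1) \<notin> J" using down_closedD(1)[OF D(2), of "r +
          1" c1 r c1] x1 D(5) rc c1 by auto
      ultimately have "(r + 1, c1) \<in> dom T" using D(5) by auto
      then obtain y1 where y1: "T (r + 1, c1) = Some y1" by blast
      have "x < y1" using column_strict_column[OF cs x' y1] by simp
      also have "y1 \<le> y" using column_strict_row[OF cs y1 y] c 2 by simp
      finally show ?thesis using \<open>z = y\<close> by simp
    next
      case 3
      then show ?thesis using column_strict_row[OF cs] c by simp
    qed
  next
    fix r1 r2 c0 x z assume r: "r1 < r2" and x: "?T (r1, c0) = Some x" and z: "?T (r2, c0) = Some z"
    consider "c0 = c" "r1 = r" | "c0 = c" "r2 = r" | "T (r1, c0) = Some x" "T (r2, c0) = Some z"
      using x z r by (auto split: if_splits)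
    then show "x < z"
    proof cases
      case 1
      then have "T (r2, c) = Some z" "x = y" "r + 1 < r2" using x z r by (auto split: if_splits)
      then show ?thesis using column_strict_column[OF cs y] by simp
    next
      case 2
      then have "T (r1, c) = Some x" "z = y" "r1 < r + 1" using x z r by (auto split: if_splits)
      then show ?thesis using column_strict_column[OF cs _ y] by simp
    next
      case 3
      then show ?thesis using column_strict_column[OF cs] r by simp
    qed
  qed
  moreover have "dom ?T = D - J - {(r + 1, c)}" using D by (auto split: if_splits)
  ultimately show ?thesis using h y' D by (auto simp: hole_state_def)
qed

text \<open>Dual to \<open>hole_state_up\<close>: below the moved entry the strict order is the
  choice of the move. An entry above the hole is at most its right neighbour, which stands above
  \<open>x\<close> in the column that \<open>x\<close> leaves.\<close>

lemma hole_state_left: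
  assumes h: "hole_state D J (r, c) T" and x: "T (r, c + 1) = Some x"
    and xy: "\<And>y. T (r + 1, c) = Some y \<Longrightarrow> x < y"
  shows "hole_state D J (r, c + 1) (T((r, c) \<mapsto> x, (r, c + 1) := None))"
    (is "hole_state D J _ ?T")
proof -
  have D: "down_closed D" "down_closed J" "(r, c) \<in> D" "(r, c) \<notin> J" "dom T = D - J - {(r, c)}"
    and cs: "column_strict T"
    using h by (simp_all add: hole_state_def)
  have rc: "1 \<le> r" "1 \<le> c" using down_closedD(2,3)[OF D(1,3)] by simp_all
  have x': "(r, c + 1) \<in> dom T" using x by blast
  have "column_strict ?T"
  proof (rule column_strictI)
    fix r0 c1 c2 u z assume c: "c1 < c2" and u: "?T (r0, c1) = Some u" and z: "?T (r0, c2) = Some z"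
    consider "r0 = r" "c1 = c" | "r0 = r" "c2 = c" | "T (r0, c1) = Some u" "T (r0, c2) = Some z"
      using u z c by (auto split: if_splits)
    then show "u \<le> z"
    proof cases
      case 1
      then have "T (r, c2) = Some z" "u = x" "c + 1 \<le> c2" using u z c by (auto split: if_splits)
      then show ?thesis using column_strict_row[OF cs x] by simp
    next
      case 2
      then have "T (r, c1) = Some u" "z = x" "c1 \<le> c + 1" using u z c by (auto split: if_splits)
      then show ?thesis using column_strict_row[OF cs _ x] by simp
    next
      case 3
      then show ?thesis using column_strict_row[OF cs] c by simp
    qed
  next
    fix r1 r2 c0 u z assume r: "r1 < r2" and u: "?T (r1, c0) = Some u" and z: "?T (r2, c0) = Some z"
    consider "c0 = c" "r1 = r" | "c0 = c" "r2 = r" | "T (r1, c0) = Some u" "T (r2, c0) = Some z"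
      using u z r by (auto split: if_splits)
    then show "u < z"
    proof cases
      case 1
      then have z': "T (r2, c) = Some z" and "u = x" using u z r by (auto split: if_splits)
      then have "(r2, c) \<in> D" using D(5) by blast
      then have "(r + 1, c) \<in> D" using down_closedD(1)[OF D(1), of r2 c "r + 1" c] r 1 rc by auto
      moreover have "(r + 1, c) \<notin> J" using down_closedD(1)[OF D(2), of "r + 1" c r c] D(4) rc
          by auto
      ultimately have "(r + 1, c) \<in> dom T" using D(5) by auto
      then obtain y where y: "T (r + 1, c) = Some y" by blast
      have "y \<le> z"
      proof (cases "r2 = r + 1")
        case False
        then show ?thesis using column_strict_column[OF cs y z'] r 1 by simp
      qed (use y z' in simp)
      then show ?thesis using xy[OF y] \<open>u = x\<close> by simp
    next
      case 2
      then have u': "T (r1, c) = Some u" and "z = x" using u z r by (auto split: if_splits)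
      then have u1: "(r1, c) \<in> dom T" by blast
      then have r1: "1 \<le> r1" using D(5) down_closedD(2)[OF D(1), of r1 c] by simp
      have "(r1, c + 1) \<in> D" using down_closedD(1)[OF D(1), of r "c + 1" r1 "c + 1"] x' D(5) r 2 r1
          by auto
      moreover have "(r1, c + 1) \<notin> J" using down_closedD(1)[OF D(2), of r1 "c +
          1" r1 c] u1 D(5) rc r1 by auto
      ultimately have "(r1, c + 1) \<in> dom T" using D(5) by auto
      then obtain b where b: "T (r1, c + 1) = Some b" by blast
      have "u \<le> b" using column_strict_row[OF cs u' b] by simp
      also have "b < x" using column_strict_column[OF cs b x] r 2 by simp
      finally show ?thesis using \<open>z = x\<close> by simp
    next
      case 3
      then show ?thesis using column_strict_column[OF cs] r by simp
    qed
  qed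
  moreover have "dom ?T = D - J - {(r, c + 1)}" using D by (auto split: if_splits)
  ultimately show ?thesis using h x' D by (auto simp: hole_state_def)
qed

section \<open>Reading words along a slide\<close>

definition row_word :: "nat \<Rightarrow> tableau \<Rightarrow> nat \<Rightarrow> nat list" where
  "row_word N T r = map (\<lambda>c. the (T (r, c))) (filter (\<lambda>c. T (r, c) \<noteq> None) [0..<N])"

definition reading :: "nat \<Rightarrow> tableau \<Rightarrow> nat list" where
  "reading N T = concat (map (row_word N T) (rev [0..<N]))"

definition row_part :: "tableau \<Rightarrow> nat \<Rightarrow> nat list \<Rightarrow> nat list" where
  "row_part T r cs = map (\<lambda>c. the (T (r, c))) (filter (\<lambda>c. T (r, c) \<noteq> None) cs)"

lemma row_part_cong: "(\<And>c. c \<in> set cs \<Longrightarrow> T (r, c) = T' (r, c)) \<Longrightarrow> row_part T r cs = row_part T' r cs"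
  unfolding row_part_def by (rule map_cong[OF filter_cong]) auto

lemma row_part_append: "row_part T r (cs @ ds) = row_part T r cs @ row_part T r ds"
  by (simp add: row_part_def)

lemma row_part_Cons: "row_part T r (c # cs) = (case T (r, c) of None \<Rightarrow> [] | Some x \<Rightarrow> [x]) @
    row_part T r cs"
  by (simp add: row_part_def split: option.split)

lemma sorted_row_word:
  assumes "column_strict T"
  shows "sorted (row_word N T r)"
proof -
  have "sorted_wrt (\<lambda>c c'. the (T (r, c)) \<le> the (T (r, c'))) (filter (\<lambda>c. T (r, c) \<noteq> None) [0..<N])"
  proof (rule sorted_wrt_mono_rel[where P = "(<)"])
    fix c c' assume "c \<in> set (filter (\<lambda>c. T (r, c) \<noteq> None) [0..<N])"
      "c' \<in> set (filter (\<lambda>c. T (r, c) \<noteq> None) [0..<N])" "c < c'"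
    then show "the (T (r, c)) \<le> the (T (r, c'))"
      using column_strict_row[OF assms] by auto
  next
    show "sorted_wrt (<) (filter (\<lambda>c. T (r, c) \<noteq> None) [0..<N])"
      by (intro sorted_wrt_filter) simp
  qed
  then show ?thesis by (simp add: row_word_def sorted_wrt_map)
qed


lemma upt_append: "i \<le> j \<Longrightarrow> j \<le> k \<Longrightarrow> [i..<k] = [i..<j] @ [j..<k]"
  using upt_add_eq_append[of i j "k - j"] by simp

lemma upto_split: "a \<le> b \<Longrightarrow> b < N \<Longrightarrow> [a..<N] = [a..<b] @ b # [Suc b..<N]"
  by (metis less_imp_le upt_append upt_conv_Cons)

lemma reading_left:
  assumes "T (r, c) = None" "T (r, c + 1) = Some x" "c + 1 < N"
  shows "reading N (T((r, c) \<mapsto> x, (r, c + 1) := None)) = reading N T"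
proof -
  let ?T = "T((r, c) \<mapsto> x, (r, c + 1) := None)"
  have s: "[0..<N] = [0..<c] @ c # (c + 1) # [c + 2..<N]"
    using assms(3) upto_split[of 0 c N] upto_split[of "c + 1" "c + 1" N] by simp
  have "filter (\<lambda>c'. ?T (r, c') \<noteq> None) [0..<c] = filter (\<lambda>c'. T (r, c') \<noteq> None) [0..<c]"
    "filter (\<lambda>c'. ?T (r, c') \<noteq> None) [c + 2..<N] = filter (\<lambda>c'. T (r, c') \<noteq> None) [c + 2..<N]"
    by (auto intro!: filter_cong)
  then have "row_word N ?T r = row_word N T r"
    unfolding row_word_def s using assms by simp
  moreover have "row_word N ?T r' = row_word N T r'" if "r' \<noteq> r" for r'
    using that by (simp add: row_word_def)
  ultimately have "row_word N ?T = row_word N T" by (metis ext)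
  then show ?thesis by (simp add: reading_def)
qed

lemma up_closed_initial:
  fixes c :: nat
  assumes "\<And>a b. Q a \<Longrightarrow> a \<le> b \<Longrightarrow> b < c \<Longrightarrow> Q b"
  obtains s where "s \<le> c" "\<And>a. a < c \<Longrightarrow> Q a \<longleftrightarrow> s \<le> a"
proof -
  define s where "s = (LEAST a. a = c \<or> Q a)"
  have s: "s = c \<or> Q s" unfolding s_def by (rule LeastI[of _ c]) simp
  have le: "s \<le> a" if "a = c \<or> Q a" for a unfolding s_def using that by (rule Least_le)
  show thesis
  proof (rule that[of s])
    show "Q a \<longleftrightarrow> s \<le> a" if "a < c" for a
      using le[of a] s assms[of s a] that by auto
  qed (use le in simp)
qed

lemma filter_upt_ge: "s \<le> c \<Longrightarrow> (\<And>a. a < c \<Longrightarrow> Q a \<longleftrightarrow> s \<le> a) \<Longrightarrow> filter Q [0..<c] = [s..<c]"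
proof -
  assume a: "s \<le> c" "\<And>a. a < c \<Longrightarrow> Q a \<longleftrightarrow> s \<le> a"
  have "[0..<c] = [0..<s] @ [s..<c]" using a(1) by (metis upt_append zero_le)
  moreover have "filter Q [0..<s] = []" using a by (auto simp: filter_empty_conv)
  moreover have "filter Q [s..<c] = [s..<c]" using a by (intro filter_True) auto
  ultimately show ?thesis by simp
qed

lemma filter_upt_less:
  "k \<le> e \<Longrightarrow> e \<le> N \<Longrightarrow> (\<And>a. k \<le> a \<Longrightarrow> a < N \<Longrightarrow> Q a \<longleftrightarrow> a < e) \<Longrightarrow> filter Q [k..<N] = [k..<e]"
proof -
  assume a: "k \<le> e" "e \<le> N" "\<And>a. k \<le> a \<Longrightarrow> a < N \<Longrightarrow> Q a \<longleftrightarrow> a < e"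
  have "[k..<N] = [k..<e] @ [e..<N]" using a(1,2) by (metis upt_append)
  moreover have "filter Q [e..<N] = []" using a by (auto simp: filter_empty_conv)
  moreover have "filter Q [k..<e] = [k..<e]" using a by (intro filter_True) auto
  ultimately show ?thesis by simp
qed

text \<open>Only the rows \<open>r\<close> and \<open>r + 1\<close> change. To the left of the hole,
  row \<open>r\<close> begins at column \<open>s\<close>; to its right, row \<open>r + 1\<close>
  ends before column \<open>e\<close>. Between these bounds both rows are filled apart from the
  hole, which is the situation of \<open>knuth_vertical_move\<close>; the remainders
  \<open>P0\<close> and \<open>V2\<close> sit at the two ends of the word and stay
  untouched.\<close>

lemma reading_up:
  assumes h: "hole_state D J (r, c) T" and y: "T (r + 1, c) = Some y"
    and yx: "\<And>x. T (r, c + 1) = Some x \<Longrightarrow> y \<le> x"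
    and N: "D \<subseteq> {..<N} \<times> {..<N}"
  shows "reading N T \<approx> reading N (T((r, c) \<mapsto> y, (r + 1, c) := None))"
proof -
  let ?T = "T((r, c) \<mapsto> y, (r + 1, c) := None)"
  have D: "down_closed D" "down_closed J" "(r, c) \<in> D" "(r, c) \<notin> J" "dom T = D - J - {(r, c)}"
    and cs: "column_strict T"
    using h by (simp_all add: hole_state_def)
  have rc: "1 \<le> r" "1 \<le> c" using down_closedD(2,3)[OF D(1,3)] by simp_all
  have cs': "column_strict ?T" using hole_state_up[OF h y yx] by (auto simp: hole_state_def)
  have "(r + 1, c) \<in> dom T" using y by blast
  then have rcD: "(r + 1, c) \<in> D" "(r + 1, c) \<notin> J" using D(5) by auto
  then have rN: "r + 1 < N" "c < N" using N by auto
  have domT: "T b \<noteq> None \<longleftrightarrow> b \<in> D \<and> b \<notin> J \<and> b \<noteq> (r, c)" for b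
    using D(5) domIff[of b T] by blast
  have up: "T (r, b) \<noteq> None" if "T (r, a) \<noteq> None" "a \<le> b" "b < c" for a b
  proof -
    have a: "(r, a) \<in> D" "(r, a) \<notin> J" using that domT by auto
    then have "1 \<le> a" using down_closedD(3)[OF D(1)] by blast
    then show ?thesis using a that domT[of "(r, b)"] down_closedD(1)[OF D(1,3), of r b]
        down_closedD(1)[OF D(2), of r b r a] rc by auto
  qed
  \<comment> \<open>\<open>s = c\<close> means that nothing in row \<open>r\<close> stands left of
    the hole.\<close>
  then obtain s where s: "s \<le> c" "\<And>a. a < c \<Longrightarrow> T (r, a) \<noteq> None \<longleftrightarrow> s \<le> a"
    using up_closed_initial[of "\<lambda>a. T (r, a) \<noteq> None" c] by blast
  have below: "T (r + 1, a) \<noteq> None" if "a < c" "s \<le> a" for a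
  proof -
    have a: "(r, a) \<in> D" "(r, a) \<notin> J" using that s domT[of "(r, a)"] by auto
    then have "1 \<le> a" using down_closedD(3)[OF D(1)] by blast
    then show ?thesis using a that domT[of "(r + 1, a)"] down_closedD(1)[OF D(1) rcD(1), of "r +
        1" a]
        down_closedD(1)[OF D(2), of "r + 1" a r a] rc by auto
  qed
  have above: "T (r, a) \<noteq> None" if "c < a" "T (r + 1, a) \<noteq> None" for a
  proof -
    have a: "(r + 1, a) \<in> D" "(r + 1, a) \<notin> J" using that domT by auto
    then show ?thesis using that domT[of "(r, a)"] down_closedD(1)[OF D(1) a(1), of r a]
        down_closedD(1)[OF D(2), of r a r c] D(4) rc by auto
  qed
  have down: "T (r + 1, b) \<noteq> None" if "T (r + 1, a) \<noteq> None" "c < b" "b \<le> a" for a b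
  proof -
    have a: "(r + 1, a) \<in> D" using that domT by auto
    then show ?thesis using that domT[of "(r + 1, b)"] down_closedD(1)[OF D(1) a(1), of "r + 1" b]
        down_closedD(1)[OF D(2), of "r + 1" b "r + 1" c] rcD rc by auto
  qed
  have "\<exists>e. c + 1 \<le> e \<and> e \<le> N \<and> (\<forall>a. c + 1 \<le> a \<longrightarrow> a < N \<longrightarrow> (T (r + 1, a) \<noteq> None \<longleftrightarrow> a < e))"
  proof -
    define e where "e = (LEAST a. c + 1 \<le> a \<and> (a = N \<or> T (r + 1, a) = None))"
    have N': "c + 1 \<le> N \<and> (N = N \<or> T (r + 1, N) = None)" using rN by simp
    have e: "c + 1 \<le> e \<and> (e = N \<or> T (r + 1, e) = None)" unfolding e_def
        by (rule LeastI[of _ N]) (rule N')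
    have "e \<le> N" unfolding e_def by (rule Least_le) (rule N')
    moreover have "T (r + 1, a) \<noteq> None \<longleftrightarrow> a < e" if "c + 1 \<le> a" "a < N" for a
    proof
      assume *: "T (r + 1, a) \<noteq> None"
      show "a < e"
      proof (rule ccontr)
        assume "\<not> a < e"
        then show False using down[OF *, of e] e that by auto
      qed
    next
      assume "a < e"
      then show "T (r + 1, a) \<noteq> None" using not_less_Least[of a] that unfolding e_def by blast
    qed
    ultimately show ?thesis using e by blast
  qed
  then obtain e where e: "c + 1 \<le> e" "e \<le> N"
    "\<And>a. c + 1 \<le> a \<Longrightarrow> a < N \<Longrightarrow> T (r + 1, a) \<noteq> None \<longleftrightarrow> a < e" by blast
  let ?F = "row_part T"
  define P0 where "P0 = ?F (r + 1) [0..<s]"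
  define P1 where "P1 = map (\<lambda>a. the (T (r + 1, a))) [s..<c]"
  define U where "U = map (\<lambda>a. the (T (r, a))) [s..<c]"
  define Q where "Q = map (\<lambda>a. the (T (r + 1, a))) [c + 1..<e]"
  define V1 where "V1 = map (\<lambda>a. the (T (r, a))) [c + 1..<e]"
  define V2 where "V2 = ?F r [e..<N]"
  have sp: "[0..<N] = [0..<c] @ c # [c + 1..<N]" using upto_split[of 0 c N] rN by simp
  have "[0..<c] = [0..<s] @ [s..<c]" using s(1) by (metis upt_append zero_le)
  moreover have "filter (\<lambda>a. T (r + 1, a) \<noteq> None) [s..<c] = [s..<c]" using below
      by (intro filter_True) auto
  ultimately have P: "?F (r + 1) [0..<c] = P0 @ P1" by (simp add: row_part_def P0_def P1_def)
  have U': "?F r [0..<c] = U" using filter_upt_ge[OF s] by (simp add: row_part_def U_def)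
  have Q': "?F (r + 1) [c + 1..<N] = Q" using filter_upt_less[OF e]
      by (simp add: row_part_def Q_def)
  have "[c + 1..<N] = [c + 1..<e] @ [e..<N]" using e by (metis upt_append)
  moreover have "filter (\<lambda>a. T (r, a) \<noteq> None) [c + 1..<e] = [c + 1..<e]"
    using above e by (intro filter_True) auto
  ultimately have V: "?F r [c + 1..<N] = V1 @ V2" by (simp add: row_part_def V1_def V2_def)
  have Trc: "T (r, c) = None" using domT[of "(r, c)"] by auto
  have rw: "row_word N T' k = row_part T' k [0..<c] @ (case T' (k, c) of None \<Rightarrow> [] | Some x \<Rightarrow> [x]) @
      row_part T' k [c + 1..<N]" for T' k
  proof -
    have "row_word N T' k = row_part T' k ([0..<c] @ c # [c + 1..<N])"
      unfolding row_word_def row_part_def sp ..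
    then show ?thesis by (simp add: row_part_append row_part_Cons)
  qed
  have rows: "row_word N T (r + 1) = P0 @ P1 @ y # Q" "row_word N T r = U @ V1 @ V2"
    unfolding rw using P Q' U' V y Trc by simp_all
  have "row_part ?T k [0..<c] = ?F k [0..<c]" "row_part ?T k [c + 1..<N] = ?F k [c + 1..<N]" for k
    by (intro row_part_cong; simp)+
  then have rows': "row_word N ?T (r + 1) = P0 @ P1 @ Q" "row_word N ?T r = U @ y # V1 @ V2"
    unfolding rw using P Q' U' V by simp_all
  have so: "sorted (P1 @ y # Q)" using sorted_row_word[OF cs, of N "r + 1"] rows
      by (simp add: sorted_append)
  have so': "sorted (U @ y # V1)" using sorted_row_word[OF cs', of N r] rows'
      by (auto simp: sorted_append)
  have UP: "list_all2 (<) U P1"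
  proof -
    have "the (T (r, a)) < the (T (r + 1, a))" if "a < c" "s \<le> a" for a
      using that s(2)[of a] below[of a] column_strict_column[OF cs, of r a _ "r + 1"] by auto
    then show ?thesis by (auto simp: U_def P1_def list_all2_conv_all_nth)
  qed
  have VQ: "list_all2 (<) V1 Q"
  proof -
    have "the (T (r, a)) < the (T (r + 1, a))" if "a < e" "c + 1 \<le> a" for a
      using that e(2) e(3)[of a] above[of a] column_strict_column[OF cs, of r a _ "r + 1"] by auto
    then show ?thesis by (auto simp: V1_def Q_def list_all2_conv_all_nth)
  qed
  have "P0 @ (P1 @ y # Q @ U @ V1) @ V2 \<approx> P0 @ (P1 @ Q @ U @ y # V1) @ V2"
    by (intro knuth_append knuth_refl knuth_vertical_move UP VQ so so')
  then have two: "row_word N T (r + 1) @ row_word N T r \<approx> row_word N ?T (r + 1) @ row_word N ?T r"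
    using rows rows' by simp
  have other: "row_word N ?T k = row_word N T k" if "k \<noteq> r" "k \<noteq> r + 1" for k
    using that by (simp add: row_word_def)
  have "[0..<N] = [0..<r] @ r # (r + 1) # [r + 2..<N]"
    using rN upto_split[of 0 r N] upto_split[of "r + 1" "r + 1" N] by simp
  then have sr: "rev [0..<N] = rev [r + 2..<N] @ [r + 1, r] @ rev [0..<r]" by simp
  have m: "map (row_word N ?T) (rev [r + 2..<N]) = map (row_word N T) (rev [r + 2..<N])"
    "map (row_word N ?T) (rev [0..<r]) = map (row_word N T) (rev [0..<r])"
    using other by auto
  have "concat (map (row_word N T) (rev [r + 2..<N])) @ (row_word N T (r + 1) @ row_word N T r)
      @ concat (map (row_word N T) (rev [0..<r])) \<approx>
    concat (map (row_word N T) (rev [r + 2..<N])) @ (row_word N ?T (r + 1) @ row_word N ?T r)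
      @ concat (map (row_word N T) (rev [0..<r]))"
    by (intro knuth_append knuth_refl two)
  moreover have "reading N T = concat (map (row_word N T) (rev [r + 2..<N]))
      @ (row_word N T (r + 1) @ row_word N T r) @ concat (map (row_word N T) (rev [0..<r]))"
    unfolding reading_def sr by simp
  moreover have "reading N ?T = concat (map (row_word N T) (rev [r + 2..<N]))
      @ (row_word N ?T (r + 1) @ row_word N ?T r) @ concat (map (row_word N T) (rev [0..<r]))"
    unfolding reading_def sr map_append m by simp
  ultimately show ?thesis by simp
qed

lemma down_closed_remove:
  assumes D: "down_closed D" and rc: "(r, c) \<in> D" "(r + 1, c) \<notin> D" "(r, c + 1) \<notin> D"
  shows "down_closed (D - {(r, c)})"
proof -
  have "(r', c') \<in> D - {(r, c)}"
    if "(a, b) \<in> D" "(a, b) \<noteq> (r, c)" "1 \<le> r'" "r' \<le> a" "1 \<le> c'" "c' \<le> b" for a b r' c'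
  proof -
    have "(r', c') \<noteq> (r, c)"
    proof
      assume "(r', c') = (r, c)"
      then have "r + 1 \<le> a \<or> c + 1 \<le> b" "1 \<le> r" "r \<le> a" "1 \<le> c" "c \<le> b" using that by auto
      then show False
        using down_closedD(1)[OF D that(1), of r "c + 1"] down_closedD(1)[OF D that(1), of "r +
            1" c] rc
        by auto
    qed
    then show ?thesis using down_closedD(1)[OF D that(1)] that by blast
  qed
  then show ?thesis using down_closedD(2,3)[OF D] unfolding down_closed_def by blast
qed

text \<open>When the slide stops, neither neighbour of the hole lies in \<open>D\<close>, so taking
  the hole out of \<open>D\<close> leaves a diagram. Moves to the left do not alter the reading at
  all; moves upwards preserve its Knuth class.\<close>

lemma slide_result:
  assumes "jdt_slide h T T'" "hole_state D J h T" "D \<subseteq> {..<N} \<times> {..<N}"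
  shows "\<exists>D'. down_closed D' \<and> J \<subseteq> D' \<and> D' \<subseteq> D \<and> dom T' = D' - J \<and> column_strict T' \<and>
    reading N T \<approx> reading N T'"
  using assms
proof (induction rule: jdt_slide.induct)
  case (stop T r c)
  have D: "down_closed D" "down_closed J" "J \<subseteq> D" "(r, c) \<in> D" "(r, c) \<notin> J" "dom T = D - J - {(r,
      c)}"
    "column_strict T"
    using stop by (simp_all add: hole_state_def)
  have rc: "1 \<le> r" "1 \<le> c" using down_closedD(2,3)[OF D(1) D(4)] by simp_all
  have "(r, c + 1) \<notin> dom T" "(r + 1, c) \<notin> dom T" using stop by (auto simp: domIff)
  moreover have "(r, c + 1) \<notin> J" "(r + 1, c) \<notin> J"
    using down_closedD(1)[OF D(2), of r "c + 1" r c] down_closedD(1)[OF D(2), of "r +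
        1" c r c] D(5) rc by auto
  ultimately have out: "(r, c + 1) \<notin> D" "(r + 1, c) \<notin> D" using D(6) by auto
  have "down_closed (D - {(r, c)})" using down_closed_remove[OF D(1,4)] out by simp
  then show ?case using D by (intro exI[of _ "D - {(r, c)}"]) auto
next
  case (up T r c y T')
  then show ?case using hole_state_up[of D J r c T y] reading_up[of D J r c T y N] knuth_trans
      by blast
next
  case (left T r c x T')
  have "(r, c + 1) \<in> dom T" "dom T = D - J - {(r, c)}" using left by (auto simp: hole_state_def)
  then have "T (r, c) = None" "c + 1 < N" using left.prems by auto
  then show ?case using left hole_state_left[of D J r c T x] reading_left[of T r c x N] by metis
qed

text \<open>Every move takes the hole to the next antidiagonal, so fewer boxes of \<open>D\<close>
  lie beyond it.\<close>

lemma slide_exists: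
  assumes "hole_state D J h T" "finite D"
  shows "\<exists>T'. jdt_slide h T T'"
  using assms
proof (induction "card {b \<in> D. fst h + snd h < fst b + snd b}" arbitrary: h T rule: less_induct)
  case less
  obtain r c where h: "h = (r, c)" by fastforce
  have dT: "dom T \<subseteq> D" using less.prems by (auto simp: hole_state_def)
  have smaller: "card {b \<in> D. fst h' + snd h' < fst b + snd b} < card {b \<in> D. fst h +
      snd h < fst b + snd b}"
    if "h' \<in> dom T" "fst h + snd h < fst h' + snd h'" for h'
    by (rule psubset_card_mono) (use that less.prems dT in auto)
  have up: "\<exists>T'. jdt_slide h T T'"
    if y: "T (r + 1, c) = Some y" and yx: "\<And>x. T (r, c + 1) = Some x \<Longrightarrow> y \<le> x" for y
  proof -
    have "hole_state D J (r + 1, c) (T((r, c) \<mapsto> y, (r + 1, c) := None))"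
      using less.prems(1) y yx unfolding h by (rule hole_state_up)
    then obtain T' where "jdt_slide (r + 1, c) (T((r, c) \<mapsto> y, (r + 1, c) := None)) T'"
      using less.hyps[OF smaller[of "(r + 1, c)"]] less.prems(2) y by (auto simp: h)
    with y yx have "jdt_slide (r, c) T T'" by (rule jdt_slide.up)
    then show ?thesis using h by blast
  qed
  have left: "\<exists>T'. jdt_slide h T T'"
    if x: "T (r, c + 1) = Some x" and xy: "\<And>y. T (r + 1, c) = Some y \<Longrightarrow> x < y" for x
  proof -
    have "hole_state D J (r, c + 1) (T((r, c) \<mapsto> x, (r, c + 1) := None))"
      using less.prems(1) x xy unfolding h by (rule hole_state_left)
    then obtain T' where "jdt_slide (r, c + 1) (T((r, c) \<mapsto> x, (r, c + 1) := None)) T'"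
      using less.hyps[OF smaller[of "(r, c + 1)"]] less.prems(2) x by (auto simp: h)
    with x xy have "jdt_slide (r, c) T T'" by (rule jdt_slide.left)
    then show ?thesis using h by blast
  qed
  show ?case
  proof (cases "T (r, c + 1)")
    case None
    then show ?thesis
      by (cases "T (r + 1, c)") (use up h jdt_slide.stop in auto)
  next
    case (Some x)
    show ?thesis
    proof (cases "T (r + 1, c)")
      case None
      then show ?thesis using left[OF Some] by simp
    next
      case (Some y)
      then show ?thesis using up[OF Some] left[OF \<open>T (r, c + 1) = Some x\<close>] \<open>T (r, c + 1) = Some x\<close>
        by (cases "y \<le> x") auto
    qed
  qed
qed

section \<open>Existence of a complete sequence of slides\<close>

definition skew :: "nat \<Rightarrow> (nat \<times> nat) set \<Rightarrow> tableau \<Rightarrow> bool" where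
  "skew N I T \<longleftrightarrow> down_closed I \<and> column_strict T \<and>
     (\<exists>D. down_closed D \<and> I \<subseteq> D \<and> D \<subseteq> {..<N} \<times> {..<N} \<and> dom T = D - I)"

lemma corner_hole_state:
  assumes "skew N I T" "corner I b"
  shows "\<exists>D. D \<subseteq> {..<N} \<times> {..<N} \<and> hole_state D (I - {b}) b T"
proof -
  obtain D where D: "down_closed D" "I \<subseteq> D" "D \<subseteq> {..<N} \<times> {..<N}" "dom T = D - I"
    and I: "down_closed I" and cs: "column_strict T"
    using assms(1) by (auto simp: skew_def)
  obtain r c where b: "b = (r, c)" by fastforce
  have c: "(r, c) \<in> I" "(r + 1, c) \<notin> I" "(r, c + 1) \<notin> I" using assms(2) b by (auto simp: corner_def)
  have "down_closed (I - {b})" using down_closed_remove[OF I c(1)] c b by simp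
  then have "hole_state D (I - {b}) b T"
    using D I cs c b by (auto simp: hole_state_def)
  then show ?thesis using D by blast
qed

lemma jdt_step_result:
  assumes "jdt_step IT IT'" "skew N (fst IT) (snd IT)"
  shows "skew N (fst IT') (snd IT') \<and> reading N (snd IT) \<approx> reading N (snd IT')"
  using assms
proof (induction rule: jdt_step.induct)
  case (1 I b T T')
  then obtain D where D: "D \<subseteq> {..<N} \<times> {..<N}" "hole_state D (I - {b}) b T"
    using corner_hole_state[of N I T b] by auto
  obtain D' where D': "down_closed D'" "I - {b} \<subseteq> D'" "D' \<subseteq> D" "dom T' = D' - (I - {b})"
    "column_strict T'" "reading N T \<approx> reading N T'"
    using slide_result[OF 1(2) D(2,1)] by blast
  moreover have "down_closed (I - {b})" using D(2) by (simp add: hole_state_def)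
  moreover have "D' \<subseteq> {..<N} \<times> {..<N}" using D(1) D'(3) by blast
  ultimately show ?case unfolding skew_def fst_conv snd_conv by blast
qed

lemma jdt_steps_result:
  assumes "jdt_step\<^sup>*\<^sup>* IT IT'" "skew N (fst IT) (snd IT)"
  shows "skew N (fst IT') (snd IT') \<and> reading N (snd IT) \<approx> reading N (snd IT')"
  using assms
  by (induction rule: rtranclp_induct) (auto dest!: jdt_step_result intro: knuth_trans)

lemma jdt_steps_exist:
  assumes "skew N I T"
  shows "\<exists>T'. jdt_step\<^sup>*\<^sup>* (I, T) ({}, T')"
  using assms
proof (induction "card I" arbitrary: I T rule: less_induct)
  case less
  show ?case
  proof (cases "I = {}")
    case False
    have "I \<subseteq> {..<N} \<times> {..<N}" using less.prems unfolding skew_def by blast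
    then have fin: "finite I" by (rule finite_subset) simp
    \<comment> \<open>A box of \<open>I\<close> with maximal \<open>r + c\<close> has neither a
      right nor a lower neighbour in \<open>I\<close>, hence is a corner.\<close>
    define m where "m = Max ((\<lambda>(r, c). r + c) ` I)"
    have "m \<in> (\<lambda>(r, c). r + c) ` I" unfolding m_def using fin False by (intro Max_in) auto
    then obtain r c where rc: "(r, c) \<in> I" "r + c = m" by auto
    have "b \<le> m" if "b \<in> (\<lambda>(r, c). r + c) ` I" for b unfolding m_def using fin that
        by (intro Max_ge) auto
    then have "corner I (r, c)" using rc unfolding corner_def by fastforce
    moreover obtain D where D: "D \<subseteq> {..<N} \<times> {..<N}" "hole_state D (I - {(r, c)}) (r, c) T"
      using corner_hole_state[OF less.prems \<open>corner I (r, c)\<close>] by auto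
    moreover have "finite D" using D by (auto intro: finite_subset)
    ultimately obtain T' where s: "jdt_step (I, T) (I - {(r, c)}, T')"
      using slide_exists[of D] jdt_step.intros by blast
    then have "skew N (I - {(r, c)}) T'" using jdt_step_result[OF s] less.prems by simp
    moreover have "card (I - {(r, c)}) < card I" using rc fin by (intro psubset_card_mono) auto
    ultimately show ?thesis using less.hyps s by (meson converse_rtranclp_into_rtranclp)
  qed auto
qed

section \<open>Passing between lists of rows and maps on boxes\<close>

definition tab_map :: "nat list list \<Rightarrow> tableau" where
  "tab_map L = (\<lambda>(r, c). if 1 \<le> r \<and> r \<le> length L \<and> 1 \<le> c \<and> c \<le> length (L ! (r - 1))
     then Some (L ! (r - 1) ! (c - 1)) else None)"

text \<open>The offsets \<open>s\<close> allow one lemma to serve straight tableaux, with offset 0,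
  and juxtapositions, whose upper rows are moved to the right.\<close>

lemma reading_shifted:
  assumes T: "\<And>r c. T (r, c) = (if 1 \<le> r \<and> r \<le> length L \<and> s r < c \<and> c \<le> s r + length (L ! (r - 1))
      then Some (L ! (r - 1) ! (c - s r - 1)) else None)"
    and N: "length L < N" "\<And>r. 1 \<le> r \<Longrightarrow> r \<le> length L \<Longrightarrow> s r + length (L ! (r - 1)) < N"
  shows "reading N T = word L"
proof -
  define f where "f r = (if 1 \<le> r \<and> r \<le> length L then L ! (r - 1) else [])" for r
  have "row_word N T r = f r" for r
  proof (cases "1 \<le> r \<and> r \<le> length L")
    case True
    let ?n = "length (L ! (r - 1))"
    have sp: "[0..<N] = [0..<Suc (s r)] @ [Suc (s r)..<Suc (s r + ?n)] @ [Suc (s r + ?n)..<N]"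
      using upt_append[of 0 "Suc (s r)" N] upt_append[of "Suc (s r)" "Suc (s r +
          ?n)" N] N(2)[of r] True
      by simp
    have "filter (\<lambda>c. T (r, c) \<noteq> None) [0..<Suc (s r)] = []"
      by (auto simp: filter_empty_conv T simp del: upt_Suc)
    moreover have "filter (\<lambda>c. T (r, c) \<noteq> None) [Suc (s r + ?n)..<N] = []"
      by (auto simp: filter_empty_conv T)
    moreover have "filter (\<lambda>c. T (r, c) \<noteq> None) [Suc (s r)..<Suc (s r + ?n)] =
        [Suc (s r)..<Suc (s r + ?n)]"
      using True by (intro filter_True) (auto simp: T simp del: upt_Suc)
    ultimately have "row_word N T r = map (\<lambda>c. the (T (r, c))) [Suc (s r)..<Suc (s r + ?n)]"
      unfolding row_word_def sp filter_append by (simp del: upt_Suc)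
    also have "\<dots> = L ! (r - 1)"
      by (rule nth_equalityI) (use True in \<open>auto simp: T simp del: upt_Suc\<close>)
    finally show ?thesis using True by (simp add: f_def)
  next
    case False
    then show ?thesis by (auto simp: row_word_def T f_def)
  qed
  then have "row_word N T = f" by blast
  \<comment> \<open>Row index 0 and the indices beyond the last row contribute empty words.\<close>
  moreover have "map f [0..<N] = [[]] @ L @ replicate (N - length L - 1) []"
    by (rule nth_equalityI) (use N in \<open>auto simp: f_def nth_append nth_Cons split: nat.splits\<close>)
  moreover have "concat (rev (replicate k [])) = []" for k by (induction k) auto
  ultimately show ?thesis by (simp add: reading_def word_def rev_map[symmetric])
qed

lemma wtab_nthI:
  "(\<And>i. i < length L \<Longrightarrow> sorted (L ! i)) \<Longrightarrow> (\<And>i. Suc i < length L \<Longrightarrow> over (L ! i) (L ! Suc i)) \<Longrightarrow> wtab L"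
proof (induction L)
  case (Cons R L)
  have "wtab L" using Cons.prems(1)[of "Suc i" for i] Cons.prems(2)[of "Suc i" for i]
      by (intro Cons.IH) auto
  moreover have "sorted R" using Cons.prems(1)[of 0] by simp
  moreover have "over R (first_row L)" using Cons.prems(2)[of 0] by (cases L) auto
  ultimately show ?case by simp
qed simp

lemma wtab_over: "wtab L \<Longrightarrow> i < j \<Longrightarrow> j < length L \<Longrightarrow> over (L ! i) (L ! j)"
proof (induction L arbitrary: i j)
  case (Cons R L)
  obtain j' where j: "j = Suc j'" "j' < length L" using Cons.prems by (cases j) auto
  show ?case
  proof (cases i)
    case 0
    show ?thesis
    proof (cases j')
      case 0
      then show ?thesis using Cons.prems j \<open>i = 0\<close> by (cases L) auto
    next
      case (Suc k)
      then have "over (L ! 0) (L ! j')" using Cons j by simp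
      moreover have "over R (L ! 0)" using Cons.prems j by (cases L) auto
      ultimately have "over R (L ! j')" unfolding over_def
          by (meson less_le_trans less_trans order_trans)
      then show ?thesis using 0 j by simp
    qed
  next
    case (Suc i')
    then show ?thesis using Cons j by simp
  qed
qed simp

lemma initial_segment_card:
  assumes "finite S" "\<And>c. c \<in> S \<Longrightarrow> 1 \<le> c" "\<And>c c'. c \<in> S \<Longrightarrow> 1 \<le> c' \<Longrightarrow> c' \<le> c \<Longrightarrow> c' \<in> S"
  shows "c \<in> S \<longleftrightarrow> 1 \<le> c \<and> c \<le> card (S::nat set)"
proof (cases "S = {}")
  case False
  then have m: "Max S \<in> S" using assms(1) by simp
  have "x \<in> S \<longleftrightarrow> x \<in> {1..Max S}" for x
    using assms(2)[of x] assms(3)[OF m, of x] Max_ge[OF assms(1), of x] by auto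
  then obtain k where "S = {1..k}" by blast
  then show ?thesis by simp
qed auto

text \<open>A diagram meets its first column and each of its rows in an initial segment, so the
  number of rows and their lengths can be recovered as cardinalities.\<close>

lemma straight_tab_map:
  assumes "skew N {} T" "0 < N"
  shows "\<exists>L. tab L \<and> T = tab_map L \<and> reading N T = word L"
proof -
  have D: "down_closed (dom T)" "dom T \<subseteq> {..<N} \<times> {..<N}" and cs: "column_strict T"
    using assms by (auto simp: skew_def)
  define H where "H = card {r. (r, 1) \<in> dom T}"
  define l where "l r = card {c. (r, c) \<in> dom T}" for r
  have sub: "{r. (r, k) \<in> dom T} \<subseteq> {..<N}" "{c. (k, c) \<in> dom T} \<subseteq> {..<N}" for k
    using D(2) by blast+
  note fin = sub[THEN finite_subset, OF finite_lessThan]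
  have "r \<in> {r. (r, 1) \<in> dom T} \<longleftrightarrow> 1 \<le> r \<and> r \<le> H" for r
    unfolding H_def
  proof (rule initial_segment_card[OF fin(1)])
    fix c c' assume "c \<in> {r. (r, 1) \<in> dom T}"
    then have *: "(c, 1) \<in> dom T" by simp
    show "1 \<le> c" using down_closedD(2)[OF D(1) *] .
    assume "1 \<le> c'" "c' \<le> c"
    then show "c' \<in> {r. (r, 1) \<in> dom T}" using down_closedD(1)[OF D(1) *, of c' 1] by simp
  qed
  then have H: "(r, 1) \<in> dom T \<longleftrightarrow> 1 \<le> r \<and> r \<le> H" for r by (simp del: One_nat_def)
  have "c \<in> {c. (r, c) \<in> dom T} \<longleftrightarrow> 1 \<le> c \<and> c \<le> l r" for r c
    unfolding l_def
  proof (rule initial_segment_card[OF fin(2)])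
    fix c c' assume "c \<in> {c. (r, c) \<in> dom T}"
    then have *: "(r, c) \<in> dom T" by simp
    show "1 \<le> c" using down_closedD(3)[OF D(1) *] .
    assume "1 \<le> c'" "c' \<le> c"
    then show "c' \<in> {c. (r, c) \<in> dom T}" using down_closedD(1)[OF D(1) *,
        of r c'] down_closedD(2)[OF D(1) *] by simp
  qed
  then have l: "(r, c) \<in> dom T \<longleftrightarrow> 1 \<le> c \<and> c \<le> l r" for r c by (simp del: One_nat_def)
  have in_dom: "(r, c) \<in> dom T \<longleftrightarrow> 1 \<le> r \<and> r \<le> H \<and> 1 \<le> c \<and> c \<le> l r" for r c
  proof
    assume *: "(r, c) \<in> dom T"
    then have c: "1 \<le> c" "c \<le> l r" using l by blast+
    have "1 \<le> r" using down_closedD(2)[OF D(1) *] .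
    then have "(r, 1) \<in> dom T" using down_closedD(1)[OF D(1) *, of r 1] c by simp
    then show "1 \<le> r \<and> r \<le> H \<and> 1 \<le> c \<and> c \<le> l r" using H c by blast
  qed (use l in blast)
  define L where "L = map (\<lambda>r. map (\<lambda>c. the (T (r, c))) [1..<Suc (l r)]) [1..<Suc H]"
  have len: "length L = H" by (simp add: L_def del: upt_Suc)
  have row: "L ! (r - 1) = map (\<lambda>c. the (T (r, c))) [1..<Suc (l r)]" if "1 \<le> r" "r \<le> H" for r
  proof -
    have "[1..<Suc H] ! (r - 1) = r" using that nth_upt[of 1 "r - 1" "Suc H"] by simp
    then show ?thesis using that unfolding L_def by (subst nth_map) (auto simp del: upt_Suc)
  qed
  have T: "T = tab_map L"
  proof
    fix b :: "nat \<times> nat"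
    obtain r c where b: "b = (r, c)" by fastforce
    show "T b = tab_map L b"
    proof (cases "(r, c) \<in> dom T")
      case True
      then have rc: "1 \<le> r" "r \<le> H" "1 \<le> c" "c \<le> l r" using in_dom by auto
      have "[1..<Suc (l r)] ! (c - 1) = c" using rc nth_upt[of 1 "c - 1" "Suc (l r)"] by simp
      then have "L ! (r - 1) ! (c - 1) = the (T (r, c))" using rc row by (simp del: upt_Suc)
      moreover have "length (L ! (r - 1)) = l r" using row rc by simp
      ultimately show ?thesis using rc True by (auto simp: b tab_map_def len)
    next
      case False
      moreover have "length (L ! (r - 1)) = l r" if "1 \<le> r" "r \<le> H" using row that by simp
      ultimately show ?thesis using in_dom[of r c] by (auto simp: b tab_map_def len)
    qed
  qed
  have "wtab L"
  proof (rule wtab_nthI)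
    fix i assume i: "i < length L"
    have "sorted_wrt (\<lambda>c c'. the (T (Suc i, c)) \<le> the (T (Suc i, c'))) [1..<Suc (l (Suc i))]"
    proof (rule sorted_wrt_mono_rel[where P = "(<)"])
      fix c c' assume "c \<in> set [1..<Suc (l (Suc i))]" "c' \<in> set [1..<Suc (l (Suc i))]" "c < c'"
      then have "(Suc i, c) \<in> dom T" "(Suc i, c') \<in> dom T" using l by auto
      then show "the (T (Suc i, c)) \<le> the (T (Suc i, c'))"
        using column_strict_row[OF cs] \<open>c < c'\<close> by fastforce
    qed (simp del: upt_Suc)
    then show "sorted (L ! i)" using row[of "Suc i"] i len
        by (simp add: sorted_wrt_map del: upt_Suc)
  next
    fix i assume i: "Suc i < length L"
    have le: "l (Suc (Suc i)) \<le> l (Suc i)"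
    proof (cases "l (Suc (Suc i)) = 0")
      case False
      then have "(Suc (Suc i), l (Suc (Suc i))) \<in> dom T" using l by simp
      then have "(Suc i, l (Suc (Suc i))) \<in> dom T" using down_closedD(1)[OF D(1),
          of "Suc (Suc i)" "l (Suc (Suc i))"] False by simp
      then show ?thesis using l by simp
    qed simp
    have "the (T (Suc i, Suc j)) < the (T (Suc (Suc i), Suc j))" if "j < l (Suc (Suc i))" for j
    proof -
      have "(Suc i, Suc j) \<in> dom T" "(Suc (Suc i), Suc j) \<in> dom T" using that le l by auto
      then show ?thesis using column_strict_column[OF cs, of "Suc i" "Suc j" _ "Suc (Suc i)"]
          by fastforce
    qed
    then show "over (L ! i) (L ! Suc i)"
      using le row[of "Suc i"] row[of "Suc (Suc i)"] i len by (simp add: over_def del: upt_Suc)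
  qed
  moreover have "[] \<notin> set L"
  proof
    assume "[] \<in> set L"
    then obtain r where "1 \<le> r" "r \<le> H" "l r = 0" by (auto simp: L_def simp del: upt_Suc)
    then show False using H[of r] l[of r 1] by simp
  qed
  ultimately have "tab L" by (simp add: tab_def)
  moreover have "reading N T = word L"
  proof (rule reading_shifted[where s = "\<lambda>_. 0"])
    show "length L < N"
      using H[of H] D(2) len assms(2) by (cases "H = 0") auto
    fix r assume "1 \<le> r" "r \<le> length L"
    then show "0 + length (L ! (r - 1)) < N"
      using l[of r "l r"] row[of r] D(2) len assms(2) by (cases "l r = 0") auto
  qed (auto simp: T tab_map_def)
  ultimately show ?thesis using T by blast
qed

lemma wtab_sh_mono: "wtab L \<Longrightarrow> i \<le> j \<Longrightarrow> sh L j \<le> sh L i"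
  by (rule lift_Suc_antimono_le[of "sh L"]) (auto intro: wtab_sh_antimono)

definition shape_set :: "nat list list \<Rightarrow> (nat \<times> nat) set" where
  "shape_set L = {(r, c). 1 \<le> r \<and> 1 \<le> c \<and> c \<le> sh L (r - 1)}"

lemma tab_map_apply: "tab_map L (r, c) = (if 1 \<le> r \<and> r \<le> length L \<and> 1 \<le> c \<and> c \<le> length (L ! (r - 1))
     then Some (L ! (r - 1) ! (c - 1)) else None)"
  by (simp add: tab_map_def)

lemma dom_tab_map: "dom (tab_map L) = shape_set L"
proof -
  have "(r, c) \<in> dom (tab_map L) \<longleftrightarrow> (r, c) \<in> shape_set L" for r c
    by (cases r) (auto simp: tab_map_def shape_set_def sh_def split: if_splits)
  then show ?thesis by auto
qed

lemma tab_map_shape_set: "(r, c) \<in> shape_set L \<Longrightarrow> tab_map L (r, c) = Some (L ! (r - 1) ! (c - 1))"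
  by (cases r) (auto simp: tab_map_def shape_set_def sh_def split: if_splits)

lemma shape_set_rows: "(r, c) \<in> shape_set L \<Longrightarrow> 1 \<le> r \<and> r \<le> length L \<and> 1 \<le> c \<and>
    c \<le> length (L ! (r - 1))"
  by (cases r) (auto simp: shape_set_def sh_def split: if_splits)

lemma down_closed_shape_set: "wtab L \<Longrightarrow> down_closed (shape_set L)"
  unfolding down_closed_def shape_set_def
proof (safe, goal_cases)
  case (1 r c r' c')
  then have "sh L (r - 1) \<le> sh L (r' - 1)" by (intro wtab_sh_mono) auto
  then show ?case using 1 by simp
qed

lemma column_strict_tab_map:
  assumes "wtab L"
  shows "column_strict (tab_map L)"
proof (rule column_strictI)
  fix r c c' x y assume c: "c < c'" and x: "tab_map L (r, c) = Some x"
      and y: "tab_map L (r, c') = Some y"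
  have d: "(r, c) \<in> shape_set L" "(r, c') \<in> shape_set L" using x y dom_tab_map by blast+
  have "sorted (L ! (r - 1))" using shape_set_rows[OF d(1)] assms by (intro wtab_sorted[of L]) auto
  then have "L ! (r - 1) ! (c - 1) \<le> L ! (r - 1) ! (c' - 1)"
    using shape_set_rows[OF d(2)] c by (intro sorted_nth_mono) auto
  then show "x \<le> y" using x y tab_map_shape_set d by auto
next
  fix r r' c x y assume r: "r < r'" and x: "tab_map L (r, c) = Some x"
      and y: "tab_map L (r', c) = Some y"
  have d: "(r, c) \<in> shape_set L" "(r', c) \<in> shape_set L" using x y dom_tab_map by blast+
  have "over (L ! (r - 1)) (L ! (r' - 1))"
    using shape_set_rows[OF d(1)] shape_set_rows[OF d(2)] r assms by (intro wtab_over) auto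
  then have "L ! (r - 1) ! (c - 1) < L ! (r' - 1) ! (c - 1)"
    using shape_set_rows[OF d(2)] by (auto simp: over_def)
  then show "x < y" using x y tab_map_shape_set d by auto
qed

lemma ran_tab_map: "ran (tab_map L) = set (word L)"
proof
  show "ran (tab_map L) \<subseteq> set (word L)"
    by (auto simp: ran_def tab_map_def set_word split: if_splits) (metis Suc_le_lessD Suc_pred
        less_le_trans nth_mem diff_Suc_less)
  show "set (word L) \<subseteq> ran (tab_map L)"
  proof
    fix x assume "x \<in> set (word L)"
    then obtain R where "R \<in> set L" "x \<in> set R" by (auto simp: set_word)
    then obtain i j where "i < length L" "j < length (L ! i)" "L ! i ! j = x"
        by (metis in_set_conv_nth)
    then have "tab_map L (Suc i, Suc j) = Some x" by (simp add: tab_map_def)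
    then show "x \<in> ran (tab_map L)" by (rule ranI)
  qed
qed

lemma tab_map_inj:
  assumes "tab L" "tab L'" "tab_map L = tab_map L'"
  shows "L = L'"
proof -
  define N where "N = Suc (length L + length L' + sh L 0 + sh L' 0)"
  have "reading N (tab_map K) = word K" if "tab K" "length K < N" "sh K 0 < N" for K
  proof (rule reading_shifted[where s = "\<lambda>_. 0"])
    fix r assume "1 \<le> r" "r \<le> length K"
    then have "length (K ! (r - 1)) = sh K (r - 1)" by (cases r) (simp_all add: sh_def)
    also have "\<dots> \<le> sh K 0" using that by (intro wtab_sh_mono tab_wtab) auto
    finally show "0 + length (K ! (r - 1)) < N" using that by simp
  qed (use that in \<open>auto simp: tab_map_def\<close>)
  then have "word L = word L'" using assms by (metis N_def add.assoc le_add1 le_add2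
      le_imp_less_Suc trans_le_add1 trans_le_add2)
  then show ?thesis using tab_unique[OF assms(1,2)] by simp
qed

text \<open>Every complete sequence of slides ends in a straight tableau whose word is Knuth
  equivalent to the initial reading. Uniqueness in the Knuth class makes the end independent of the
  chosen corners.\<close>

lemma rectification_eq:
  assumes "skew N I T" "0 < N" "tab L" "word L \<approx> reading N T"
  shows "rectification I T = tab_map L"
proof -
  have u: "T' = tab_map L" if s: "jdt_step\<^sup>*\<^sup>* (I, T) ({}, T')" for T'
  proof -
    have T': "skew N {} T'" "reading N T \<approx> reading N T'" using jdt_steps_result[OF s] assms(1)
        by auto
    then obtain L' where L': "tab L'" "T' = tab_map L'" "reading N T' = word L'"
      using straight_tab_map assms(2) by blast
    then have "word L \<approx> word L'" using knuth_trans[OF assms(4) T'(2)] by simp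
    then show ?thesis using tab_unique assms(3) L' by blast
  qed
  obtain T' where "jdt_step\<^sup>*\<^sup>* (I, T) ({}, T')" using jdt_steps_exist[OF assms(1)] by blast
  then show ?thesis unfolding rectification_def using u by (metis (no_types, lifting) the_equality)
qed

section \<open>The plactic product in terms of words\<close>

lemma height_tab_map:
  assumes "tab L"
  shows "height (tab_map L) = length L"
proof -
  have "fst ` dom (tab_map L) = {1..length L}"
  proof (intro set_eqI iffI)
    fix r assume "r \<in> {1..length L}"
    then have "(r, 1) \<in> shape_set L" using tab_length[OF assms, of "r - 1"]
        by (auto simp: shape_set_def)
    then show "r \<in> fst ` dom (tab_map L)" unfolding dom_tab_map by force
  next
    fix r assume "r \<in> fst ` dom (tab_map L)"
    then show "r \<in> {1..length L}" using shape_set_rows unfolding dom_tab_map by fastforce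
  qed
  then show ?thesis by (simp add: height_def)
qed

lemma width_tab_map:
  assumes "tab L"
  shows "width (tab_map L) = sh L 0"
proof -
  have "snd ` dom (tab_map L) = {1..sh L 0}"
  proof (intro set_eqI iffI)
    fix c assume "c \<in> {1..sh L 0}"
    then have "(1, c) \<in> shape_set L" by (auto simp: shape_set_def)
    then show "c \<in> snd ` dom (tab_map L)" unfolding dom_tab_map by force
  next
    fix c assume "c \<in> snd ` dom (tab_map L)"
    then obtain r where r: "(r, c) \<in> shape_set L" unfolding dom_tab_map by auto
    then have "sh L (r - 1) \<le> sh L 0" using assms by (intro wtab_sh_mono tab_wtab) auto
    then show "c \<in> {1..sh L 0}" using r by (auto simp: shape_set_def)
  qed
  then show ?thesis by (simp add: width_def)
qed

text \<open>Read from the bottom row upwards, the juxtaposition yields the word of \<open>L1\<close>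
  and then that of \<open>L2\<close>: as a list of rows it is \<open>L2 @ L1\<close> with the upper
  rows moved right.\<close>

lemma plactic_tab_map:
  assumes L1: "tab L1" and L2: "tab L2"
  shows "tab_map L1 \<star> tab_map L2 = tab_map (ptab (word L1 @ word L2))"
proof -
  define h where "h = length L2"
  define w where "w = sh L1 0"
  define N where "N = Suc (length L1 + length L2 + sh L1 0 + sh L2 0)"
  let ?I = "{1..h} \<times> {1..w}"
  let ?T = "juxtapose (tab_map L1) (tab_map L2)"
  have T: "?T (r, c) = (if r \<le> h then (if c \<le> w then None else tab_map L2 (r, c - w))
      else tab_map L1 (r - h, c))" for r c
    by (simp add: juxtapose_def height_tab_map[OF L2] width_tab_map[OF L1] h_def w_def)
  \<comment> \<open>The outer diagram: the inner rectangle, \<open>L2\<close> to its right and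
    \<open>L1\<close> below it.\<close>
  define D where "D = ?I \<union> {(r, c). r \<le> h \<and> w < c \<and> (r, c - w) \<in> shape_set L2}
      \<union> {(r, c). h < r \<and> (r - h, c) \<in> shape_set L1}"
  have sh0: "sh K i \<le> sh K 0" if "tab K" for K i using that by (intro wtab_sh_mono tab_wtab) auto
  have w': "c \<le> w" if "(r, c) \<in> shape_set L1" for r c
    using that sh0[OF L1, of "r - 1"] by (auto simp: shape_set_def w_def)
  have h': "r \<le> h" if "(r, c) \<in> shape_set L2" for r c
    using shape_set_rows[OF that] by (simp add: h_def)
  have top: "(r, 1) \<in> shape_set L2" if "1 \<le> r" "r \<le> h" for r
    using that tab_length[OF L2, of "r - 1"] by (auto simp: shape_set_def h_def)
  have dom: "dom ?T = D - ?I"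
  proof -
    have "(r, c) \<in> dom ?T \<longleftrightarrow> (r, c) \<in> D - ?I" for r c
    proof -
      have dL: "(a, b) \<in> shape_set K \<longleftrightarrow> tab_map K (a, b) \<noteq> None" for a b K
        using dom_tab_map[of K] by blast
      show ?thesis by (auto simp: D_def T domIff dL simp del: not_None_eq)
    qed
    then show ?thesis by (intro set_eqI) (metis surj_pair)
  qed
  have dc: "down_closed (shape_set L1)" "down_closed (shape_set L2)"
    using L1 L2 by (auto intro: down_closed_shape_set tab_wtab)
  have "down_closed D"
    unfolding down_closed_def
  proof (clarify, intro conjI allI impI)
    fix r c assume rc: "(r, c) \<in> D"
    show "1 \<le> r" using rc down_closedD(2)[OF dc(2), of r] by (auto simp: D_def)
    show "1 \<le> c" using rc down_closedD(3)[OF dc(1), of "r - h" c] by (auto simp: D_def)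
    fix r' c' assume le: "1 \<le> r'" "r' \<le> r" "1 \<le> c'" "c' \<le> c"
    consider "(r, c) \<in> ?I" | "r \<le> h" "w < c" "(r, c - w) \<in> shape_set L2"
      | "h < r" "(r - h, c) \<in> shape_set L1"
      using rc by (auto simp: D_def)
    then show "(r', c') \<in> D"
    proof cases
      case 2
      then show ?thesis using le down_closedD(1)[OF dc(2) 2(3), of r' "c' - w"]
        by (cases "c' \<le> w") (auto simp: D_def)
    next
      case 3
      then show ?thesis using le down_closedD(1)[OF dc(1) 3(2), of "r' - h" c'] w'[OF 3(2)]
        by (cases "r' \<le> h") (auto simp: D_def)
    qed (use le in \<open>auto simp: D_def\<close>)
  qed
  moreover have "D \<subseteq> {..<N} \<times> {..<N}"
  proof -
    have "r < N \<and> c < N" if rc: "(r, c) \<in> D" for r c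
    proof -
      consider "(r, c) \<in> ?I" | "r \<le> h" "(r, c - w) \<in> shape_set L2" | "(r - h, c) \<in> shape_set L1"
        using rc by (auto simp: D_def)
      then show ?thesis
      proof cases
        case 2
        then show ?thesis using sh0[OF L2, of "r - 1"]
            by (auto simp: shape_set_def N_def h_def w_def)
      next
        case 3
        then show ?thesis using w'[OF 3] shape_set_rows[OF 3] by (auto simp: N_def h_def w_def)
      qed (auto simp: N_def h_def w_def)
    qed
    then show ?thesis by auto
  qed
  moreover have "column_strict ?T"
  proof (rule column_strictI)
    fix r c c' x y assume c: "c < c'" "?T (r, c) = Some x" "?T (r, c') = Some y"
    show "x \<le> y"
    proof (cases "r \<le> h")
      case True
      then have "tab_map L2 (r, c - w) = Some x" "tab_map L2 (r, c' - w) = Some y"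
        using c by (auto simp: T split: if_splits)
      then show ?thesis using c column_strict_row[OF column_strict_tab_map[OF tab_wtab[OF L2]]]
          by auto
    next
      case False
      then show ?thesis using c column_strict_row[OF column_strict_tab_map[OF tab_wtab[OF L1]]]
        by (auto simp: T)
    qed
  next
    fix r r' c x y assume r: "r < r'" "?T (r, c) = Some x" "?T (r', c) = Some y"
    show "x < y"
    proof (cases "c \<le> w")
      case True
      then have "h < r" "h < r'" using r by (auto simp: T split: if_splits)
      then show ?thesis using r column_strict_column[OF column_strict_tab_map[OF tab_wtab[OF L1]],
          of "r - h" c x "r' - h" y]
        by (auto simp: T)
    next
      case False
      have "r' \<le> h"
      proof (rule ccontr)
        assume "\<not> r' \<le> h"
        then have "(r' - h, c) \<in> shape_set L1" using r dom_tab_map[of L1] by (auto simp: T)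
        then show False using w' False by auto
      qed
      then show ?thesis using r False column_strict_column[OF column_strict_tab_map[OF tab_wtab[OF
          L2]], of r "c - w" x r' y]
        by (auto simp: T)
    qed
  qed
  moreover have "?I \<subseteq> D" by (auto simp: D_def)
  moreover have "down_closed ?I" by (auto simp: down_closed_def)
  ultimately have skew: "skew N ?I ?T" using dom unfolding skew_def by blast
  have "reading N ?T = word (L2 @ L1)"
  proof (rule reading_shifted[where s = "\<lambda>r. if r \<le> h then w else 0"])
    fix r c
    show "?T (r, c) = (if 1 \<le> r \<and> r \<le> length (L2 @ L1) \<and> (if r \<le> h then w else 0) < c \<and>
        c \<le> (if r \<le> h then w else 0) + length ((L2 @ L1) ! (r - 1))
      then Some ((L2 @ L1) ! (r - 1) ! (c - (if r \<le> h then w else 0) - 1)) else None)"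
    proof (cases "r \<le> h")
      case True
      then show ?thesis by (cases r) (auto simp: T tab_map_apply h_def nth_append)
    next
      case False
      then have "(L2 @ L1) ! (r - 1) = L1 ! (r - h - 1)" by (auto simp: nth_append h_def)
      then show ?thesis using False by (auto simp: T tab_map_apply h_def)
    qed
  next
    fix r assume r: "1 \<le> r" "r \<le> length (L2 @ L1)"
    show "(if r \<le> h then w else 0) + length ((L2 @ L1) ! (r - 1)) < N"
    proof (cases "r \<le> h")
      case True
      then have "length ((L2 @ L1) ! (r - 1)) = sh L2 (r - 1)" using r
          by (auto simp: nth_append h_def sh_def)
      then show ?thesis using True sh0[OF L2, of "r - 1"] by (simp add: N_def w_def)
    next
      case False
      then have "length ((L2 @ L1) ! (r - 1)) = sh L1 (r - h - 1)" using r
          by (auto simp: nth_append h_def sh_def)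
      then show ?thesis using False sh0[OF L1, of "r - h - 1"] by (simp add: N_def)
    qed
  qed (simp add: N_def)
  then have "reading N ?T = word L1 @ word L2" by (simp add: word_def)
  then have "rectification ?I ?T = tab_map (ptab (word L1 @ word L2))"
    by (intro rectification_eq[OF skew]) (simp_all add: N_def word_ptab)
  then show ?thesis by (simp add: plactic_def height_tab_map L2 width_tab_map L1 h_def w_def)
qed

lemma tab_map_row: "tab_map (if k = 0 then [] else [replicate k i]) = one_row i k"
  by (auto simp: tab_map_def one_row_def fun_eq_iff)

lemma plactic_one_row:
  assumes "tab L"
  shows "tab_map L \<star> one_row i k = tab_map (ptab (word L @ replicate k i))"
    and "one_row i k \<star> tab_map L = tab_map (ptab (replicate k i @ word L))"
proof -
  let ?R = "if k = 0 then [] else [replicate k i]"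
  have "tab ?R" by (simp add: tab_def)
  moreover have "word ?R = replicate k i" by simp
  ultimately show "tab_map L \<star> one_row i k = tab_map (ptab (word L @ replicate k i))"
    "one_row i k \<star> tab_map L = tab_map (ptab (replicate k i @ word L))"
    using plactic_tab_map[of L ?R] plactic_tab_map[of ?R L] assms by (simp_all add: tab_map_row)
qed

lemma wt_tab_map: "wt (tab_map L) i = count_list (word L) i"
proof -
  have "wt (tab_map L) i = card {(a, b). a < length L \<and> b < length (L ! a) \<and> L ! a ! b = i}"
  proof -
    have "{b. tab_map L b = Some i} = (\<lambda>(a, b). (Suc a, Suc b)) ` {(a, b). a < length L \<and>
        b < length (L ! a) \<and> L ! a ! b = i}"
    proof (intro set_eqI iffI)
      fix x assume "x \<in> {b. tab_map L b = Some i}"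
      then obtain r c where x: "x = (r, c)" "1 \<le> r" "r \<le> length L" "1 \<le> c" "c \<le>
          length (L ! (r - 1))"
        "L ! (r - 1) ! (c - 1) = i"
        by (cases x) (auto simp: tab_map_def split: if_splits)
      then show "x \<in> (\<lambda>(a, b). (Suc a, Suc b)) ` {(a, b). a < length L \<and> b < length (L ! a) \<and>
          L ! a ! b = i}"
        by (intro image_eqI[of _ _ "(r - 1, c - 1)"]) auto
    qed (auto simp: tab_map_def)
    then show ?thesis by (simp add: wt_def card_image inj_on_def split: prod.splits)
  qed
  also have "\<dots> = count_list (word L) i"
  proof (induction L)
    case (Cons R L)
    let ?S = "\<lambda>L. {(a, b). a < length L \<and> b < length (L ! a) \<and> L ! a ! b = i}"
    have fin: "finite (?S L)"
      by (rule finite_subset[of _ "SIGMA a:{..<length L}. {..<length (L ! a)}"]) auto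
    have "?S (R # L) = (\<lambda>b. (0, b)) ` {b. b < length R \<and> R ! b = i} \<union> (\<lambda>(a, b). (Suc a, b)) ` ?S L"
    proof (intro set_eqI iffI)
      fix x assume "x \<in> ?S (R # L)"
      then obtain a b where x: "x = (a, b)" "a < length (R # L)" "b < length ((R # L) ! a)" "(R #
          L) ! a ! b = i"
        by auto
      then show "x \<in> (\<lambda>b. (0, b)) ` {b. b < length R \<and> R ! b = i} \<union> (\<lambda>(a, b). (Suc a, b)) ` ?S L"
        by (cases a) force+
    qed auto
    then have "card (?S (R # L)) = card ((\<lambda>b. (0::nat, b)) ` {b. b < length R \<and>
        R ! b = i}) + card ((\<lambda>(a, b). (Suc a, b)) ` ?S L)"
      using fin by (auto intro!: card_Un_disjoint)
    also have "card ((\<lambda>b. (0::nat, b)) ` {b. b < length R \<and> R ! b = i}) = count_list R i"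
      by (subst card_image) (auto simp: inj_on_def count_list_eq_length_filter
          length_filter_conv_card eq_commute)
    also have "card ((\<lambda>(a, b). (Suc a, b)) ` ?S L) = card (?S L)"
      by (rule card_image) (auto simp: inj_on_def)
    finally show ?case using Cons by simp
  qed simp
  finally show ?thesis .
qed

section \<open>Charge and cancellation\<close>

definition weight_words :: "nat \<Rightarrow> (nat \<Rightarrow> nat) \<Rightarrow> nat \<Rightarrow> nat list set" where
  "weight_words n m i = {w. set w \<subseteq> {i..n} \<and> (\<forall>j\<in>{i..n}. count_list w j = m j)}"

definition weight_tabs :: "nat \<Rightarrow> (nat \<Rightarrow> nat) \<Rightarrow> nat \<Rightarrow> nat list list set" where
  "weight_tabs n m i = {L. tab L \<and> word L \<in> weight_words n m i}"

lemma count_list_mset: "count_list w x = count (mset w) x"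
  by (induction w) auto

lemma weight_words_mset: "mset w = mset w' \<Longrightarrow> w \<in> weight_words n m i \<longleftrightarrow> w' \<in> weight_words n m i"
  by (simp add: weight_words_def count_list_mset flip: set_mset_mset)

lemma weight_words_knuth: "w \<approx> w' \<Longrightarrow> w \<in> weight_words n m i \<longleftrightarrow> w' \<in> weight_words n m i"
  by (rule weight_words_mset[OF knuth_mset])

lemma ptab_weight_tabs: "w \<in> weight_words n m i \<Longrightarrow> ptab w \<in> weight_tabs n m i"
  using weight_words_knuth[OF word_ptab] by (auto simp: weight_tabs_def)

lemma length_weight_words:
  "w \<in> weight_words n m i \<Longrightarrow> length w = (\<Sum>j\<in>{i..n}. m j)"
proof -
  assume w: "w \<in> weight_words n m i"
  have "length w = (\<Sum>j\<in>set w. count_list w j)" by (simp add: sum_count_set)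
  also have "\<dots> = (\<Sum>j\<in>{i..n}. count_list w j)"
    using w by (intro sum.mono_neutral_left) (auto simp: weight_words_def count_list_0_iff)
  finally show ?thesis using w by (simp add: weight_words_def)
qed

lemma finite_weight_words: "finite (weight_words n m i)"
proof (rule finite_subset)
  show "weight_words n m i \<subseteq> {w. set w \<subseteq> {i..n} \<and> length w = (\<Sum>j\<in>{i..n}. m j)}"
    using length_weight_words by (auto simp: weight_words_def)
qed (rule finite_lists_length_eq, simp)

lemma finite_weight_tabs: "finite (weight_tabs n m i)"
proof (rule finite_imageD)
  show "finite (word ` weight_tabs n m i)"
    by (rule finite_subset[OF _ finite_weight_words[of n m i]]) (auto simp: weight_tabs_def)
  show "inj_on word (weight_tabs n m i)"
    by (rule inj_onI) (auto simp: weight_tabs_def intro: tab_unique)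
qed

text \<open>The first column is strictly increasing, so it has at most as many boxes as there are
  letters.\<close>

lemma tab_length_le:
  assumes "tab L" "set (word L) \<subseteq> {i..n}"
  shows "length L \<le> Suc n - i"
proof -
  have f: "filter (\<lambda>R. R \<noteq> []) L = L" using assms(1) by (intro filter_True) (auto simp: tab_def)
  have "sorted_wrt (<) (heads L)" using assms(1) by (intro heads_strict tab_wtab)
  then have "distinct (heads L)" by (simp add: strict_sorted_iff)
  moreover have "set (heads L) \<subseteq> {i..n}"
  proof
    fix x assume "x \<in> set (heads L)"
    then obtain R where R: "R \<in> set L" "x = hd R" "R \<noteq> []" by (auto simp: heads_def)
    then have "x \<in> set (word L)" using hd_in_set[of R] unfolding set_word by blast
    then show "x \<in> {i..n}" using assms(2) by blast
  qed
  ultimately have "length (heads L) \<le> card {i..n}" by (metis card_mono distinct_card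
      finite_atLeastAtMost)
  then show ?thesis by (simp add: heads_def f)
qed

lemma sh_eq_0: "length L \<le> j \<Longrightarrow> sh L j = 0"
  by (simp add: sh_def)

lemma length_word: "length L \<le> N \<Longrightarrow> length (word L) = (\<Sum>j<N. sh L j)"
proof (induction L arbitrary: N)
  case (Cons R L)
  then obtain N' where "N = Suc N'" "length L \<le> N'" by (cases N) auto
  then show ?case using Cons.IH[of N'] by (simp add: sum.lessThan_Suc_shift del: sum.lessThan_Suc)
qed simp

lemma finite_hstrip: "finite {\<nu>. hstrip (sh L) \<nu>}"
proof (rule finite_subset)
  show "{\<nu>. hstrip (sh L) \<nu>} \<subseteq> {\<nu>. \<forall>j. (j \<in> {..<length L} \<longrightarrow>
      \<nu> j \<in> {..sh L 0 + sum (sh L) {..<length L}}) \<and> (j \<notin> {..<length L} \<longrightarrow> \<nu> j = 0)}"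
  proof (safe, goal_cases)
    case (1 \<nu> j)
    then have "\<nu> j \<le> sh L j" by (simp add: hstrip_def)
    also have "\<dots> \<le> sum (sh L) {..<length L}" using 1 by (intro member_le_sum) auto
    finally show ?case by simp
  next
    case (2 \<nu> j)
    then have "\<nu> j \<le> sh L j" by (simp add: hstrip_def)
    then show ?case using 2 by (simp add: sh_def split: if_splits)
  qed
qed (rule finite_set_of_finite_funs; simp)

text \<open>An index already shifted by \<delta>: a shape occupies the coordinates from
  \<open>i\<close> to \<open>n\<close>, with the matching part of \<delta> added, while the earlier
  coordinates, taken from \<open>b\<close>, still await their operators.\<close>

definition with_rows :: "nat \<Rightarrow> (nat \<Rightarrow> int) \<Rightarrow> nat \<Rightarrow> (nat \<Rightarrow> int) \<Rightarrow> nat \<Rightarrow> int" where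
  "with_rows n b i f j = (if i \<le> j \<and> j \<le> n then f (j - i) + int (n - j) else b j)"

definition alternating :: "nat \<Rightarrow> nat \<Rightarrow> ((nat \<Rightarrow> int) \<Rightarrow> int) \<Rightarrow> bool" where
  "alternating n i G \<longleftrightarrow> (\<forall>a\<in>{i..n}. \<forall>c\<in>{i..n}. \<forall>\<beta>. a \<noteq> c \<longrightarrow> G (\<beta> \<circ> Transposition.transpose a c) =
      - G \<beta>)"

definition cons_row :: "nat \<Rightarrow> (nat \<Rightarrow> nat) \<Rightarrow> nat \<Rightarrow> nat" where
  "cons_row a \<nu> j = (case j of 0 \<Rightarrow> a | Suc j' \<Rightarrow> \<nu> j')"

lemma cons_row_simps [simp]: "cons_row a \<nu> 0 = a" "cons_row a \<nu> (Suc j) = \<nu> j"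
  by (simp_all add: cons_row_def)

definition size_diff :: "nat \<Rightarrow> (nat \<Rightarrow> nat) \<Rightarrow> (nat \<Rightarrow> nat) \<Rightarrow> nat" where
  "size_diff n \<rho> \<nu> = (\<Sum>j<n. \<rho> j) - (\<Sum>j<n. \<nu> j)"

lemma sum_involution_zero:
  fixes g :: "'a \<Rightarrow> int"
  assumes "\<And>x. x \<in> S \<Longrightarrow> f x \<in> S" "\<And>x. x \<in> S \<Longrightarrow> f (f x) = x" "\<And>x. x \<in> S \<Longrightarrow> g (f x) = - g x"
  shows "sum g S = 0"
proof -
  have "bij_betw f S S"
    by (rule bij_betw_byWitness[where f' = f]) (use assms(1,2) in blast)+
  then have "sum g S = (\<Sum>x\<in>S. g (f x))" by (rule sum.reindex_bij_betw[symmetric])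
  also have "\<dots> = - sum g S" using assms(3) by (simp add: sum_negf)
  finally show ?thesis by simp
qed

text \<open>The charge axioms for a single weight \<open>m\<close>, transferred to words. Cyclage
  can be stated as the rotation of an arbitrary word because \<open>ptab\<close> depends on the
  Knuth class only.\<close>

locale list_charge =
  fixes n :: nat and m :: "nat \<Rightarrow> nat" and c :: "nat list list \<Rightarrow> nat"
  assumes c_row: "1 \<le> i \<Longrightarrow> i \<le> n \<Longrightarrow> L \<in> weight_tabs n m (Suc i) \<Longrightarrow>
      c (ptab (word L @ replicate (m i) i)) = c L"
    and c_cyclage: "1 \<le> i \<Longrightarrow> i \<le> n \<Longrightarrow> x \<noteq> i \<Longrightarrow> x # w \<in> weight_words n m i \<Longrightarrow>
      c (ptab (w @ [x])) = Suc (c (ptab (x # w)))"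
begin

lemma c_cyclages:
  assumes i: "1 \<le> i" "i \<le> n" and "i \<notin> set u" "v @ u \<in> weight_words n m i"
  shows "c (ptab (v @ u)) = c (ptab (u @ v)) + length u"
  using assms(3,4)
proof (induction u arbitrary: v rule: rev_induct)
  case (snoc x u)
  have w: "x # v @ u \<in> weight_words n m i"
    using snoc.prems(2) weight_words_mset[of "x # v @ u" "v @ u @ [x]"] by simp
  then have "c (ptab ((v @ u) @ [x])) = Suc (c (ptab (x # v @ u)))"
    using i snoc.prems by (intro c_cyclage) auto
  moreover have "c (ptab ((x # v) @ u)) = c (ptab (u @ x # v)) + length u"
    using snoc.prems w by (intro snoc.IH) auto
  ultimately show ?case by simp
qed simp

context
  fixes i :: nat and b :: "nat \<Rightarrow> int" and G :: "(nat \<Rightarrow> int) \<Rightarrow> int" and k :: nat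
  assumes i: "1 \<le> i" "i \<le> n" and G: "alternating n i G"
begin

abbreviation zeros :: "nat list" where "zeros \<equiv> replicate (m i) i"

text \<open>A row and a tableau without a fixed order of the factors: \<open>u * T\<close> leads
  back to the horizontal strips, whereas \<open>T * u\<close> is what the cancellation keeps
  fixed.\<close>

definition pairs :: "(nat list list \<times> nat list) set" where
  "pairs = {(T, u). tab T \<and> sorted u \<and> word T @ u \<in> weight_words n m (Suc i)}"

text \<open>The charge condition is written with \<open>T * i^k * u\<close> instead of
  \<open>u * T\<close>, since this is the tableau that both members of a cancelling couple
  share.\<close>

definition val :: "nat list list \<Rightarrow> nat list \<Rightarrow> int" where
  "val T u = (if c (ptab (word T @ zeros @ u)) = k
     then G (with_rows n b i (int \<circ> cons_row (m i + length u) (sh T))) else 0)"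

lemma pairs_letters:
  assumes "(T, u) \<in> pairs"
  shows "\<forall>x\<in>set (word T). i < x" "\<forall>x\<in>set u. i < x" "i \<notin> set u"
  using assms by (auto simp: pairs_def weight_words_def)

lemma pairs_words:
  assumes "(T, u) \<in> pairs"
  shows "word T @ zeros @ u \<in> weight_words n m i"
proof -
  have w: "set (word T @ u) \<subseteq> {Suc i..n}" "\<And>j. j \<in> {Suc i..n} \<Longrightarrow> count_list (word T @ u) j = m j"
    using assms by (auto simp: pairs_def weight_words_def)
  have z: "count_list zeros j = (if j = i then m i else 0)" for j
    by (simp add: count_list_mset)
  have "count_list (word T @ zeros @ u) j = m j" if "j \<in> {i..n}" for j
  proof (cases "j = i")
    case True
    then show ?thesis using pairs_letters[OF assms] z by (auto simp: count_list_0_iff)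
  next
    case False
    then show ?thesis using w(2)[of j] that z by simp
  qed
  then show ?thesis using w(1) i by (auto simp: weight_words_def)
qed

lemma charge_pairs:
  assumes "(T, u) \<in> pairs"
  shows "c (ptab (word T @ zeros @ u)) = c (ptab (u @ word T)) + length u"
proof -
  have "c (ptab ((word T @ zeros) @ u)) = c (ptab (u @ word T @ zeros)) + length u"
    using c_cyclages[OF i pairs_letters(3)[OF assms], of "word T @ zeros"] pairs_words[OF assms]
        by simp
  moreover have "ptab (u @ word T @ zeros) = ptab (word (ptab (u @ word T)) @ zeros)"
    using knuth_append[OF knuth_sym[OF word_ptab[of "u @ word T"]] knuth_refl[of zeros]]
    by (intro ptab_cong) simp
  moreover have "u @ word T \<in> weight_words n m (Suc i)"
    using assms weight_words_mset[of "u @ word T" "word T @ u"] by (simp add: pairs_def)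
  then have "c (ptab (word (ptab (u @ word T)) @ zeros)) = c (ptab (u @ word T))"
    using i by (intro c_row ptab_weight_tabs)
  ultimately show ?thesis by simp
qed

lemma length_u:
  assumes "tab T" "tab X" "mset (word X) = mset (word T @ u)" "word X \<in> weight_words n m (Suc i)"
  shows "size_diff n (sh X) (sh T) = length u"
proof -
  have "set (word X) = set (word T @ u)" using assms(3) by (metis set_mset_mset)
  moreover have "set (word X) \<subseteq> {Suc i..n}" using assms(4) by (simp add: weight_words_def)
  ultimately have "length X \<le> Suc n - Suc i" "length T \<le> Suc n - Suc i"
    using tab_length_le[OF assms(2), of "Suc i" n] tab_length_le[OF assms(1), of "Suc i" n] by auto
  then have "length (word X) = (\<Sum>j<n. sh X j)" "length (word T) = (\<Sum>j<n. sh T j)"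
    by (intro length_word; linarith)+
  moreover have "length (word X) = length (word T) + length u"
    using arg_cong[OF assms(3), of size] by simp
  ultimately show ?thesis by (simp add: size_diff_def)
qed

text \<open>The left Pieri bijection is the suitable one: in \<open>L = u * T\<close> the row stands
  in front, where the cyclages of \<open>charge_pairs\<close> bring it.\<close>

lemma sum_pairs:
  "(\<Sum>L\<in>weight_tabs n m (Suc i). \<Sum>\<nu> | hstrip (sh L) \<nu>.
      if c L + size_diff n (sh L) \<nu> = k
      then G (with_rows n b i (int \<circ> cons_row (m i + size_diff n (sh L) \<nu>) \<nu>)) else 0) =
    (\<Sum>(T, u)\<in>pairs. val T u)"
proof -
  have fin: "finite {\<nu>. hstrip (sh L) \<nu>}" for L by (rule finite_hstrip)
  let ?I = "SIGMA L:weight_tabs n m (Suc i). {\<nu>. hstrip (sh L) \<nu>}"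
  define f where "f = (\<lambda>(T, u). (ptab (u @ word T), sh T))"
  have bij: "bij_betw f pairs ?I"
    unfolding bij_betw_def
  proof
    show "inj_on f pairs"
      by (rule inj_onI) (auto simp: f_def pairs_def dest!: ptab_eqD dest: pieri_left_inj)
    show "f ` pairs = ?I"
    proof
      have "u @ word T \<in> weight_words n m (Suc i)" if "word T @ u \<in> weight_words n m (Suc i)"
          for T u
        using that weight_words_mset[of "u @ word T" "word T @ u"] by simp
      then show "f ` pairs \<subseteq> ?I" by (auto simp: f_def pairs_def ptab_weight_tabs pieri_left_hstrip)
      show "?I \<subseteq> f ` pairs"
      proof
        fix x assume "x \<in> ?I"
        then obtain L \<nu> where x: "x = (L, \<nu>)" and L: "L \<in> weight_tabs n m (Suc i)" "hstrip (sh L)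
            \<nu>" by auto
        then obtain T u where T: "tab T" "sh T = \<nu>" "sorted u" "u @ word T \<approx> word L"
          using pieri_left_surj[of L \<nu>] by (auto simp: weight_tabs_def)
        then have "u @ word T \<in> weight_words n m (Suc i)"
          using weight_words_knuth[OF T(4)] L by (simp add: weight_tabs_def)
        then have "(T, u) \<in> pairs"
          using T weight_words_mset[of "u @ word T" "word T @ u"] by (simp add: pairs_def)
        moreover have "f (T, u) = (L, \<nu>)"
          using T L ptab_cong[OF T(4)] by (simp add: f_def weight_tabs_def ptab_word)
        ultimately show "x \<in> f ` pairs" unfolding x by (metis imageI)
      qed
    qed
  qed
  have "(\<Sum>L\<in>weight_tabs n m (Suc i). \<Sum>\<nu> | hstrip (sh L) \<nu>.
      if c L + size_diff n (sh L) \<nu> = k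
      then G (with_rows n b i (int \<circ> cons_row (m i + size_diff n (sh L) \<nu>) \<nu>)) else 0) =
    (\<Sum>(L, \<nu>)\<in>?I. if c L + size_diff n (sh L) \<nu> = k
      then G (with_rows n b i (int \<circ> cons_row (m i + size_diff n (sh L) \<nu>) \<nu>)) else 0)"
    using finite_weight_tabs fin by (subst sum.Sigma) auto
  also have "\<dots> = (\<Sum>p\<in>pairs. (\<lambda>(L, \<nu>). if c L + size_diff n (sh L) \<nu> = k
      then G (with_rows n b i (int \<circ> cons_row (m i + size_diff n (sh L) \<nu>) \<nu>)) else 0) (f p))"
    by (rule sum.reindex_bij_betw[OF bij, symmetric])
  also have "\<dots> = (\<Sum>(T, u)\<in>pairs. val T u)"
  proof (rule sum.cong[OF refl])
    fix p assume "p \<in> pairs"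
    then obtain T u where p: "p = (T, u)" and Tu: "(T, u) \<in> pairs" by (cases p) auto
    have "mset (word (ptab (u @ word T))) = mset (word T @ u)"
      using knuth_mset[OF word_ptab[of "u @ word T"]] by simp
    moreover have "word (ptab (u @ word T)) \<in> weight_words n m (Suc i)"
      using weight_words_mset[OF calculation] Tu by (simp add: pairs_def)
    ultimately have "size_diff n (sh (ptab (u @ word T))) (sh T) = length u"
      using Tu by (intro length_u) (auto simp: pairs_def)
    then show "(\<lambda>(L, \<nu>). if c L + size_diff n (sh L) \<nu> = k
      then G (with_rows n b i (int \<circ> cons_row (m i + size_diff n (sh L) \<nu>) \<nu>)) else 0) (f p) =
          (case p of (T, u) \<Rightarrow> val T u)"
      using charge_pairs[OF Tu] by (simp add: p f_def val_def)
  qed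
  finally show ?thesis .
qed

section \<open>The pairs whose row fits on top of the tableau\<close>

definition fixed :: "(nat list list \<times> nat list) set" where
  "fixed = {(T, u)\<in>pairs. sh (ptab (word T @ u)) 0 \<le> m i + length u}"

text \<open>Adjoining the letters \<open>i\<close> affects the shape only through the shapes of
  \<open>T * u\<close> and \<open>T\<close> and the length of the row. The exchange used for the
  cancellation changes the last two and keeps the first.\<close>

lemma greene_pairs:
  assumes "(T, u) \<in> pairs"
  shows "greene (Suc j) (word T @ zeros @ u) =
    max (\<Sum>q<Suc j. sh (ptab (word T @ u)) q) ((\<Sum>q<j. sh T q) + m i + length u)"
  using greene_insert_small[of "word T" i u j "m i"] pairs_letters[OF assms] assms
  by (simp add: pairs_def greene_ptab[of "Suc j" "word T @ u"] greene_word tab_wtab)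

text \<open>The second term of the maximum in \<open>greene_pairs\<close> always wins: the top row
  of \<open>T * u\<close> is short enough by the definition of \<open>fixed\<close>, and its other
  rows are bounded by the rows of \<open>T\<close> since they form a horizontal strip. Differences
  of consecutive Greene numbers are the row lengths.\<close>

lemma sh_fixed:
  assumes "(T, u) \<in> fixed"
  shows "sh (ptab (word T @ zeros @ u)) = cons_row (m i + length u) (sh T)"
proof -
  have p: "(T, u) \<in> pairs" and le: "sh (ptab (word T @ u)) 0 \<le> m i + length u"
    using assms by (auto simp: fixed_def)
  have "hstrip (sh (ptab (word T @ u))) (sh T)"
    using p by (intro pieri_hstrip) (auto simp: pairs_def)
  then have st: "sh (ptab (word T @ u)) (Suc q) \<le> sh T q" for q by (simp add: hstrip_def)
  have *: "greene (Suc j) (word T @ zeros @ u) = (\<Sum>q<j. sh T q) + m i + length u" for j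
  proof -
    have "(\<Sum>q<Suc j. sh (ptab (word T @ u)) q) \<le> (\<Sum>q<j. sh T q) + m i + length u"
      using le sum_mono[of "{..<j}" "\<lambda>q. sh (ptab (word T @ u)) (Suc q)" "sh T"] st
      by (simp add: sum.lessThan_Suc_shift del: sum.lessThan_Suc)
    then show ?thesis using greene_pairs[OF p, of j] by simp
  qed
  show ?thesis
  proof
    fix j
    show "sh (ptab (word T @ zeros @ u)) j = cons_row (m i + length u) (sh T) j"
      using *[of j] *[of "j - 1"] greene_ptab[of "Suc j" "word T @ zeros @
          u"] greene_ptab[of j "word T @ zeros @ u"]
      by (cases j) auto
  qed
qed

text \<open>Columns are strict, so all smallest letters \<open>i\<close> of a tableau lie in its
  first row. The inverse map cuts off this row and deletes the letters \<open>i\<close> from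
  it.\<close>

lemma sum_fixed: "(\<Sum>(T, u)\<in>fixed. val T u) =
    (\<Sum>P\<in>weight_tabs n m i. if c P = k then G (with_rows n b i (int \<circ> sh P)) else 0)"
proof -
  define f where "f = (\<lambda>(T, u). ptab (word T @ zeros @ u))"
  have sorted_zu: "sorted (zeros @ u)" if "(T, u) \<in> pairs" for T u
    using that pairs_letters[OF that] by (auto simp: pairs_def sorted_append less_imp_le)
  have bij: "bij_betw f fixed (weight_tabs n m i)"
    unfolding bij_betw_def
  proof
    show "inj_on f fixed"
    proof (rule inj_onI)
      fix p p' assume p: "p \<in> fixed" "p' \<in> fixed" "f p = f p'"
      obtain T u T' u' where pp: "p = (T, u)" "p' = (T', u')" by fastforce
      have sh: "cons_row (m i + length u) (sh T) = cons_row (m i + length u') (sh T')"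
        using p sh_fixed[of T u] sh_fixed[of T' u'] by (simp add: pp f_def)
      have "sh T q = sh T' q" for q using fun_cong[OF sh, of "Suc q"] by simp
      then have "sh T = sh T'" by blast
      moreover have "word T @ (zeros @ u) \<approx> word T' @ (zeros @ u')"
        using p by (auto simp: pp f_def dest: ptab_eqD)
      ultimately have "T = T' \<and> zeros @ u = zeros @ u'"
        using p sorted_zu[of T u] sorted_zu[of T' u']
        by (intro pieri_inj) (auto simp: pp fixed_def pairs_def)
      then show "p = p'" by (simp add: pp)
    qed
    show "f ` fixed = weight_tabs n m i"
    proof
      show "f ` fixed \<subseteq> weight_tabs n m i"
        using pairs_words by (auto simp: f_def fixed_def intro!: ptab_weight_tabs)
      show "weight_tabs n m i \<subseteq> f ` fixed"
      proof
        fix P assume P: "P \<in> weight_tabs n m i"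
        then have tP: "tab P" and W: "set (word P) \<subseteq> {i..n}" "\<And>j. j \<in> {i..n} \<Longrightarrow>
            count_list (word P) j = m j"
          by (auto simp: weight_tabs_def weight_words_def)
        define R where "R = first_row P"
        define T where "T = tl P"
        have RT: "word P = word T @ R" by (cases P) (auto simp: R_def T_def)
        have tT: "tab T" using tP by (cases P) (auto simp: T_def tab_def)
        have sR: "sorted R" using tP by (cases P) (auto simp: R_def tab_def)
        have Ti: "i < x" if x: "x \<in> set (word T)" for x
        proof -
          obtain S where "S \<in> set T" "x \<in> set S" using x by (auto simp: set_word)
          then obtain j where j: "j < length T" "x \<in> set (T ! j)" by (metis in_set_conv_nth)
          then obtain q where q: "q < length (T ! j)" "x = T ! j ! q" by (metis in_set_conv_nth)
          have P: "P = R # T" using j by (cases P) (auto simp: R_def T_def)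
          then have "over R (T ! j)" using wtab_over[OF tab_wtab[OF tP], of 0 "Suc j"] j by simp
          then have "R ! q < x" "R ! q \<in> set R" using q by (auto simp: over_def)
          then show ?thesis using W(1) RT by (auto simp: subset_iff)
        qed
        define u where "u = filter (\<lambda>x. i < x) R"
        have Ri: "\<forall>x\<in>set R. i \<le> x" using W(1) RT by auto
        have "count_list (word T) i = 0" using Ti by (force simp: count_list_0_iff)
        then have "count_list R i = m i" using W(2)[of i] i RT by simp
        moreover have "R = replicate (count_list R i) i @ filter (\<lambda>x. i < x) R"
          using sR Ri
        proof (induction R)
          case (Cons x R)
          show ?case
          proof (cases "x = i")
            case True
            then show ?thesis using Cons by simp
          next
            case False
            then have "\<forall>y\<in>set (x # R). i < y" using Cons.prems by fastforce
            then have "filter (\<lambda>x. i < x) (x # R) = x # R" "count_list (x # R) i = 0"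
              by (auto simp: count_list_0_iff intro: filter_True)
            then show ?thesis by simp
          qed
        qed simp
        ultimately have R: "R = zeros @ u" by (simp add: u_def)
        have "word T @ u \<in> weight_words n m (Suc i)"
        proof -
          have "set (word T @ u) \<subseteq> {Suc i..n}"
            using W(1) Ti unfolding RT by (force simp: u_def Suc_le_eq)
          moreover have "count_list (word T @ u) j = m j" if "j \<in> {Suc i..n}" for j
            using W(2)[of j] that unfolding RT R by (simp add: count_list_mset)
          ultimately show ?thesis by (simp add: weight_words_def)
        qed
        then have p: "(T, u) \<in> pairs" using tT sR R by (auto simp: pairs_def sorted_append)
        have fP: "f (T, u) = P" using ptab_word[OF tP] RT R by (simp add: f_def)
        \<comment> \<open>The length of the first row is that of a longest increasing subsequence,
          which does not get shorter when the letters \<open>i\<close> are put back.\<close>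
        have "sh (ptab (word T @ u)) 0 = greene 1 (word T @ u)"
            using greene_ptab[of 1 "word T @ u"] by simp
        also have "\<dots> \<le> greene 1 (word T @ zeros @ u)" by (rule greene_mono_insert)
        also have "\<dots> = sh P 0" using greene_word[OF tab_wtab[OF tP], of 1] RT R by simp
        also have "\<dots> = length R" by (simp add: R_def length_first_row)
        also have "\<dots> = m i + length u" by (simp add: R)
        finally have "(T, u) \<in> fixed" using p by (simp add: fixed_def)
        then show "P \<in> f ` fixed" using fP by (metis imageI)
      qed
    qed
  qed
  have "(\<Sum>P\<in>weight_tabs n m i. if c P = k then G (with_rows n b i (int \<circ> sh P)) else 0) =
      (\<Sum>p\<in>fixed. if c (f p) = k then G (with_rows n b i (int \<circ> sh (f p))) else 0)"
    by (rule sum.reindex_bij_betw[OF bij, symmetric])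
  also have "\<dots> = (\<Sum>(T, u)\<in>fixed. val T u)"
    by (rule sum.cong[OF refl]) (auto simp: f_def val_def sh_fixed)
  finally show ?thesis ..
qed

section \<open>The sign-reversing involution\<close>

lemma length_word_pairs:
  assumes "(T, u) \<in> pairs"
  shows "length (word T @ u) = (\<Sum>j<n. sh T j) + length u"
proof -
  have "length T \<le> Suc n - Suc i"
    using assms by (intro tab_length_le) (auto simp: pairs_def weight_words_def)
  then show ?thesis using length_word[of T n] by simp
qed

lemma sum_fun_upd: "q \<in> A \<Longrightarrow> finite A \<Longrightarrow> (\<Sum>j\<in>A. (f(q := v)) j) + f q = (\<Sum>j\<in>A. f j) + (v :: nat)"
proof -
  assume "q \<in> A" "finite A"
  moreover have "(\<Sum>j\<in>A - {q}. (f(q := v)) j) = sum f (A - {q})" by (intro sum.cong) auto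
  ultimately show ?thesis using sum.remove[of A q "f(q := v)"] sum.remove[of A q f] by simp
qed

abbreviation rho :: "nat list list \<times> nat list \<Rightarrow> nat \<Rightarrow> nat" where
  "rho p \<equiv> sh (ptab (word (fst p) @ snd p))"

text \<open>The index of the row of \<open>\<nu>\<close> that exchanges its place with the new first row, of length
  \<open>m i + length u\<close>; after adding \<open>\<delta>\<close>, both lie between the same two consecutive entries of \<open>\<rho>\<close>.\<close>

definition swap_row :: "nat list list \<times> nat list \<Rightarrow> nat" where
  "swap_row p = Max {q. m i + length (snd p) + q + 1 \<le> rho p q}"

text \<open>The set in the definition contains 0 because the pair is not \<open>fixed\<close>, and
  it is bounded because \<open>rho\<close> vanishes from row \<open>n - i\<close> on. Maximality
  gives the second inequality; with the first it says that the exchanged row still fits into a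
  horizontal strip.\<close>

lemma swap_row:
  assumes p: "p \<in> pairs - fixed"
  shows "m i + length (snd p) + swap_row p + 1 \<le> rho p (swap_row p)"
    and "rho p (Suc (swap_row p)) \<le> m i + length (snd p) + swap_row p + 1"
    and "swap_row p < n - i"
proof -
  let ?a = "m i + length (snd p)"
  let ?Q = "{q. ?a + q + 1 \<le> rho p q}"
  have w: "word (fst p) @ snd p \<in> weight_words n m (Suc i)" using p by (auto simp: pairs_def)
  have "word (ptab (word (fst p) @ snd p)) \<in> weight_words n m (Suc i)"
    using w weight_words_knuth[OF word_ptab] by blast
  then have len: "length (ptab (word (fst p) @ snd p)) \<le> Suc n - Suc i"
    by (intro tab_length_le) (auto simp: weight_words_def)
  have Q: "q < n - i" if "q \<in> ?Q" for q
  proof (rule ccontr)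
    assume "\<not> q < n - i"
    then have "rho p q = 0" using len by (intro sh_eq_0) simp
    then show False using that by simp
  qed
  then have fin: "finite ?Q" by (intro finite_subset[of ?Q "{..<n - i}"]) auto
  have "0 \<in> ?Q" using p by (cases p) (auto simp: fixed_def)
  then have "?Q \<noteq> {}" by blast
  then have "swap_row p \<in> ?Q" unfolding swap_row_def by (rule Max_in[OF fin])
  then show "?a + swap_row p + 1 \<le> rho p (swap_row p)" "swap_row p < n - i" using Q by auto
  have "Suc (swap_row p) \<notin> ?Q"
    using Max_ge[OF fin, of "Suc (swap_row p)"] unfolding swap_row_def by auto
  then show "rho p (Suc (swap_row p)) \<le> ?a + swap_row p + 1" by simp
qed

lemma swap_row_eqI:
  assumes "m i + length (snd p) + q + 1 \<le> rho p q" "rho p (Suc q) \<le> m i + length (snd p) + q + 1"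
  shows "swap_row p = q"
proof -
  let ?a = "m i + length (snd p)"
  have le: "q' \<le> q" if q': "?a + q' + 1 \<le> rho p q'" for q'
  proof (rule ccontr)
    assume "\<not> q' \<le> q"
    then have "Suc q \<le> q'" by simp
    then have "rho p q' \<le> rho p (Suc q)" by (intro wtab_sh_mono tab_wtab tab_ptab)
    then show False using q' assms \<open>Suc q \<le> q'\<close> by linarith
  qed
  then have "{q. ?a + q + 1 \<le> rho p q} \<subseteq> {..q}" by blast
  then have "finite {q. ?a + q + 1 \<le> rho p q}" by (rule finite_subset) simp
  then show ?thesis unfolding swap_row_def using le assms(1) by (intro Max_eqI) simp_all
qed

text \<open>The entries of \<delta> for the new first row and for row \<open>q = swap_row p\<close>
  differ by \<open>q + 1\<close>, whence the new length. Such a partner exists by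
  \<open>pieri_surj\<close> and is unique by \<open>pieri_inj\<close>.\<close>

definition swapped :: "nat list list \<times> nat list \<Rightarrow> nat list list \<times> nat list \<Rightarrow> bool" where
  "swapped p p' \<longleftrightarrow> p' \<in> pairs \<and> word (fst p') @ snd p' \<approx> word (fst p) @ snd p \<and>
     sh (fst p') = (sh (fst p))(swap_row p := m i + length (snd p) + swap_row p + 1)"

lemma swapped_exists:
  assumes p: "p \<in> pairs - fixed"
  shows "\<exists>p'. swapped p p'"
proof -
  let ?\<nu> = "(sh (fst p))(swap_row p := m i + length (snd p) + swap_row p + 1)"
  have hs: "hstrip (rho p) (sh (fst p))" using p by (intro pieri_hstrip) (auto simp: pairs_def)
  then have "hstrip (rho p) ?\<nu>" using swap_row[OF p] by (simp add: hstrip_def)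
  then obtain T u where T: "tab T" "sh T = ?\<nu>" "sorted u" "word T @ u \<approx> word (ptab (word (fst p) @
      snd p))"
    using pieri_surj[OF tab_ptab] by blast
  then have kn: "word T @ u \<approx> word (fst p) @ snd p" using word_ptab knuth_trans by blast
  then have "(T, u) \<in> pairs" using T p weight_words_knuth[OF kn] by (auto simp: pairs_def)
  then have "swapped p (T, u)" using kn T by (simp add: swapped_def)
  then show ?thesis by blast
qed

text \<open>The number of letters is preserved, and this forces the length of the new
  \<open>u\<close>. Together with the unchanged \<open>rho\<close> it follows that the same row is
  selected again, so the exchange can be undone.\<close>

lemma swapped_row:
  assumes p: "p \<in> pairs - fixed" and s: "swapped p p'"
  shows "rho p' = rho p" "m i + length (snd p') + swap_row p + 1 = sh (fst p) (swap_row p)"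
    "swap_row p' = swap_row p" "p' \<in> pairs - fixed"
proof -
  let ?q = "swap_row p"
  have p': "p' \<in> pairs" and kn: "word (fst p') @ snd p' \<approx> word (fst p) @ snd p"
    and sh: "sh (fst p') = (sh (fst p))(?q := m i + length (snd p) + ?q + 1)"
    using s by (auto simp: swapped_def)
  show rho: "rho p' = rho p" using ptab_cong[OF kn] by simp
  have "(\<Sum>j<n. sh (fst p') j) + length (snd p') = (\<Sum>j<n. sh (fst p) j) + length (snd p)"
    using knuth_length[OF kn] length_word_pairs[of "fst p" "snd p"] length_word_pairs[of "fst p'"
        "snd p'"] p p'
    by simp
  moreover have "(\<Sum>j<n. sh (fst p') j) + sh (fst p) ?q = (\<Sum>j<n. sh (fst p) j) + (m i +
      length (snd p) + ?q + 1)"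
    unfolding sh using swap_row(3)[OF p] by (intro sum_fun_upd) auto
  ultimately show a: "m i + length (snd p') + ?q + 1 = sh (fst p) ?q" by linarith
  have "hstrip (rho p) (sh (fst p))" using p by (intro pieri_hstrip) (auto simp: pairs_def)
  then have st: "sh (fst p) ?q \<le> rho p ?q" "rho p (Suc ?q) \<le> sh (fst p) ?q"
      by (auto simp: hstrip_def)
  then show "swap_row p' = ?q" using a rho by (intro swap_row_eqI) simp_all
  have "rho p' ?q \<le> rho p' 0" by (intro wtab_sh_mono tab_wtab) auto
  then have "m i + length (snd p') < rho p' 0" using a st rho by simp
  then show "p' \<in> pairs - fixed" using p' by (cases p') (auto simp: fixed_def)
qed

lemma swapped_sym:
  assumes "p \<in> pairs - fixed" "swapped p p'"
  shows "swapped p' p"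
  using assms swapped_row[OF assms] knuth_sym by (auto simp: swapped_def)

lemma swapped_unique:
  assumes "swapped p p'" "swapped p p''"
  shows "p' = p''"
proof -
  have "word (fst p') @ snd p' \<approx> word (fst p'') @ snd p''"
    using assms knuth_trans knuth_sym unfolding swapped_def by blast
  then have "fst p' = fst p'' \<and> snd p' = snd p''"
    using assms by (intro pieri_inj) (auto simp: swapped_def pairs_def)
  then show ?thesis by (simp add: prod_eq_iff)
qed

text \<open>If the sum over \<open>k\<close> rows of \<open>T\<close> includes the exchanged row,
  its total with the length of the new first row is unchanged. If not, both candidates for the new
  first row are shorter than row \<open>k\<close> of \<open>rho\<close>, so the first term of the
  maximum wins on either side.\<close>

lemma swapped_greene:
  assumes p: "p \<in> pairs - fixed" and s: "swapped p p'"
  shows "greene k' (word (fst p) @ zeros @ snd p) = greene k' (word (fst p') @ zeros @ snd p')"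
proof (cases k')
  case (Suc k)
  let ?q = "swap_row p"
  let ?R = "\<Sum>q<Suc k. rho p q"
  have sh: "sh (fst p') = (sh (fst p))(?q := m i + length (snd p) + ?q + 1)"
    using s by (auto simp: swapped_def)
  note sr = swapped_row[OF p s]
  have "max ?R ((\<Sum>q<k. sh (fst p) q) + m i + length (snd p)) =
      max ?R ((\<Sum>q<k. sh (fst p') q) + m i + length (snd p'))"
  proof (cases "?q < k")
    case True
    then have "(\<Sum>j<k. sh (fst p') j) + sh (fst p) ?q = (\<Sum>j<k. sh (fst p) j) + (m i +
        length (snd p) + ?q + 1)"
      unfolding sh by (intro sum_fun_upd) auto
    then show ?thesis using sr(2) by simp
  next
    case False
    have hs: "hstrip (rho p) (sh (fst p))" using p by (intro pieri_hstrip) (auto simp: pairs_def)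
    have "(\<Sum>j<k. sh (fst p') j) = (\<Sum>j<k. sh (fst p) j)" using False
        by (intro sum.cong) (auto simp: sh)
    moreover have "(\<Sum>j<k. sh (fst p) j) \<le> (\<Sum>j<k. rho p j)" using hs
        by (intro sum_mono) (simp add: hstrip_def)
    moreover have "rho p ?q \<le> rho p k" using False by (intro wtab_sh_mono tab_wtab) auto
    moreover have "sh (fst p) ?q \<le> rho p ?q" using hs by (simp add: hstrip_def)
    ultimately show ?thesis using sr(2) swap_row(1)[OF p] by simp
  qed
  then show ?thesis
    using greene_pairs[of "fst p" "snd p" k] greene_pairs[of "fst p'" "snd p'" k] p sr(1,4) Suc
        by simp
qed (simp add: greene_ptab)

lemma swapped_val:
  assumes p: "p \<in> pairs - fixed" and s: "swapped p p'"
  shows "val (fst p') (snd p') = - val (fst p) (snd p)"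
proof -
  let ?q = "swap_row p"
  note sr = swapped_row[OF p s]
  have sh: "sh (fst p') = (sh (fst p))(?q := m i + length (snd p) + ?q + 1)"
    and kn: "word (fst p') @ snd p' \<approx> word (fst p) @ snd p"
    using s by (auto simp: swapped_def)
  have filt: "filter (\<lambda>x. i < x) (word (fst r) @ zeros @ snd r) = word (fst r) @ snd r"
      if "r \<in> pairs" for r
    using pairs_letters[of "fst r" "snd r"] that by (auto intro: filter_True)
  have "word (fst p) @ zeros @ snd p \<approx> word (fst p') @ zeros @ snd p'"
  proof (rule knuth_add_min)
    show "filter (\<lambda>x. i < x) (word (fst p) @ zeros @ snd p) \<approx> filter (\<lambda>x. i < x) (word (fst p') @
        zeros @ snd p')"
      using filt[of p] filt[of p'] p sr(4) knuth_sym[OF kn] by simp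
    show "\<forall>x\<in>set (word (fst p) @ zeros @ snd p). i \<le> x"
      using pairs_words[of "fst p" "snd p"] p by (auto simp: weight_words_def)
    show "\<forall>x\<in>set (word (fst p') @ zeros @ snd p'). i \<le> x"
      using pairs_words[of "fst p'" "snd p'"] sr(4) by (auto simp: weight_words_def)
  qed (rule swapped_greene[OF p s])
  then have P: "ptab (word (fst p) @ zeros @ snd p) = ptab (word (fst p') @ zeros @ snd p')"
    by (rule ptab_cong)
  let ?f = "\<lambda>r. with_rows n b i (int \<circ> cons_row (m i + length (snd r)) (sh (fst r)))"
  have q: "?q < n - i" by (rule swap_row(3)[OF p])
  then have q': "Suc (i + ?q) \<le> n" "int (n - i) = int (n - Suc (i + ?q)) + int ?q + 1" by simp_all
  \<comment> \<open>Row \<open>q\<close> of \<open>T\<close> stands at coordinate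
    \<open>i + 1 + q\<close>, because the new first row takes coordinate \<open>i\<close>.\<close>
  have "?f p' = ?f p \<circ> Transposition.transpose i (i + 1 + ?q)"
  proof
    fix j
    have i': "cons_row a \<nu> (j - i) = \<nu> (j - i - 1)" if "i < j" for a \<nu>
      using that by (cases "j - i") auto
    consider "j = i" | "j = i + 1 + ?q" | "j \<noteq> i" "j \<noteq> i + 1 + ?q" by blast
    then show "?f p' j = (?f p \<circ> Transposition.transpose i (i + 1 + ?q)) j"
    proof cases
      case 1
      then show ?thesis using q' sr(2)[symmetric] i by (simp add: with_rows_def)
    next
      case 2
      then show ?thesis using q' i'[of j] by (simp add: with_rows_def sh)
    next
      case 3
      then have "sh (fst p') (j - i - 1) = sh (fst p) (j - i - 1)" if "i < j" using that
          by (auto simp: sh)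
      then show ?thesis using 3 i' by (cases "i < j") (auto simp: with_rows_def)
    qed
  qed
  moreover have "G (?f p \<circ> Transposition.transpose i (i + 1 + ?q)) = - G (?f p)"
    using G q i unfolding alternating_def by auto
  ultimately show ?thesis using P by (simp add: val_def)
qed

text \<open>The partner is picked by choice; its uniqueness makes the resulting map an
  involution.\<close>

lemma sum_bad: "(\<Sum>(T, u)\<in>pairs - fixed. val T u) = 0"
proof (rule sum_involution_zero[where f = "\<lambda>p. SOME p'. swapped p p'"])
  fix p assume p: "p \<in> pairs - fixed"
  define p' where "p' = (SOME p'. swapped p p')"
  have s: "swapped p p'" unfolding p'_def by (rule someI_ex[OF swapped_exists[OF p]])
  then show "p' \<in> pairs - fixed" by (rule swapped_row(4)[OF p])
  then have "swapped p' (SOME p''. swapped p' p'')" by (intro someI_ex[OF swapped_exists])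
  then show "(SOME p''. swapped p' p'') = p" using swapped_unique swapped_sym[OF p s] by blast
  show "(case p' of (T, u) \<Rightarrow> val T u) = - (case p of (T, u) \<Rightarrow> val T u)"
    using swapped_val[OF p s] by (simp add: case_prod_unfold)
qed

lemma finite_pairs: "finite pairs"
proof (rule finite_subset)
  let ?W = "{w. set w \<subseteq> {Suc i..n} \<and> length w \<le> (\<Sum>j\<in>{Suc i..n}. m j)}"
  have fW: "finite ?W" by (rule finite_lists_length_le) simp
  show "pairs \<subseteq> (ptab ` ?W) \<times> ?W"
  proof
    fix p assume p: "p \<in> pairs"
    then have W: "word (fst p) @ snd p \<in> weight_words n m (Suc i)" and t: "tab (fst p)"
        by (auto simp: pairs_def)
    then have "word (fst p) \<in> ?W" "snd p \<in> ?W"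
      using length_weight_words[OF W] by (auto simp: weight_words_def)
    moreover from t this(1) have "fst p \<in> ptab ` ?W" by (intro image_eqI[of _ _ "word (fst p)"])
        (simp_all only: ptab_word)
    ultimately show "p \<in> (ptab ` ?W) \<times> ?W" unfolding mem_Times_iff by blast
  qed
  show "finite ((ptab ` ?W) \<times> ?W)" using fW by simp
qed

text \<open>The tableau side of one induction step: the strips that come from the operators with
  first index \<open>i\<close> add up to the tableaux in the letters from \<open>i\<close>
  on.\<close>

lemma charge_recursion:
  "(\<Sum>L\<in>weight_tabs n m (Suc i). \<Sum>\<nu> | hstrip (sh L) \<nu>.
      if c L + size_diff n (sh L) \<nu> = k
      then G (with_rows n b i (int \<circ> cons_row (m i + size_diff n (sh L) \<nu>) \<nu>)) else 0) =
    (\<Sum>P\<in>weight_tabs n m i. if c P = k then G (with_rows n b i (int \<circ> sh P)) else 0)"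
proof -
  have "fixed \<subseteq> pairs" by (auto simp: fixed_def)
  then have "(\<Sum>(T, u)\<in>pairs. val T u) = (\<Sum>(T, u)\<in>pairs - fixed. val T u) + (\<Sum>(T, u)\<in>fixed. val T u)"
    using finite_pairs by (rule sum.subset_diff)
  then show ?thesis using sum_pairs sum_bad sum_fixed by simp
qed

end

end

section \<open>The recursion for raising operators\<close>

text \<open>Linear extension to formal symbols. With \<open>schur n\<close> it is
  \<open>eval_schur\<close>; with integer-valued functions of the index it gives the coefficient
  functionals.\<close>

definition lin :: "(weight \<Rightarrow> 'r::comm_ring_1) \<Rightarrow> (weight \<Rightarrow>\<^sub>0 int) \<Rightarrow> 'r" where
  "lin f p = (\<Sum>\<nu>\<in>Poly_Mapping.keys p. of_int (Poly_Mapping.lookup p \<nu>) * f \<nu>)"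

lemma lin_superset:
  assumes "finite A" "Poly_Mapping.keys p \<subseteq> A"
  shows "lin f p = (\<Sum>\<nu>\<in>A. of_int (Poly_Mapping.lookup p \<nu>) * f \<nu>)"
  unfolding lin_def using assms by (intro sum.mono_neutral_left) (auto simp: in_keys_iff)

lemma lin_single [simp]: "lin f (Poly_Mapping.single \<mu> x) = of_int x * f \<mu>"
  by (subst lin_superset[of "{\<mu>}"]) auto

lemma lin_0 [simp]: "lin f 0 = 0"
  by (simp add: lin_def)

lemma lin_add: "lin f (p + q) = lin f p + lin f q"
proof -
  let ?A = "Poly_Mapping.keys p \<union> Poly_Mapping.keys q"
  have "lin f r = (\<Sum>\<nu>\<in>?A. of_int (Poly_Mapping.lookup r \<nu>) * f \<nu>)" if "Poly_Mapping.keys r \<subseteq> ?A"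
      for r
    using that by (intro lin_superset) auto
  then show ?thesis using Poly_Mapping.keys_add[of p q]
    by (simp add: lookup_add distrib_right sum.distrib)
qed

lemma lin_minus: "lin f (p - q) = lin f p - lin f q"
  using lin_add[of f "p - q" q] by simp

lemma lin_sum: "lin f (\<Sum>x\<in>A. g x) = (\<Sum>x\<in>A. lin f (g x))"
  by (induction A rule: infinite_finite_induct) (auto simp: lin_add)

lemma lin_single_mult: "lin f (Poly_Mapping.single a 1 * p) = lin (\<lambda>\<nu>. f (a + \<nu>)) p"
  using subset_UNIV[of "Poly_Mapping.keys p"]
proof (induction p rule: frag_induction)
  case (one \<mu>)
  then show ?case by (simp add: mult_single)
next
  case (diff p q)
  then show ?case by (simp add: right_diff_distrib lin_minus)
qed simp

lemma lin_fun_sum: "lin (\<lambda>\<nu>. \<Sum>x\<in>A. f x \<nu>) p = (\<Sum>x\<in>A. lin (f x) p)"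
  unfolding lin_def by (subst sum.swap) (simp add: sum_distrib_left)

section \<open>Expansion of the raising operators\<close>

definition comps :: "nat set \<Rightarrow> nat \<Rightarrow> (nat \<Rightarrow> nat) set" where
  "comps B r = {\<alpha>. (\<forall>j. j \<notin> B \<longrightarrow> \<alpha> j = 0) \<and> sum \<alpha> B = r}"

lemma finite_comps: "finite B \<Longrightarrow> finite (comps B r)"
proof (rule finite_subset)
  assume B: "finite B"
  show "comps B r \<subseteq> {\<alpha>. \<forall>j. (j \<in> B \<longrightarrow> \<alpha> j \<in> {..r}) \<and> (j \<notin> B \<longrightarrow> \<alpha> j = 0)}"
    using B by (auto simp: comps_def intro: member_le_sum)
  show "finite {\<alpha>. \<forall>j. (j \<in> B \<longrightarrow> \<alpha> j \<in> {..r}) \<and> (j \<notin> B \<longrightarrow> \<alpha> j = (0::nat))}"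
    using B by (rule finite_set_of_finite_funs) simp
qed

definition comp_weight :: "nat \<Rightarrow> nat set \<Rightarrow> (nat \<Rightarrow> nat) \<Rightarrow> weight" where
  "comp_weight i B \<alpha> = (\<Sum>j\<in>B. Poly_Mapping.single i (int (\<alpha> j)) - Poly_Mapping.single j (int (\<alpha>
      j)))"

lemma lookup_comp_weight:
  assumes "finite B" "i \<notin> B" "\<alpha> \<in> comps B r"
  shows "Poly_Mapping.lookup (comp_weight i B \<alpha>) j = (if j = i then int r else - int (\<alpha> j))"
proof (cases "j \<in> B")
  case True
  then have "Poly_Mapping.lookup (comp_weight i B \<alpha>) j = (\<Sum>k\<in>B. if k = j then - int (\<alpha> j) else 0)"
    using assms unfolding comp_weight_def lookup_sum
    by (intro sum.cong) (auto simp: lookup_minus lookup_single when_def)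
  then show ?thesis using True assms by auto
next
  case False
  then have "Poly_Mapping.lookup (comp_weight i B \<alpha>) j = (\<Sum>k\<in>B. if j = i then int (\<alpha> k) else 0)"
    unfolding comp_weight_def lookup_sum
    by (intro sum.cong) (auto simp: lookup_minus lookup_single when_def)
  then show ?thesis using False assms by (auto simp: comps_def simp flip: of_nat_sum)
qed

lemma raising_monom_power:
  "raising_monom i j ^ k = Poly_Mapping.single (Poly_Mapping.single i (int k) - Poly_Mapping.single
      j (int k)) 1"
proof (induction k)
  case (Suc k)
  have "Poly_Mapping.single i (1::int) - Poly_Mapping.single j 1 +
      (Poly_Mapping.single i (int k) - Poly_Mapping.single j (int k))
      = Poly_Mapping.single i (int (Suc k)) - Poly_Mapping.single j (int (Suc k))"
    by (simp add: algebra_simps single_add[symmetric])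
  then show ?case using Suc by (simp add: raising_monom_def mult_single)
qed simp

lemma prod_raising_geom:
  assumes "finite B"
  shows "fps_nth (\<Prod>j\<in>B. raising_geom i j) r = (\<Sum>\<alpha>\<in>comps B r. Poly_Mapping.single (comp_weight i B
      \<alpha>) 1)"
  using assms
proof (induction B arbitrary: r rule: finite_induct)
  case empty
  have "comps {} r = (if r = 0 then {\<lambda>_. 0} else {})" by (auto simp: comps_def)
  then show ?case by (auto simp: comp_weight_def)
next
  case (insert b B)
  have "fps_nth (\<Prod>j\<in>insert b B. raising_geom i j) r =
      (\<Sum>k=0..r. raising_monom i b ^ k * fps_nth (\<Prod>j\<in>B. raising_geom i j) (r - k))"
    using insert by (simp add: fps_mult_nth raising_geom_def)
  also have "\<dots> = (\<Sum>k=0..r. \<Sum>\<alpha>\<in>comps B (r - k). Poly_Mapping.single (comp_weight i (insert b B) (\<alpha>(b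
      := k))) 1)"
  proof (rule sum.cong[OF refl])
    fix k
    have "comp_weight i (insert b B) (\<alpha>(b := k)) = Poly_Mapping.single i (int k) -
        Poly_Mapping.single b (int k) + comp_weight i B \<alpha>" for \<alpha>
    proof -
      have "comp_weight i B (\<alpha>(b := k)) = comp_weight i B \<alpha>"
        unfolding comp_weight_def using insert by (intro sum.cong) auto
      then show ?thesis unfolding comp_weight_def using insert by simp
    qed
    then show "raising_monom i b ^ k * fps_nth (\<Prod>j\<in>B. raising_geom i j) (r - k) =
        (\<Sum>\<alpha>\<in>comps B (r - k). Poly_Mapping.single (comp_weight i (insert b B) (\<alpha>(b := k))) 1)"
      using insert.IH by (simp add: raising_monom_power sum_distrib_left mult_single)
  qed
  also have "\<dots> = (\<Sum>(k, \<alpha>)\<in>(SIGMA k:{0..r}. comps B (r - k)). Poly_Mapping.single (comp_weight i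
      (insert b B) (\<alpha>(b := k))) 1)"
    using insert by (intro sum.Sigma) (auto simp: finite_comps)
  also have "\<dots> = (\<Sum>\<alpha>\<in>comps (insert b B) r. Poly_Mapping.single (comp_weight i (insert b B) \<alpha>) 1)"
  proof (rule sum.reindex_bij_witness[where i = "\<lambda>\<alpha>. (\<alpha> b, \<alpha>(b := 0))"
      and j = "\<lambda>(k, \<alpha>). \<alpha>(b := k)"])
    have s: "sum (\<alpha>(b := k)) B = sum \<alpha> B" for \<alpha> :: "nat \<Rightarrow> nat" and k
      using insert by (intro sum.cong) auto
    fix a assume a: "a \<in> (SIGMA k:{0..r}. comps B (r - k))"
    then obtain k \<alpha> where a': "a = (k, \<alpha>)" "k \<le> r" "\<alpha> \<in> comps B (r - k)" by auto
    then have "\<alpha> b = 0" using insert by (auto simp: comps_def)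
    then show "(\<lambda>\<alpha>. (\<alpha> b, \<alpha>(b := 0))) ((\<lambda>(k, \<alpha>). \<alpha>(b := k)) a) = a" using a' by auto
    show "(\<lambda>(k, \<alpha>). \<alpha>(b := k)) a \<in> comps (insert b B) r"
      using a' insert s by (auto simp: comps_def simp del: fun_upd_apply) (auto simp: comps_def)
  next
    have s: "sum (\<alpha>(b := k)) B = sum \<alpha> B" for \<alpha> :: "nat \<Rightarrow> nat" and k
      using insert by (intro sum.cong) auto
    fix \<alpha> assume "\<alpha> \<in> comps (insert b B) r"
    then show "(\<alpha> b, \<alpha>(b := 0)) \<in> (SIGMA k:{0..r}. comps B (r - k))"
      using insert s[of \<alpha> 0] by (auto simp: comps_def)
  qed (auto split: prod.splits)
  finally show ?case .
qed

definition index_pairs :: "nat \<Rightarrow> nat \<Rightarrow> (nat \<times> nat) set" where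
  "index_pairs n i = {(a, b). i \<le> a \<and> a < b \<and> b \<le> n}"

lemma finite_index_pairs: "finite (index_pairs n i)"
  by (rule finite_subset[of _ "{..n} \<times> {..n}"]) (auto simp: index_pairs_def)

text \<open>The operators with first index at least \<open>i\<close>, applied to the symbol of
  \<mu>; for \<open>i = 1\<close> this is \<open>Q_\<mu>\<close> before straightening.\<close>

definition raised :: "nat \<Rightarrow> weight \<Rightarrow> nat \<Rightarrow> (weight \<Rightarrow>\<^sub>0 int) fps" where
  "raised n \<mu> i = (\<Prod>(a, b)\<in>index_pairs n i. raising_geom a b) * fps_const (Poly_Mapping.single \<mu> 1)"

lemma raised_rec: "raised n \<mu> i = (\<Prod>j\<in>{Suc i..n}. raising_geom i j) * raised n \<mu> (Suc i)"
proof -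
  have "index_pairs n i = Pair i ` {Suc i..n} \<union> index_pairs n (Suc i)"
    by (auto simp: index_pairs_def image_iff)
  moreover have "Pair i ` {Suc i..n} \<inter> index_pairs n (Suc i) = {}" by (auto simp: index_pairs_def)
  ultimately have "(\<Prod>(a, b)\<in>index_pairs n i. raising_geom a b) =
      (\<Prod>(a, b)\<in>Pair i ` {Suc i..n}. raising_geom a b) * (\<Prod>(a, b)\<in>index_pairs n (Suc i).
          raising_geom a b)"
    using finite_index_pairs by (simp add: prod.union_disjoint)
  also have "(\<Prod>(a, b)\<in>Pair i ` {Suc i..n}. raising_geom a b) = (\<Prod>j\<in>{Suc i..n}. raising_geom i j)"
    by (subst prod.reindex) (auto simp: inj_on_def)
  finally show ?thesis by (simp add: raised_def mult.assoc)
qed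

section \<open>Functionals on shifted indices\<close>

definition shifted :: "nat \<Rightarrow> weight \<Rightarrow> nat \<Rightarrow> int" where
  "shifted n \<nu> j = Poly_Mapping.lookup \<nu> j + Poly_Mapping.lookup (delta n) j"

definition eval_at :: "nat \<Rightarrow> ((nat \<Rightarrow> int) \<Rightarrow> int) \<Rightarrow> (weight \<Rightarrow>\<^sub>0 int) \<Rightarrow> int" where
  "eval_at n G = lin (\<lambda>\<nu>. G (shifted n \<nu>))"

text \<open>The transpose of the operators \<open>R_ij\<close> for fixed \<open>i\<close> in degree
  \<open>r\<close>: rather than moving the symbol, the argument of \<open>G\<close> is translated,
  with exponents \<alpha>.\<close>

definition raise_sum :: "nat \<Rightarrow> nat \<Rightarrow> nat \<Rightarrow> ((nat \<Rightarrow> int) \<Rightarrow> int) \<Rightarrow> (nat \<Rightarrow> int) \<Rightarrow> int" where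
  "raise_sum n i r G \<beta> = (\<Sum>\<alpha>\<in>comps {Suc i..n} r. G (\<lambda>j. \<beta> j + (if j =
      i then int r else - int (\<alpha> j))))"

lemma eval_at_raised:
  "eval_at n G (fps_nth (raised n \<mu> i) k) =
    (\<Sum>r=0..k. eval_at n (raise_sum n i r G) (fps_nth (raised n \<mu> (Suc i)) (k - r)))"
proof -
  have "eval_at n G (fps_nth (raised n \<mu> i) k) =
    (\<Sum>r=0..k. \<Sum>\<alpha>\<in>comps {Suc i..n} r. eval_at n G
      (Poly_Mapping.single (comp_weight i {Suc i..n} \<alpha>) 1 * fps_nth (raised n \<mu> (Suc i)) (k - r)))"
    unfolding raised_rec[of n \<mu> i] fps_mult_nth
    by (simp add: prod_raising_geom eval_at_def lin_sum sum_distrib_right)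
  also have "\<dots> = (\<Sum>r=0..k. eval_at n (raise_sum n i r G) (fps_nth (raised n \<mu> (Suc i)) (k - r)))"
  proof (rule sum.cong[OF refl])
    fix r
    have "G (shifted n (comp_weight i {Suc i..n} \<alpha> + \<nu>)) =
        G (\<lambda>j. shifted n \<nu> j + (if j = i then int r else - int (\<alpha> j)))" if "\<alpha> \<in> comps {Suc i..n} r"
            for \<alpha> \<nu>
    proof -
      have "shifted n (comp_weight i {Suc i..n} \<alpha> + \<nu>) = (\<lambda>j. shifted n \<nu> j + (if j =
          i then int r else - int (\<alpha> j)))"
        using lookup_comp_weight[OF _ _ that, of i] by (auto simp: shifted_def lookup_add
            fun_eq_iff)
      then show ?thesis by simp
    qed
    then show "(\<Sum>\<alpha>\<in>comps {Suc i..n} r. eval_at n G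
      (Poly_Mapping.single (comp_weight i {Suc i..n} \<alpha>) 1 * fps_nth (raised n \<mu> (Suc i)) (k - r))) =
      eval_at n (raise_sum n i r G) (fps_nth (raised n \<mu> (Suc i)) (k - r))"
      unfolding eval_at_def lin_single_mult raise_sum_def lin_fun_sum
      by (intro sum.cong refl) (simp add: lin_def)
  qed
  finally show ?thesis .
qed

definition vanishing :: "nat \<Rightarrow> nat \<Rightarrow> ((nat \<Rightarrow> int) \<Rightarrow> int) \<Rightarrow> bool" where
  "vanishing n i G \<longleftrightarrow> (\<forall>\<beta>. (\<exists>j\<in>{i..n}. \<beta> j < 0) \<longrightarrow> G \<beta> = 0)"

text \<open>The translations lower all coordinates after \<open>i\<close>, so negative entries stay
  negative there. Coordinate \<open>i\<close> is raised, which is why the conclusion starts at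
  \<open>Suc i\<close>.\<close>

lemma vanishing_raise_sum: "vanishing n i G \<Longrightarrow> vanishing n (Suc i) (raise_sum n i r G)"
  unfolding vanishing_def raise_sum_def
proof (intro allI impI sum.neutral ballI)
  fix \<beta> :: "nat \<Rightarrow> int" and \<alpha> :: "nat \<Rightarrow> nat"
  assume G: "\<forall>\<beta>. (\<exists>j\<in>{i..n}. \<beta> j < 0) \<longrightarrow> G \<beta> = 0" and "\<exists>j\<in>{Suc i..n}. \<beta> j < 0"
  then obtain j where "j \<in> {Suc i..n}" "\<beta> j < 0" by blast
  then have "j \<in> {i..n}" "\<beta> j + (if j = i then int r else - int (\<alpha> j)) < 0" by auto
  then show "G (\<lambda>j. \<beta> j + (if j = i then int r else - int (\<alpha> j))) = 0"
    by (intro G[rule_format] bexI[of _ j])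
qed

text \<open>The set of exponent vectors is stable under permutations of the coordinates after
  \<open>i\<close>, so a transposition can be carried over from \<beta> to \<alpha>.\<close>

lemma alternating_raise_sum:
  assumes "alternating n i G"
  shows "alternating n (Suc i) (raise_sum n i r G)"
  unfolding alternating_def
proof (intro ballI allI impI)
  fix a c \<beta> assume ac: "a \<in> {Suc i..n}" "c \<in> {Suc i..n}" "a \<noteq> c"
  let ?t = "Transposition.transpose a c"
  have p: "?t permutes {Suc i..n}" using ac by (intro permutes_swap_id)
  have tt: "\<alpha> \<circ> ?t \<circ> ?t = \<alpha>" for \<alpha> :: "nat \<Rightarrow> nat" by (simp add: fun_eq_iff)
  have mem: "\<alpha> \<circ> ?t \<in> comps {Suc i..n} r" if "\<alpha> \<in> comps {Suc i..n} r" for \<alpha>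
  proof -
    have "sum (\<alpha> \<circ> ?t) {Suc i..n} = sum \<alpha> {Suc i..n}"
      using sum.permute[OF p, of \<alpha>] by (simp add: comp_def)
    moreover have "?t j \<in> {Suc i..n} \<longleftrightarrow> j \<in> {Suc i..n}" for j using permutes_in_image[OF p] by simp
    ultimately show ?thesis using that by (auto simp: comps_def)
  qed
  have "raise_sum n i r G (\<beta> \<circ> ?t) =
      (\<Sum>\<alpha>\<in>comps {Suc i..n} r. G (\<lambda>j. (\<beta> \<circ> ?t) j + (if j = i then int r else - int ((\<alpha> \<circ> ?t) j))))"
    unfolding raise_sum_def
    by (rule sum.reindex_bij_witness[where i = "\<lambda>\<alpha>. \<alpha> \<circ> ?t" and j = "\<lambda>\<alpha>. \<alpha> \<circ> ?t"])
      (use mem tt in \<open>simp_all cong: if_cong\<close>)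
  also have "\<dots> = (\<Sum>\<alpha>\<in>comps {Suc i..n} r. G ((\<lambda>j. \<beta> j + (if j = i then int r else - int (\<alpha> j))) \<circ>
      ?t))"
  proof -
    have "?t j = i \<longleftrightarrow> j = i" for j using ac by (auto simp: transpose_def)
    then show ?thesis by (simp add: comp_def cong: if_cong)
  qed
  also have "\<dots> = - raise_sum n i r G \<beta>"
    using assms ac by (simp add: alternating_def raise_sum_def sum_negf)
  finally show "raise_sum n i r G (\<beta> \<circ> ?t) = - raise_sum n i r G \<beta>" .
qed

text \<open>The alternating sum over all ways to lower the entries of \<open>\<rho>\<close> by \<open>r\<close> in total reduces to the
  horizontal strips: if \<open>\<alpha> j\<close> is too large for the first time at \<open>j\<close>, exchange the entries \<open>j\<close>
      and \<open>j + 1\<close>.\<close>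

lemma raise_sum_hstrip:
  assumes i: "1 \<le> i" "i \<le> n" and alt: "alternating n i G" and van: "vanishing n i G"
    and L: "tab L" "length L \<le> n - i"
    and b: "b i = int (a + (n - i))"
  shows "raise_sum n i r G (with_rows n b (Suc i) (int \<circ> sh L)) =
    (\<Sum>\<nu> | hstrip (sh L) \<nu> \<and> size_diff n (sh L) \<nu> = r. G (with_rows n b i (int \<circ> cons_row (a +
        r) \<nu>)))"
proof -
  \<comment> \<open>The amount by which coordinate \<open>j\<close> may be lowered within a
    horizontal strip: row \<open>j - Suc i\<close> must not become shorter than the next row
    was.\<close>
  define d where "d j = sh L (j - Suc i) - sh L (j - i)" for j
  have mono: "sh L (j - i) \<le> sh L (j - Suc i)" for j using L by (intro wtab_sh_mono tab_wtab) auto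
  let ?C = "comps {Suc i..n} r"
  let ?g = "\<lambda>\<alpha>. \<lambda>j. with_rows n b (Suc i) (int \<circ> sh L) j + (if j = i then int r else - int (\<alpha> j))"
  \<comment> \<open>The last coordinate is left out, having no right neighbour for an exchange.
    Lowering it by more than \<open>d n\<close> makes it negative, and there \<open>G\<close>
    vanishes.\<close>
  let ?bad = "\<lambda>\<alpha> j. j \<in> {Suc i..<n} \<and> d j < \<alpha> j"
  define B where "B = {\<alpha>\<in>?C. \<exists>j. ?bad \<alpha> j}"
  define H where "H = {\<alpha>\<in>?C. \<forall>j\<in>{Suc i..n}. \<alpha> j \<le> d j}"
  have fin: "finite ?C" by (rule finite_comps) simp
  define first where "first \<alpha> = (LEAST j. ?bad \<alpha> j)" for \<alpha>
  \<comment> \<open>The unlowered entries at \<open>j\<close> and \<open>Suc j\<close> differ by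
    \<open>d j + 1\<close>, the 1 coming from \<delta>. Exchanging the lowered entries therefore
    amounts to these new exponents, with the same total.\<close>
  define swap where "swap \<alpha> = \<alpha>(first \<alpha> := d (first \<alpha>) + 1 + \<alpha> (Suc (first \<alpha>)),
      Suc (first \<alpha>) := \<alpha> (first \<alpha>) - d (first \<alpha>) - 1)" for \<alpha>
  have first: "?bad \<alpha> (first \<alpha>)" if "\<alpha> \<in> B" for \<alpha>
    unfolding first_def by (rule LeastI_ex) (use that in \<open>auto simp: B_def\<close>)
  have first_le: "first \<alpha> \<le> j" if "?bad \<alpha> j" for \<alpha> j unfolding first_def
      by (rule Least_le) (rule that)
  have zeroB: "(\<Sum>\<alpha>\<in>B. G (?g \<alpha>)) = 0"
  proof (rule sum_involution_zero[where f = swap])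
    fix \<alpha> assume \<alpha>: "\<alpha> \<in> B"
    define j where "j = first \<alpha>"
    have j: "Suc i \<le> j" "j < n" "d j < \<alpha> j" using first[OF \<alpha>] by (auto simp: j_def)
    have sw: "swap \<alpha> = \<alpha>(j := d j + 1 + \<alpha> (Suc j), Suc j := \<alpha> j - d j - 1)"
        by (simp add: swap_def j_def)
    have split: "sum f {Suc i..n} = f j + f (Suc j) + sum f ({Suc i..n} - {j, Suc j})"
        for f :: "nat \<Rightarrow> nat"
    proof -
      have "{Suc i..n} = insert j (insert (Suc j) ({Suc i..n} - {j, Suc j}))" using j by auto
      then have "sum f {Suc i..n} = sum f (insert j (insert (Suc j) ({Suc i..n} - {j, Suc j})))"
          by simp
      then show ?thesis by simp
    qed
    have "sum (swap \<alpha>) {Suc i..n} = sum \<alpha> {Suc i..n}"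
    proof -
      have "sum (swap \<alpha>) ({Suc i..n} - {j, Suc j}) = sum \<alpha> ({Suc i..n} - {j, Suc j})"
        by (intro sum.cong) (auto simp: sw)
      then show ?thesis using split[of "swap \<alpha>"] split[of \<alpha>] j by (simp add: sw)
    qed
    moreover have "swap \<alpha> q = 0" if "q \<notin> {Suc i..n}" for q
      using that \<alpha> j by (auto simp: sw B_def comps_def)
    ultimately have C: "swap \<alpha> \<in> ?C" using \<alpha> by (auto simp: B_def comps_def)
    have bad: "?bad (swap \<alpha>) j" using j by (simp add: sw)
    then show "swap \<alpha> \<in> B" using C by (auto simp: B_def)
    have "first (swap \<alpha>) = j"
    proof (rule order.antisym)
      show "first (swap \<alpha>) \<le> j" using bad by (rule first_le)
      show "j \<le> first (swap \<alpha>)"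
      proof (rule ccontr)
        assume lt: "\<not> j \<le> first (swap \<alpha>)"
        have "?bad (swap \<alpha>) (first (swap \<alpha>))" by (rule first) fact
        then have "?bad \<alpha> (first (swap \<alpha>))" using lt by (auto simp: sw split: if_splits)
        then show False using first_le lt by (auto simp: j_def)
      qed
    qed
    then show "swap (swap \<alpha>) = \<alpha>" unfolding swap_def[of "swap \<alpha>"] using j
        by (auto simp: sw fun_eq_iff)
    have e: "with_rows n b (Suc i) (int \<circ> sh L) j - with_rows n b (Suc i) (int \<circ> sh L) (Suc j) =
        int (d j) + 1"
    proof -
      have "int (n - j) = int (n - Suc j) + 1" using j by simp
      moreover have "Suc j - Suc i = j - i" by simp
      moreover have "int (d j) = int (sh L (j - Suc i)) - int (sh L (j - i))" using mono[of j]
          by (simp add: d_def)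
      ultimately show ?thesis using j by (simp add: with_rows_def)
    qed
    have "?g (swap \<alpha>) = ?g \<alpha> \<circ> Transposition.transpose j (Suc j)"
    proof
      fix q
      consider "q = j" | "q = Suc j" | "q \<noteq> j" "q \<noteq> Suc j" by blast
      then show "?g (swap \<alpha>) q = (?g \<alpha> \<circ> Transposition.transpose j (Suc j)) q"
      proof cases
        case 1
        then show ?thesis using e j by (simp add: sw)
      next
        case 2
        then show ?thesis using e j by (simp add: sw)
      next
        case 3
        then show ?thesis by (simp add: sw)
      qed
    qed
    then show "G (?g (swap \<alpha>)) = - G (?g \<alpha>)"
      using alt j unfolding alternating_def by simp
  qed
  have d_n: "d n = sh L (n - Suc i)" using L by (simp add: d_def sh_eq_0)
  have HB: "H \<subseteq> ?C - B"
  proof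
    fix \<alpha> assume \<alpha>: "\<alpha> \<in> H"
    have "\<not> ?bad \<alpha> j" for j
    proof
      assume "?bad \<alpha> j"
      then have "j \<in> {Suc i..n}" "d j < \<alpha> j" by auto
      then show False using \<alpha> unfolding H_def by fastforce
    qed
    then show "\<alpha> \<in> ?C - B" using \<alpha> unfolding H_def B_def by blast
  qed
  have "raise_sum n i r G (with_rows n b (Suc i) (int \<circ> sh L)) = (\<Sum>\<alpha>\<in>?C. G (?g \<alpha>))"
    by (simp add: raise_sum_def)
  also have "\<dots> = (\<Sum>\<alpha>\<in>?C - B. G (?g \<alpha>)) + (\<Sum>\<alpha>\<in>B. G (?g \<alpha>))"
    by (rule sum.subset_diff[OF _ fin]) (auto simp: B_def)
  also have "(\<Sum>\<alpha>\<in>?C - B. G (?g \<alpha>)) = (\<Sum>\<alpha>\<in>H. G (?g \<alpha>))"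
  proof (rule sum.mono_neutral_right)
    show "\<forall>\<alpha>\<in>?C - B - H. G (?g \<alpha>) = 0"
    proof
      fix \<alpha> assume \<alpha>: "\<alpha> \<in> ?C - B - H"
      then obtain j where j: "j \<in> {Suc i..n}" "d j < \<alpha> j" by (auto simp: H_def)
      then have "j = n" using \<alpha> by (auto simp: B_def) (metis atLeastLessThan_iff
          le_neq_implies_less)
      then have "?g \<alpha> n < 0" using j d_n by (simp add: with_rows_def)
      then show "G (?g \<alpha>) = 0" using van i unfolding vanishing_def
          by (meson atLeastAtMost_iff order_refl)
    qed
  qed (use fin HB in auto)
  also have "\<dots> = (\<Sum>\<nu> | hstrip (sh L) \<nu> \<and> size_diff n (sh L) \<nu> = r. G (with_rows n b i (int \<circ>
      cons_row (a + r) \<nu>)))"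
  proof (rule sum.reindex_bij_witness[where
      i = "\<lambda>\<nu> j. if Suc i \<le> j \<and> j \<le> n then sh L (j - Suc i) - \<nu> (j - Suc i) else 0" and
      j = "\<lambda>\<alpha> q. sh L q - \<alpha> (Suc i + q)"])
    have sh0: "sh L q = 0" if "n - i \<le> q" for q using L that by (intro sh_eq_0) simp
    have sumsh: "(\<Sum>q<n. f q) = (\<Sum>j\<in>{Suc i..n}. f (j - Suc i))" if "\<And>q. n - i \<le> q \<Longrightarrow> f q = 0"
        for f :: "nat \<Rightarrow> nat"
    proof -
      have "(\<Sum>q<n. f q) = (\<Sum>q<n - i. f q)" using that by (intro sum.mono_neutral_right) auto
      also have "\<dots> = (\<Sum>j\<in>{Suc i..n}. f (j - Suc i))"
        by (rule sum.reindex_bij_witness[where i = "\<lambda>j. j - Suc i" and j = "\<lambda>q. q + Suc i"]) auto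
      finally show ?thesis .
    qed
    {
      fix \<alpha> assume "\<alpha> \<in> H"
      then have \<alpha>: "\<And>j. j \<notin> {Suc i..n} \<Longrightarrow> \<alpha> j = 0" "sum \<alpha> {Suc i..n} = r" "\<And>j. j \<in> {Suc i..n} \<Longrightarrow>
          \<alpha> j \<le> d j"
        by (auto simp: H_def comps_def)
      have dle: "\<alpha> j \<le> sh L (j - Suc i)" for j
        using \<alpha>(1)[of j] \<alpha>(3)[of j] by (cases "j \<in> {Suc i..n}") (auto simp: d_def)
      let ?\<nu> = "\<lambda>q. sh L q - \<alpha> (Suc i + q)"
      show "(\<lambda>j. if Suc i \<le> j \<and> j \<le> n then sh L (j - Suc i) - ?\<nu> (j - Suc i) else 0) = \<alpha>"
        using dle \<alpha>(1) by (auto simp: fun_eq_iff)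
      have "hstrip (sh L) ?\<nu>"
        unfolding hstrip_def
      proof
        fix q
        have "sh L (Suc q) \<le> ?\<nu> q"
        proof (cases "Suc i + q \<le> n")
          case True
          then show ?thesis using \<alpha>(3)[of "Suc i + q"] mono[of "Suc i + q"] by (simp add: d_def)
        next
          case False
          then show ?thesis using sh0[of "Suc q"] by simp
        qed
        then show "?\<nu> q \<le> sh L q \<and> sh L (Suc q) \<le> ?\<nu> q" by simp
      qed
      moreover have "size_diff n (sh L) ?\<nu> = r"
      proof -
        have "(\<Sum>q<n. ?\<nu> q) = (\<Sum>j\<in>{Suc i..n}. ?\<nu> (j - Suc i))" using sh0 by (intro sumsh) simp
        also have "\<dots> = (\<Sum>j\<in>{Suc i..n}. sh L (j - Suc i) - \<alpha> j)" by (intro sum.cong) auto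
        also have "\<dots> = (\<Sum>j\<in>{Suc i..n}. sh L (j - Suc i)) - r"
          using dle by (subst sum_subtractf_nat) (auto simp: \<alpha>(2))
        finally have "(\<Sum>q<n. ?\<nu> q) = (\<Sum>q<n. sh L q) - r" using sumsh[of "sh L"] sh0 by simp
        moreover have "r \<le> (\<Sum>q<n. sh L q)"
          using sumsh[of "sh L"] sh0 sum_mono[of "{Suc i..n}" \<alpha> "\<lambda>j. sh L (j - Suc i)"] dle \<alpha>(2)
              by simp
        ultimately show ?thesis by (simp add: size_diff_def)
      qed
      ultimately show "?\<nu> \<in> {\<nu>. hstrip (sh L) \<nu> \<and> size_diff n (sh L) \<nu> = r}" by simp
      have "with_rows n b i (int \<circ> cons_row (a + r) ?\<nu>) = ?g \<alpha>"
      proof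
        fix j
        consider "j < i \<or> n < j" | "j = i" | "Suc i \<le> j" "j \<le> n" by linarith
        then show "with_rows n b i (int \<circ> cons_row (a + r) ?\<nu>) j = ?g \<alpha> j"
        proof cases
          case 1
          then show ?thesis using \<alpha>(1)[of j] i by (auto simp: with_rows_def)
        next
          case 2
          then show ?thesis using b i by (simp add: with_rows_def)
        next
          case 3
          then have "j - i = Suc (j - Suc i)" by simp
          then show ?thesis using 3 dle[of j] by (simp add: with_rows_def)
        qed
      qed
      then show "G (with_rows n b i (int \<circ> cons_row (a + r) ?\<nu>)) = G (?g \<alpha>)" by simp
    next
      fix \<nu> assume "\<nu> \<in> {\<nu>. hstrip (sh L) \<nu> \<and> size_diff n (sh L) \<nu> = r}"
      then have \<nu>: "\<And>q. \<nu> q \<le> sh L q" "\<And>q. sh L (Suc q) \<le> \<nu> q" "size_diff n (sh L) \<nu> = r"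
        by (auto simp: hstrip_def)
      let ?\<alpha> = "\<lambda>j. if Suc i \<le> j \<and> j \<le> n then sh L (j - Suc i) - \<nu> (j - Suc i) else 0"
      have \<nu>0: "\<nu> q = 0" if "n - i \<le> q" for q using \<nu>(1)[of q] sh0[OF that] by simp
      show "(\<lambda>q. sh L q - ?\<alpha> (Suc i + q)) = \<nu>"
      proof
        fix q
        show "sh L q - ?\<alpha> (Suc i + q) = \<nu> q"
          using \<nu>(1)[of q] sh0[of q] \<nu>0[of q] by (cases "Suc i + q \<le> n") auto
      qed
      have "sum ?\<alpha> {Suc i..n} = (\<Sum>j\<in>{Suc i..n}. sh L (j - Suc i) - \<nu> (j - Suc i))"
          by (intro sum.cong) auto
      also have "\<dots> = size_diff n (sh L) \<nu>"
        using \<nu>(1) sumsh[of "sh L"] sumsh[of \<nu>] sh0 \<nu>0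
            by (subst sum_subtractf_nat) (auto simp: size_diff_def)
      finally have "sum ?\<alpha> {Suc i..n} = r" using \<nu>(3) by simp
      then have "?\<alpha> \<in> ?C" by (auto simp: comps_def)
      moreover have "?\<alpha> j \<le> d j" if "j \<in> {Suc i..n}" for j
      proof -
        have "Suc (j - Suc i) = j - i" using that by auto
        then show ?thesis using \<nu>(2)[of "j - Suc i"] that
            by (auto simp: d_def intro!: diff_le_mono2)
      qed
      ultimately show "?\<alpha> \<in> H" by (simp add: H_def)
    }
  qed
  finally show ?thesis unfolding zeroB by (simp only: add_0_right)
qed

text \<open>Downward induction on \<open>i\<close>. At \<open>i = n + 1\<close> only the empty
  tableau and the symbol of \<mu> remain. \<open>G\<close> and \<open>k\<close> vary, since a step
  replaces them by \<open>raise_sum n i r G\<close> and \<open>k - r\<close>.\<close>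

lemma (in list_charge) eval_at_charge:
  assumes "c [] = 0" and m: "\<And>j. j \<in> {1..n} \<Longrightarrow> Poly_Mapping.lookup \<mu> j = int (m j)"
    and "1 \<le> i" "i \<le> Suc n" "alternating n i G" "vanishing n i G"
  shows "eval_at n G (fps_nth (raised n \<mu> i) k) =
    (\<Sum>P\<in>weight_tabs n m i. if c P = k then G (with_rows n (shifted n \<mu>) i (int \<circ> sh P)) else 0)"
  using assms(4,3,5,6)
proof (induction i arbitrary: G k rule: inc_induct)
  case base
  have "weight_tabs n m (Suc n) = {[]}"
  proof -
    have "L = []" if "tab L" "set (word L) \<subseteq> {}" for L
      using that by (cases L) (auto simp: tab_def)
    then show ?thesis by (auto simp: weight_tabs_def weight_words_def tab_def)
  qed
  moreover have "with_rows n (shifted n \<mu>) (Suc n) f = shifted n \<mu>" for f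
      by (auto simp: with_rows_def)
  moreover have "index_pairs n (Suc n) = {}" by (auto simp: index_pairs_def)
  then have "raised n \<mu> (Suc n) = fps_const (Poly_Mapping.single \<mu> 1)" by (simp add: raised_def)
  ultimately show ?case using assms(1) by (simp add: eval_at_def)
next
  case (step i)
  have i: "1 \<le> i" "i \<le> n" using step by auto
  let ?b = "shifted n \<mu>"
  let ?W = "weight_tabs n m (Suc i)"
  let ?F = "\<lambda>L \<nu>. G (with_rows n ?b i (int \<circ> cons_row (m i + size_diff n (sh L) \<nu>) \<nu>))"
  have fin: "finite {\<nu>. hstrip (sh L) \<nu>}" for L by (rule finite_hstrip)
  have bi: "?b i = int (m i + (n - i))" using m[of i] i by (simp add: shifted_def lookup_delta)
  have "eval_at n G (fps_nth (raised n \<mu> i) k) =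
      (\<Sum>r=0..k. \<Sum>L\<in>?W. if c L = k - r then raise_sum n i r G (with_rows n ?b (Suc i) (int \<circ> sh L))
          else 0)"
    unfolding eval_at_raised[of n G \<mu> i]
    using step.IH step.prems by (intro sum.cong refl) (simp add: alternating_raise_sum
        vanishing_raise_sum)
  also have "\<dots> = (\<Sum>r=0..k. \<Sum>L\<in>?W. \<Sum>\<nu> | hstrip (sh L) \<nu>.
      if c L = k - r \<and> size_diff n (sh L) \<nu> = r then ?F L \<nu> else 0)"
  proof (intro sum.cong refl)
    fix r L assume L: "L \<in> ?W"
    then have "length L \<le> Suc n - Suc i" by (intro tab_length_le) (auto simp: weight_tabs_def
        weight_words_def)
    then have "raise_sum n i r G (with_rows n ?b (Suc i) (int \<circ> sh L)) =
      (\<Sum>\<nu> | hstrip (sh L) \<nu> \<and> size_diff n (sh L) \<nu> = r. G (with_rows n ?b i (int \<circ> cons_row (m i +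
          r) \<nu>)))"
      using L i step.prems by (intro raise_sum_hstrip bi) (auto simp: weight_tabs_def)
    also have "\<dots> = (\<Sum>\<nu> | hstrip (sh L) \<nu>. if size_diff n (sh L) \<nu> = r then ?F L \<nu> else 0)"
    proof -
      have "{\<nu>. hstrip (sh L) \<nu> \<and> size_diff n (sh L) \<nu> = r} = {\<nu>\<in>{\<nu>. hstrip (sh L) \<nu>}. size_diff n
          (sh L) \<nu> = r}"
        by simp
      then show ?thesis by (simp only: sum.inter_filter[OF fin[of L]]) (intro sum.cong refl
          if_cong; simp)
    qed
    finally have "raise_sum n i r G (with_rows n ?b (Suc i) (int \<circ> sh L)) =
      (\<Sum>\<nu> | hstrip (sh L) \<nu>. if size_diff n (sh L) \<nu> = r then ?F L \<nu> else 0)" .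
    then show "(if c L = k - r then raise_sum n i r G (with_rows n ?b (Suc i) (int \<circ> sh L)) else 0)
        =
      (\<Sum>\<nu> | hstrip (sh L) \<nu>. if c L = k - r \<and> size_diff n (sh L) \<nu> = r then ?F L \<nu> else 0)"
      by (cases "c L = k - r") (simp_all only: simp_thms if_True if_False sum.neutral_const)
  qed
  also have "\<dots> = (\<Sum>L\<in>?W. \<Sum>r=0..k. \<Sum>\<nu> | hstrip (sh L) \<nu>.
      if c L = k - r \<and> size_diff n (sh L) \<nu> = r then ?F L \<nu> else 0)"
    by (rule sum.swap)
  also have "\<dots> = (\<Sum>L\<in>?W. \<Sum>\<nu> | hstrip (sh L) \<nu>. \<Sum>r=0..k.
      if c L = k - r \<and> size_diff n (sh L) \<nu> = r then ?F L \<nu> else 0)"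
    by (intro sum.cong refl sum.swap)
  \<comment> \<open>The degree \<open>r\<close> is forced to be the size of the strip, and
    \<open>r \<le> k\<close> makes the truncated difference \<open>k - r\<close> exact.\<close>
  also have "\<dots> = (\<Sum>L\<in>?W. \<Sum>\<nu> | hstrip (sh L) \<nu>. if c L + size_diff n (sh L) \<nu> =
      k then ?F L \<nu> else 0)"
  proof (intro sum.cong refl)
    fix L \<nu>
    have "(\<Sum>r=0..k. if c L = k - r \<and> size_diff n (sh L) \<nu> = r then ?F L \<nu> else 0) =
        (\<Sum>r=0..k. if r = size_diff n (sh L) \<nu> then (if c L = k - r then ?F L \<nu> else 0) else 0)"
      by (intro sum.cong) auto
    then show "(\<Sum>r=0..k. if c L = k - r \<and> size_diff n (sh L) \<nu> = r then ?F L \<nu> else 0) =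
      (if c L + size_diff n (sh L) \<nu> = k then ?F L \<nu> else 0)"
      by auto
  qed
  also have "\<dots> = (\<Sum>P\<in>weight_tabs n m i. if c P = k then G (with_rows n ?b i (int \<circ> sh P)) else 0)"
    using i step.prems by (intro charge_recursion)
  finally show ?case .
qed

section \<open>Quotients of alternants\<close>

lemma perm_act_add: "w permutes {1..n} \<Longrightarrow> perm_act w (\<mu> + \<nu>) = perm_act w \<mu> + perm_act w \<nu>"
  by (rule poly_mapping_eqI) (simp add: lookup_perm_act lookup_add)

lemma perm_act_comp:
  assumes "v permutes {1..n}" "w permutes {1..n}"
  shows "perm_act (v \<circ> w) \<mu> = perm_act v (perm_act w \<mu>)"
proof (rule poly_mapping_eqI)
  fix i
  have "inv (v \<circ> w) = inv w \<circ> inv v" using assms by (intro o_inv_distrib permutes_bij)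
  then show "Poly_Mapping.lookup (perm_act (v \<circ> w) \<mu>) i = Poly_Mapping.lookup (perm_act v (perm_act
      w \<mu>)) i"
    using assms by (simp add: lookup_perm_act[OF permutes_compose[OF assms(2,1)]]
        lookup_perm_act[OF assms(1)] lookup_perm_act[OF assms(2)])
qed

lemma perm_act_id [simp]: "perm_act id \<mu> = \<mu>"
  by (rule poly_mapping_eqI) (simp add: lookup_perm_act[OF permutes_id[of "{1..n}"]])

lemma perm_act_inverse:
  assumes "w permutes {1..n}"
  shows "perm_act (inv w) (perm_act w \<mu>) = \<mu>"
  using perm_act_comp[OF permutes_inv[OF assms] assms, of \<mu>] permutes_inv_o(2)[OF assms] by simp

lemma weights_lookup: "\<mu> \<in> weights n \<longleftrightarrow> (\<forall>i. i \<notin> {1..n} \<longrightarrow> Poly_Mapping.lookup \<mu> i = 0)"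
  by (auto simp: weights_def in_keys_iff)

lemma perm_act_weights: "w permutes {1..n} \<Longrightarrow> \<mu> \<in> weights n \<Longrightarrow> perm_act w \<mu> \<in> weights n"
  unfolding weights_lookup using lookup_perm_act permutes_not_in[OF permutes_inv] by metis

lemma delta_weights: "delta n \<in> weights n"
  by (auto simp: weights_lookup lookup_delta)

lemma weights_add: "\<mu> \<in> weights n \<Longrightarrow> \<nu> \<in> weights n \<Longrightarrow> \<mu> + \<nu> \<in> weights n"
  by (simp add: weights_lookup lookup_add)

lemma weights_diff: "\<mu> \<in> weights n \<Longrightarrow> \<nu> \<in> weights n \<Longrightarrow> \<mu> - \<nu> \<in> weights n"
  by (simp add: weights_lookup lookup_minus)

lemma alternant_perm_act:
  assumes v: "v permutes {1..n}"
  shows "alternant n (perm_act v \<mu>) = of_int (sign v) * alternant n \<mu>"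
proof -
  have "alternant n (perm_act v \<mu>) = (\<Sum>w | w permutes {1..n}. Poly_Mapping.single (perm_act (w \<circ> v)
      \<mu>) (sign w))"
    unfolding alternant_def using v by (intro sum.cong) (simp_all add: perm_act_comp)
  also have "\<dots> = (\<Sum>w | w permutes {1..n}. Poly_Mapping.single (perm_act w \<mu>) (sign (w \<circ> inv v)))"
  proof (rule sum.reindex_bij_witness[where i = "\<lambda>w. w \<circ> inv v" and j = "\<lambda>w. w \<circ> v"])
    fix w assume "w \<in> {w. w permutes {1..n}}"
    then have w: "w permutes {1..n}" by simp
    have vv: "v \<circ> inv v = id" "inv v \<circ> v = id" using permutes_inv_o[OF v] by auto
    show "(w \<circ> v) \<circ> inv v = w" "(w \<circ> inv v) \<circ> v = w" using vv by (simp_all add: comp_assoc)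
    show "w \<circ> v \<in> {w. w permutes {1..n}}" "w \<circ> inv v \<in> {w. w permutes {1..n}}"
      using w v by (auto intro: permutes_compose permutes_inv)
    show "Poly_Mapping.single (perm_act (w \<circ> v) \<mu>) (sign ((w \<circ> v) \<circ> inv v)) =
        Poly_Mapping.single (perm_act (w \<circ> v) \<mu>) (sign w)"
      using vv by (simp add: comp_assoc)
  qed
  also have "\<dots> = (\<Sum>w | w permutes {1..n}. of_int (sign v) * Poly_Mapping.single (perm_act w \<mu>)
      (sign w))"
  proof (rule sum.cong[OF refl])
    fix w assume "w \<in> {w. w permutes {1..n}}"
    then have "permutation w" "permutation (inv v)" "permutation v"
      using v by (auto intro: permutation_permutes[THEN iffD2] permutes_inv)
    then have "sign (w \<circ> inv v) = sign v * sign w" by (simp add: sign_compose sign_inverse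
        mult.commute)
    moreover have "of_int (sign v) * Poly_Mapping.single \<kappa> x = Poly_Mapping.single \<kappa> (sign v * x)"
        for \<kappa> :: weight and x :: int
      by (simp add: mult_single flip: single_of_int)
    ultimately show "Poly_Mapping.single (perm_act w \<mu>) (sign (w \<circ> inv v)) =
        of_int (sign v) * Poly_Mapping.single (perm_act w \<mu>) (sign w)"
      by simp
  qed
  finally show ?thesis by (simp add: alternant_def sum_distrib_left)
qed

lemma alternant_eq_0:
  assumes "a \<in> {1..n}" "b \<in> {1..n}" "a \<noteq> b" "Poly_Mapping.lookup \<mu> a = Poly_Mapping.lookup \<mu> b"
  shows "alternant n \<mu> = 0"
proof -
  let ?t = "Transposition.transpose a b"
  have t: "?t permutes {1..n}" using assms by (intro permutes_swap_id)
  have "perm_act ?t \<mu> = \<mu>"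
    by (rule poly_mapping_eqI) (use assms in \<open>auto simp: lookup_perm_act[OF t] transpose_def\<close>)
  then have "alternant n \<mu> = - alternant n \<mu>"
    using alternant_perm_act[OF t, of \<mu>] assms by (simp add: sign_swap_id)
  then have "Poly_Mapping.lookup (alternant n \<mu>) x = - Poly_Mapping.lookup (alternant n \<mu>) x" for x
    by (metis lookup_uminus)
  then have "Poly_Mapping.lookup (alternant n \<mu>) x = 0" for x by (metis equal_neg_zero)
  then show ?thesis by (intro poly_mapping_eqI) simp
qed

section \<open>Orbits and the pairing with \<delta>\<close>

definition orbit :: "nat \<Rightarrow> weight \<Rightarrow> weight set" where
  "orbit n \<mu> = (\<lambda>w. perm_act w \<mu>) ` {w. w permutes {1..n}}"

text \<open>The scalar product with \<delta>. It singles out the decreasing member of an orbit as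
  the maximum, and it is the cross term in the norm of \<mu> + \<delta>.\<close>

definition pairing :: "nat \<Rightarrow> weight \<Rightarrow> int" where
  "pairing n \<mu> = (\<Sum>i\<in>{1..n}. Poly_Mapping.lookup \<mu> i * int (n - i))"

lemma finite_orbit: "finite (orbit n \<mu>)"
  by (simp add: orbit_def finite_permutations)

lemma orbit_self: "\<mu> \<in> orbit n \<mu>"
  unfolding orbit_def by (rule image_eqI[of _ _ id]) (simp_all add: permutes_id)

lemma orbit_perm_act: "w permutes {1..n} \<Longrightarrow> \<nu> \<in> orbit n \<mu> \<Longrightarrow> perm_act w \<nu> \<in> orbit n \<mu>"
  unfolding orbit_def using perm_act_comp permutes_compose by (auto simp flip: perm_act_comp) blast

lemma orbit_weights: "\<mu> \<in> weights n \<Longrightarrow> \<nu> \<in> orbit n \<mu> \<Longrightarrow> \<nu> \<in> weights n"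
  by (auto simp: orbit_def perm_act_weights)

lemma pairing_swap:
  assumes "1 \<le> j" "j < n"
  shows "pairing n (perm_act (Transposition.transpose j (Suc j)) \<mu>) =
    pairing n \<mu> + Poly_Mapping.lookup \<mu> (Suc j) - Poly_Mapping.lookup \<mu> j"
proof -
  let ?t = "Transposition.transpose j (Suc j)"
  have t: "?t permutes {1..n}" using assms by (intro permutes_swap_id) auto
  have it: "inv ?t = ?t" by simp
  have "{1..n} = insert j (insert (Suc j) ({1..n} - {j, Suc j}))" using assms by auto
  then have split: "sum f {1..n} = f j + f (Suc j) + sum f ({1..n} - {j, Suc j})"
      for f :: "nat \<Rightarrow> int"
    by (metis (no_types, lifting) Diff_iff add.assoc finite_Diff finite_atLeastAtMost finite_insert
        insertCI
        insertE n_not_Suc_n sum.insert)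
  have "(\<Sum>i\<in>{1..n} - {j, Suc j}. Poly_Mapping.lookup (perm_act ?t \<mu>) i * int (n - i)) =
      (\<Sum>i\<in>{1..n} - {j, Suc j}. Poly_Mapping.lookup \<mu> i * int (n - i))"
    by (intro sum.cong) (auto simp: lookup_perm_act[OF t] it)
  moreover have "int (n - j) = int (n - Suc j) + 1" using assms by simp
  ultimately show ?thesis unfolding pairing_def split
    by (simp add: lookup_perm_act[OF t] it algebra_simps)
qed

definition weakly_decreasing :: "nat \<Rightarrow> weight \<Rightarrow> bool" where
  "weakly_decreasing n \<mu> \<longleftrightarrow> (\<forall>i\<in>{1..<n}. Poly_Mapping.lookup \<mu> (Suc i) \<le> Poly_Mapping.lookup \<mu> i)"

lemma dominant_iff: "\<mu> \<in> dominant n \<longleftrightarrow> \<mu> \<in> weights n \<and> weakly_decreasing n \<mu>"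
  by (simp add: dominant_def weakly_decreasing_def)

text \<open>At an ascent, exchanging the two neighbouring entries would increase the pairing by
  their difference.\<close>

lemma pairing_max_decreasing:
  assumes "\<nu> \<in> orbit n \<mu>" "\<And>\<kappa>. \<kappa> \<in> orbit n \<mu> \<Longrightarrow> pairing n \<kappa> \<le> pairing n \<nu>"
  shows "weakly_decreasing n \<nu>"
  unfolding weakly_decreasing_def
proof
  fix j assume j: "j \<in> {1..<n}"
  let ?t = "Transposition.transpose j (Suc j)"
  have "?t permutes {1..n}" using j by (intro permutes_swap_id) auto
  then have "pairing n (perm_act ?t \<nu>) \<le> pairing n \<nu>" using assms orbit_perm_act by blast
  then show "Poly_Mapping.lookup \<nu> (Suc j) \<le> Poly_Mapping.lookup \<nu> j"
    using pairing_swap[of j n \<nu>] j by simp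
qed

lemma pairing_max_exists:
  "\<exists>\<nu>\<in>orbit n \<mu>. \<forall>\<kappa>\<in>orbit n \<mu>. pairing n \<kappa> \<le> pairing n \<nu>"
proof -
  have "Max (pairing n ` orbit n \<mu>) \<in> pairing n ` orbit n \<mu>"
    using finite_orbit[of n \<mu>] orbit_self[of \<mu> n] by (intro Max_in) auto
  then obtain \<nu> where \<nu>: "\<nu> \<in> orbit n \<mu>" "pairing n \<nu> = Max (pairing n ` orbit n \<mu>)" by auto
  then have "pairing n \<kappa> \<le> pairing n \<nu>" if "\<kappa> \<in> orbit n \<mu>" for \<kappa>
    using that finite_orbit[of n \<mu>] by simp
  then show ?thesis using \<nu> by blast
qed

lemma weakly_decreasing_antimono:
  assumes "weakly_decreasing n \<mu>" "1 \<le> i" "i \<le> j" "j \<le> n"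
  shows "Poly_Mapping.lookup \<mu> j \<le> Poly_Mapping.lookup \<mu> i"
  using assms(3,4)
proof (induction j rule: dec_induct)
  case (step j)
  then have "Poly_Mapping.lookup \<mu> (Suc j) \<le> Poly_Mapping.lookup \<mu> j" using assms
      by (simp add: weakly_decreasing_def)
  then show ?case using step by simp
qed simp

lemma decreasing_orbit_unique:
  assumes "\<mu> \<in> weights n" "weakly_decreasing n \<mu>" "\<nu> \<in> orbit n \<mu>" "weakly_decreasing n \<nu>"
  shows "\<nu> = \<mu>"
proof -
  obtain w where w: "w permutes {1..n}" "\<nu> = perm_act w \<mu>" using assms(3) by (auto simp: orbit_def)
  \<comment> \<open>Entries are negated because \<open>sorted\<close> means increasing. Two sorted
    lists with the same multiset of entries coincide.\<close>
  let ?l = "\<lambda>\<kappa>. map (\<lambda>i. - Poly_Mapping.lookup \<kappa> i) [1..<Suc n]"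
  have so: "sorted (?l \<kappa>)" if "weakly_decreasing n \<kappa>" for \<kappa>
    unfolding sorted_wrt_map
  proof (rule sorted_wrt_mono_rel[where P = "(<)"])
    fix i j assume "i \<in> set [1..<Suc n]" "j \<in> set [1..<Suc n]" "i < j"
    then show "- Poly_Mapping.lookup \<kappa> i \<le> - Poly_Mapping.lookup \<kappa> j"
      using weakly_decreasing_antimono[OF that, of i j] by auto
  qed (simp del: upt_Suc)
  have l: "mset (?l \<kappa>) = image_mset (\<lambda>i. - Poly_Mapping.lookup \<kappa> i) (mset_set {1..n})" for \<kappa>
    by (simp add: mset_set_upto_eq_mset_upto atLeastLessThanSuc_atLeastAtMost[symmetric] del:
        upt_Suc)
  have "image_mset (inv w) (mset_set {1..n}) = mset_set (inv w ` {1..n})"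
    using permutes_inj_on[OF permutes_inv[OF w(1)]] by (rule image_mset_mset_set)
  also have "inv w ` {1..n} = {1..n}" using permutes_inv[OF w(1)] by (rule permutes_image)
  finally have "image_mset (\<lambda>i. - Poly_Mapping.lookup \<mu> i) (image_mset (inv w) (mset_set {1..n})) =
      image_mset (\<lambda>i. - Poly_Mapping.lookup \<mu> i) (mset_set {1..n})" by simp
  then have "mset (?l \<nu>) = mset (?l \<mu>)"
    unfolding l w(2) by (simp add: lookup_perm_act[OF w(1)] multiset.map_comp comp_def)
  then have "?l \<nu> = ?l \<mu>" using so assms properties_for_sort by metis
  then have "Poly_Mapping.lookup \<nu> i = Poly_Mapping.lookup \<mu> i" if "i \<in> {1..n}" for i
    using that by (auto simp del: upt_Suc)
  moreover have "\<nu> \<in> weights n" using assms orbit_weights by blast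
  ultimately show ?thesis using assms(1) unfolding weights_lookup by (intro poly_mapping_eqI) metis
qed

lemma pairing_less:
  assumes "\<mu> \<in> dominant n" "\<nu> \<in> orbit n \<mu>" "\<nu> \<noteq> \<mu>"
  shows "pairing n \<nu> < pairing n \<mu>"
proof -
  have m: "\<mu> \<in> weights n" "weakly_decreasing n \<mu>" using assms by (auto simp: dominant_iff)
  obtain \<kappa> where k: "\<kappa> \<in> orbit n \<mu>" "\<forall>\<kappa>'\<in>orbit n \<mu>. pairing n \<kappa>' \<le> pairing n \<kappa>"
    using pairing_max_exists by blast
  then have "\<kappa> = \<mu>" using decreasing_orbit_unique[OF m k(1)] pairing_max_decreasing by blast
  have "\<not> pairing n \<mu> \<le> pairing n \<nu>"
  proof
    assume "pairing n \<mu> \<le> pairing n \<nu>"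
    then have "weakly_decreasing n \<nu>"
      using k \<open>\<kappa> = \<mu>\<close> by (intro pairing_max_decreasing[OF assms(2)]) (meson order_trans)
    then show False using decreasing_orbit_unique[OF m assms(2)] assms(3) by blast
  qed
  then show ?thesis by simp
qed

text \<open>For each \<open>w\<close> the orbit sum may be rewritten with \<open>w\<gamma>\<close>
  in place of \<gamma>; then \<open>w\<close> acts on \<gamma> + \<delta> as a whole.\<close>

lemma orbit_sum_mult:
  "(\<Sum>\<gamma>\<in>orbit n \<mu>. Poly_Mapping.single \<gamma> 1) * alternant n (delta n) =
      (\<Sum>\<gamma>\<in>orbit n \<mu>. alternant n (\<gamma> + delta n))"
proof -
  let ?S = "{w. w permutes {1..n}}"
  have "(\<Sum>\<gamma>\<in>orbit n \<mu>. Poly_Mapping.single \<gamma> 1) * alternant n (delta n) =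
      (\<Sum>w\<in>?S. \<Sum>\<gamma>\<in>orbit n \<mu>. Poly_Mapping.single (\<gamma> + perm_act w (delta n)) (sign w))"
    unfolding alternant_def sum_product by (subst sum.swap) (simp add: mult_single)
  also have "\<dots> = (\<Sum>w\<in>?S. \<Sum>\<gamma>\<in>orbit n \<mu>. Poly_Mapping.single (perm_act w (\<gamma> + delta n)) (sign w))"
  proof (rule sum.cong[OF refl])
    fix w assume "w \<in> ?S"
    then have w: "w permutes {1..n}" by simp
    show "(\<Sum>\<gamma>\<in>orbit n \<mu>. Poly_Mapping.single (\<gamma> + perm_act w (delta n)) (sign w)) =
      (\<Sum>\<gamma>\<in>orbit n \<mu>. Poly_Mapping.single (perm_act w (\<gamma> + delta n)) (sign w))"
      by (rule sum.reindex_bij_witness[where i = "perm_act w" and j = "perm_act (inv w)"])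
        (use w perm_act_inverse[OF w] perm_act_inverse[OF permutes_inv[OF w]] in
          \<open>auto simp: perm_act_add[OF w] permutes_inv_inv[OF w]
            intro: orbit_perm_act[OF w] orbit_perm_act[OF permutes_inv[OF w]]\<close>)
  qed
  also have "\<dots> = (\<Sum>\<gamma>\<in>orbit n \<mu>. alternant n (\<gamma> + delta n))"
    unfolding alternant_def by (rule sum.swap)
  finally show ?thesis .
qed

definition norm2 :: "nat \<Rightarrow> weight \<Rightarrow> int" where
  "norm2 n \<mu> = (\<Sum>i\<in>{1..n}. Poly_Mapping.lookup \<mu> i ^ 2)"

lemma norm2_perm_act:
  assumes w: "w permutes {1..n}"
  shows "norm2 n (perm_act w \<mu>) = norm2 n \<mu>"
  using sum.permute[OF permutes_inv[OF w], of "\<lambda>i. Poly_Mapping.lookup \<mu> i ^ 2"]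
  by (simp add: norm2_def lookup_perm_act[OF w] comp_def)

lemma norm2_add_delta: "norm2 n (\<mu> + delta n) = norm2 n \<mu> + 2 * pairing n \<mu> + norm2 n (delta n)"
proof -
  have "norm2 n (\<mu> + delta n) = (\<Sum>i\<in>{1..n}. Poly_Mapping.lookup \<mu> i ^ 2 +
      2 * (Poly_Mapping.lookup \<mu> i * int (n - i)) + Poly_Mapping.lookup (delta n) i ^ 2)"
    unfolding norm2_def by (intro sum.cong refl) (simp add: lookup_add lookup_delta power2_sum)
  then show ?thesis by (simp add: norm2_def pairing_def sum.distrib sum_distrib_left)
qed

text \<open>Two equal neighbours kill the alternant. Otherwise the integer entries drop by at least
  1 at each place, as much as those of \<delta> do.\<close>

lemma strictly_decreasing_split:
  assumes "\<kappa> \<in> weights n" "weakly_decreasing n \<kappa>"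
  obtains "alternant n \<kappa> = 0" | \<xi> where "\<xi> \<in> dominant n" "\<kappa> = \<xi> + delta n"
proof (cases "\<exists>i\<in>{1..<n}. Poly_Mapping.lookup \<kappa> (Suc i) = Poly_Mapping.lookup \<kappa> i")
  case True
  then obtain i where "i \<in> {1..<n}" "Poly_Mapping.lookup \<kappa> (Suc i) = Poly_Mapping.lookup \<kappa> i"
      by blast
  then have "alternant n \<kappa> = 0" by (intro alternant_eq_0[of "Suc i" n i]) auto
  then show thesis by (rule that(1))
next
  case False
  have "weakly_decreasing n (\<kappa> - delta n)"
    unfolding weakly_decreasing_def
  proof
    fix i assume i: "i \<in> {1..<n}"
    then have "Poly_Mapping.lookup \<kappa> (Suc i) \<le> Poly_Mapping.lookup \<kappa> i"
      "Poly_Mapping.lookup \<kappa> (Suc i) \<noteq> Poly_Mapping.lookup \<kappa> i"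
      using assms False by (auto simp: weakly_decreasing_def)
    then show "Poly_Mapping.lookup (\<kappa> - delta n) (Suc i) \<le> Poly_Mapping.lookup (\<kappa> - delta n) i"
      using i by (auto simp: lookup_minus lookup_delta)
  qed
  then have "\<kappa> - delta n \<in> dominant n" using assms delta_weights
      by (simp add: dominant_iff weights_diff)
  then show thesis by (rule that(2)) simp
qed

text \<open>An orbit sum times \<open>a\<^sub>\<delta>\<close> is \<open>a\<^bsub>\<lambda>+\<delta>\<^esub>\<close> plus alternants whose index has smaller norm.\<close>

lemma alternant_divisible:
  assumes "\<kappa> \<in> weights n"
  shows "\<exists>f. f * alternant n (delta n) = alternant n \<kappa>"
  using assms
proof (induction "nat (norm2 n \<kappa>)" arbitrary: \<kappa> rule: less_induct)
  case less
  have "\<exists>\<nu>\<in>orbit n \<kappa>. \<forall>\<kappa>'\<in>orbit n \<kappa>. pairing n \<kappa>' \<le> pairing n \<nu>" by (rule pairing_max_exists)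
  then obtain \<nu> where \<nu>: "\<nu> \<in> orbit n \<kappa>" "weakly_decreasing n \<nu>" using pairing_max_decreasing
      by blast
  obtain w where w: "w permutes {1..n}" "\<nu> = perm_act w \<kappa>" using \<nu>(1) by (auto simp: orbit_def)
  have alt_eq: "alternant n \<kappa> = of_int (sign (inv w)) * alternant n \<nu>"
    using alternant_perm_act[OF permutes_inv[OF w(1)], of \<nu>] perm_act_inverse[OF w(1)] w(2) by simp
  have n\<nu>: "norm2 n \<nu> = norm2 n \<kappa>" using norm2_perm_act[OF w(1)] w(2) by simp
  have "\<exists>f. f * alternant n (delta n) = alternant n \<nu>"
  proof (rule strictly_decreasing_split[OF orbit_weights[OF less.prems \<nu>(1)] \<nu>(2)])
    assume "alternant n \<nu> = 0"
    then show ?thesis by (intro exI[of _ 0]) simp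
  next
    fix \<xi> assume l: "\<xi> \<in> dominant n" "\<nu> = \<xi> + delta n"
    \<comment> \<open>The norm is constant on the orbit, and \<xi> alone has the largest pairing
      with \<delta>. So \<gamma> + \<delta> has smaller norm than \<xi> + \<delta>, whose norm is
      that of \<kappa>.\<close>
    have "\<exists>f. f * alternant n (delta n) = alternant n (\<gamma> + delta n)" if g: "\<gamma> \<in> orbit n \<xi> - {\<xi>}"
        for \<gamma>
    proof (rule less.hyps)
      obtain v where "v permutes {1..n}" "\<gamma> = perm_act v \<xi>" using g by (auto simp: orbit_def)
      then have "norm2 n \<gamma> = norm2 n \<xi>" by (simp add: norm2_perm_act)
      moreover have "pairing n \<gamma> < pairing n \<xi>" using g l by (intro pairing_less) auto
      ultimately have "norm2 n (\<gamma> + delta n) < norm2 n \<kappa>"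
        using n\<nu> l by (simp add: norm2_add_delta)
      moreover have "0 \<le> norm2 n (\<gamma> + delta n)" by (simp add: norm2_def sum_nonneg)
      ultimately show "nat (norm2 n (\<gamma> + delta n)) < nat (norm2 n \<kappa>)" by simp
      show "\<gamma> + delta n \<in> weights n"
        using g l orbit_weights delta_weights by (intro weights_add) (auto simp: dominant_iff)
    qed
    then obtain h where h: "\<And>\<gamma>. \<gamma> \<in> orbit n \<xi> - {\<xi>} \<Longrightarrow> h \<gamma> * alternant n (delta n) =
        alternant n (\<gamma> + delta n)"
      by metis
    have "((\<Sum>\<gamma>\<in>orbit n \<xi>. Poly_Mapping.single \<gamma> 1) - (\<Sum>\<gamma>\<in>orbit n \<xi> - {\<xi>}. h \<gamma>)) * alternant n
        (delta n) =
        (\<Sum>\<gamma>\<in>orbit n \<xi>. alternant n (\<gamma> + delta n)) - (\<Sum>\<gamma>\<in>orbit n \<xi> - {\<xi>}. alternant n (\<gamma> + delta n))"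
      unfolding left_diff_distrib orbit_sum_mult
      by (rule arg_cong2[where f = "(-)", OF refl], unfold sum_distrib_right, intro sum.cong refl h)
    also have "\<dots> = alternant n \<nu>"
      using sum.remove[OF finite_orbit[of n \<xi>] orbit_self[of \<xi> n], of "\<lambda>\<gamma>. alternant n (\<gamma> +
          delta n)"] l by simp
    finally show ?thesis by blast
  qed
  then obtain f where "f * alternant n (delta n) = alternant n \<nu>" by blast
  then have "(of_int (sign (inv w)) * f) * alternant n (delta n) = alternant n \<kappa>"
    using alt_eq by (simp add: mult.assoc)
  then show ?case by blast
qed

section \<open>Reading off Schur coefficients\<close>

lemma schur_mult:
  assumes "\<mu> \<in> weights n"
  shows "schur n \<mu> * alternant n (delta n) = alternant n (\<mu> + delta n)"
proof -
  obtain f where "f * alternant n (delta n) = alternant n (\<mu> + delta n)"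
    using alternant_divisible weights_add[OF assms delta_weights] by blast
  then show ?thesis using schur_eqI by metis
qed

lemma dominant_add_delta_less:
  assumes "\<mu> \<in> dominant n" "1 \<le> i" "i < j" "j \<le> n"
  shows "Poly_Mapping.lookup (\<mu> + delta n) j < Poly_Mapping.lookup (\<mu> + delta n) i"
  using weakly_decreasing_antimono[of n \<mu> i j] assms
  by (auto simp: dominant_iff lookup_add lookup_delta)

text \<open>A strictly decreasing weight has trivial stabiliser and is the only weakly decreasing
  weight in its orbit.\<close>

lemma lookup_alternant_dominant:
  assumes "\<mu> \<in> dominant n" "\<nu> \<in> dominant n"
  shows "Poly_Mapping.lookup (alternant n (\<mu> + delta n)) (\<nu> + delta n) = (if \<mu> = \<nu> then 1 else 0)"
proof -
  have "perm_act w (\<mu> + delta n) = \<nu> + delta n \<longleftrightarrow> w = id \<and> \<mu> = \<nu>" if w: "w permutes {1..n}" for w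
  proof
    assume e: "perm_act w (\<mu> + delta n) = \<nu> + delta n"
    have wd: "weakly_decreasing n (\<kappa> + delta n)" if "\<kappa> \<in> dominant n" for \<kappa>
      using dominant_add_delta_less[OF that] by (auto simp: weakly_decreasing_def intro!:
          less_imp_le)
    have "\<nu> + delta n \<in> orbit n (\<mu> + delta n)" using w e unfolding orbit_def
        by (intro image_eqI[of _ _ w]) auto
    then have "\<nu> + delta n = \<mu> + delta n"
      using assms wd delta_weights by (intro decreasing_orbit_unique) (auto simp: dominant_iff
          weights_add)
    then have mn: "\<mu> = \<nu>" by simp
    have "inv w i = i" for i
    proof (cases "i \<in> {1..n}")
      case True
      then have iw: "inv w i \<in> {1..n}" using permutes_in_image[OF permutes_inv[OF w]] by blast
      have "Poly_Mapping.lookup (\<mu> + delta n) (inv w i) = Poly_Mapping.lookup (\<mu> + delta n) i"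
        using e mn by (metis lookup_perm_act w)
      then show ?thesis
        using dominant_add_delta_less[OF assms(1), of "inv w i" i] dominant_add_delta_less[OF
            assms(1), of i "inv w i"] iw True
        by (cases "inv w i" i rule: linorder_cases) auto
    qed (use permutes_not_in[OF permutes_inv[OF w]] in blast)
    then have "inv w = id" by auto
    then show "w = id \<and> \<mu> = \<nu>" using mn by (metis inv_id permutes_inv_inv w)
  qed simp
  then have "Poly_Mapping.lookup (alternant n (\<mu> + delta n)) (\<nu> + delta n) =
      (\<Sum>w | w permutes {1..n}. if w = id then (if \<mu> = \<nu> then 1 else 0) else 0)"
    unfolding alternant_def lookup_sum by (intro sum.cong refl) (auto simp: lookup_single when_def)
  then show ?thesis by (simp add: finite_permutations permutes_id)
qed

lemma lookup_of_int_mult: "Poly_Mapping.lookup (of_int c * (f :: laurent)) x =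
    c * Poly_Mapping.lookup f x"
proof (induction c rule: int_induct[where k = 0])
  case (step1 i)
  then show ?case by (simp add: distrib_right lookup_add)
next
  case (step2 i)
  then show ?case by (simp add: left_diff_distrib lookup_minus)
qed simp

lemma lookup_lin: "Poly_Mapping.lookup (lin f p :: laurent) x = lin (\<lambda>\<nu>. Poly_Mapping.lookup (f \<nu>)
    x) p"
  by (simp add: lin_def lookup_sum lookup_of_int_mult)

lemma lin_schur_mult:
  assumes "Poly_Mapping.keys p \<subseteq> weights n"
  shows "lin (schur n) p * alternant n (delta n) = lin (\<lambda>\<nu>. alternant n (\<nu> + delta n)) p"
  unfolding lin_def sum_distrib_right
  using assms schur_mult by (intro sum.cong refl) (auto simp: mult.assoc)

text \<open>After multiplication by \<open>a_\<delta>\<close> each \<open>s_\<nu>\<close>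
  contributes a single monomial whose exponent is a dominant weight plus \<delta>, namely \<nu> +
  \<delta>.\<close>

lemma lookup_lin_schur:
  assumes "Poly_Mapping.keys c \<subseteq> dominant n" "\<xi> \<in> dominant n"
  shows "Poly_Mapping.lookup (lin (schur n) c * alternant n (delta n)) (\<xi> + delta n) =
      Poly_Mapping.lookup c \<xi>"
proof -
  have "Poly_Mapping.lookup (lin (schur n) c * alternant n (delta n)) (\<xi> + delta n) =
      lin (\<lambda>\<nu>. Poly_Mapping.lookup (alternant n (\<nu> + delta n)) (\<xi> + delta n)) c"
    using assms by (subst lin_schur_mult) (auto simp: dominant_iff lookup_lin)
  also have "\<dots> = (\<Sum>\<nu>\<in>Poly_Mapping.keys c. Poly_Mapping.lookup c \<nu> * (if \<nu> = \<xi> then 1 else 0))"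
    unfolding lin_def using assms by (intro sum.cong refl) (auto simp: lookup_alternant_dominant)
  also have "\<dots> = (\<Sum>\<nu>\<in>Poly_Mapping.keys c. if \<nu> = \<xi> then Poly_Mapping.lookup c \<xi> else 0)"
    by (intro sum.cong refl) auto
  also have "\<dots> = Poly_Mapping.lookup c \<xi>" by (simp add: in_keys_iff)
  finally show ?thesis .
qed

lemma schur_straighten:
  assumes "\<mu> \<in> weights n"
  shows "\<exists>c. Poly_Mapping.keys c \<subseteq> dominant n \<and> schur n \<mu> = lin (schur n) c"
proof -
  have "\<exists>\<nu>\<in>orbit n (\<mu> + delta n). \<forall>\<kappa>'\<in>orbit n (\<mu> + delta n). pairing n \<kappa>' \<le> pairing n \<nu>"
      by (rule pairing_max_exists)
  then obtain \<nu> where \<nu>: "\<nu> \<in> orbit n (\<mu> + delta n)" "weakly_decreasing n \<nu>"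
      using pairing_max_decreasing by blast
  obtain w where w: "w permutes {1..n}" "\<nu> = perm_act w (\<mu> + delta n)" using \<nu>(1)
      by (auto simp: orbit_def)
  have alt_eq: "alternant n (\<mu> + delta n) = of_int (sign (inv w)) * alternant n \<nu>"
    using alternant_perm_act[OF permutes_inv[OF w(1)], of \<nu>] perm_act_inverse[OF w(1)] w(2) by simp
  have "\<nu> \<in> weights n" using orbit_weights[OF weights_add[OF assms delta_weights] \<nu>(1)] .
  then show ?thesis using \<nu>(2)
  proof (rule strictly_decreasing_split)
    assume "alternant n \<nu> = 0"
    then have "schur n \<mu> = 0" using alt_eq by (intro schur_eqI) simp
    then show ?thesis by (intro exI[of _ 0]) simp
  next
    fix \<xi> assume l: "\<xi> \<in> dominant n" "\<nu> = \<xi> + delta n"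
    have "schur n \<mu> = of_int (sign (inv w)) * schur n \<xi>"
      using alt_eq l schur_mult[of \<xi> n] by (intro schur_eqI) (simp add: mult.assoc dominant_iff)
    then show ?thesis using l by (intro exI[of _ "Poly_Mapping.single \<xi> (sign (inv w))"]) auto
  qed
qed

lemma lin_schur_straighten:
  assumes "Poly_Mapping.keys p \<subseteq> weights n"
  shows "\<exists>c. Poly_Mapping.keys c \<subseteq> dominant n \<and> lin (schur n) p = lin (schur n) c"
  using assms
proof (induction p rule: frag_induction)
  case zero
  show ?case by (intro exI[of _ 0]) simp
next
  case (one \<mu>)
  then show ?case using schur_straighten by simp
next
  case (diff p q)
  then obtain c d where c: "Poly_Mapping.keys c \<subseteq> dominant n" "lin (schur n) p = lin (schur n) c"
    and d: "Poly_Mapping.keys d \<subseteq> dominant n" "lin (schur n) q = lin (schur n) d" by blast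
  have "Poly_Mapping.keys (c - d) \<subseteq> dominant n" using keys_diff[of c d] c d by blast
  then show ?case using c d by (intro exI[of _ "c - d"]) (simp add: lin_minus)
qed

text \<open>Reading off the monomial \<xi> + \<delta> is linear and works for symbols of arbitrary
  index. Straightening serves only to show that the definite description in
  \<open>schur_coeff\<close> denotes something; uniqueness comes from
  \<open>lookup_lin_schur\<close>.\<close>

lemma schur_coeff_lin:
  assumes p: "Poly_Mapping.keys p \<subseteq> weights n" and l: "\<xi> \<in> dominant n"
  shows "schur_coeff n (lin (schur n) p) \<xi> =
    lin (\<lambda>\<nu>. Poly_Mapping.lookup (alternant n (\<nu> + delta n)) (\<xi> + delta n)) p"
proof -
  obtain c where c: "Poly_Mapping.keys c \<subseteq> dominant n" "lin (schur n) p = lin (schur n) c"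
    using lin_schur_straighten[OF p] by blast
  have unique: "c' = c" if "Poly_Mapping.keys c' \<subseteq> dominant n" "lin (schur n) p = lin (schur n) c'"
      for c'
  proof (rule poly_mapping_eqI)
    fix \<nu>
    show "Poly_Mapping.lookup c' \<nu> = Poly_Mapping.lookup c \<nu>"
    proof (cases "\<nu> \<in> dominant n")
      case True
      then show ?thesis using lookup_lin_schur[of c n \<nu>] lookup_lin_schur[of c' n \<nu>] c that by simp
    next
      case False
      then have "\<nu> \<notin> Poly_Mapping.keys c" "\<nu> \<notin> Poly_Mapping.keys c'" using c that by auto
      then show ?thesis by (simp add: in_keys_iff)
    qed
  qed
  have "(THE c. Poly_Mapping.keys c \<subseteq> dominant n \<and> lin (schur n) p = lin (schur n) c) = c"
    using c unique by (intro the_equality) blast+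
  then have "schur_coeff n (lin (schur n) p) \<xi> = Poly_Mapping.lookup c \<xi>"
    unfolding schur_coeff_def lin_def[of "schur n", symmetric] by simp
  also have "\<dots> = Poly_Mapping.lookup (lin (schur n) p * alternant n (delta n)) (\<xi> + delta n)"
    using lookup_lin_schur[OF c(1) l] c(2) by simp
  finally show ?thesis using p by (simp add: lin_schur_mult lookup_lin)
qed

section \<open>Tableaux and charge in terms of lists of rows\<close>

definition shape_weight :: "nat \<Rightarrow> nat list list \<Rightarrow> weight" where
  "shape_weight n L = (\<Sum>i\<in>{1..n}. Poly_Mapping.single i (int (sh L (i - 1))))"

lemma lookup_shape_weight:
  "Poly_Mapping.lookup (shape_weight n L) i = (if i \<in> {1..n} then int (sh L (i - 1)) else 0)"
  by (simp add: shape_weight_def lookup_sum lookup_single when_def)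

lemma shape_weight_partitions:
  assumes "tab L"
  shows "shape_weight n L \<in> partitions n"
proof -
  have "sh L i \<le> sh L (i - 1)" for i using assms by (intro wtab_sh_mono tab_wtab) auto
  then show ?thesis
    by (auto simp: partitions_def dominant_iff weights_lookup weakly_decreasing_def
        lookup_shape_weight)
qed

lemma diagram_shape_weight:
  assumes "length L \<le> n"
  shows "diagram (shape_weight n L) = shape_set L"
proof -
  have "sh L (r - 1) = 0" if "n < r" for r using assms that by (intro sh_eq_0) simp
  then have "(r, c) \<in> diagram (shape_weight n L) \<longleftrightarrow> (r, c) \<in> shape_set L" for r c
    by (cases "n < r") (auto simp: diagram_def shape_set_def lookup_shape_weight)
  then show ?thesis by (intro set_eqI) (metis surj_pair)
qed

lemma down_closed_diagram:
  assumes "lam \<in> partitions n"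
  shows "down_closed (diagram lam)"
  unfolding down_closed_def diagram_def
proof (safe, goal_cases)
  case (1 r c)
  then have "Poly_Mapping.lookup lam r \<noteq> 0" by auto
  then show ?case using assms by (auto simp: partitions_def dominant_iff weights_lookup)
next
  case (2 r c r' c')
  then have "Poly_Mapping.lookup lam r \<noteq> 0" by auto
  then have "r \<le> n" using assms by (auto simp: partitions_def dominant_iff weights_lookup)
  then have "Poly_Mapping.lookup lam r \<le> Poly_Mapping.lookup lam r'"
    using assms 2 by (intro weakly_decreasing_antimono[of n]) (auto simp: partitions_def
        dominant_iff)
  then show ?case using 2 by simp
qed

lemma tableaux_of_shape_iff:
  assumes lam: "lam \<in> partitions n"
  shows "T \<in> tableaux_of_shape n lam \<longleftrightarrow>
    (\<exists>L. tab L \<and> set (word L) \<subseteq> {1..n} \<and> shape_weight n L = lam \<and> T = tab_map L)"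
proof
  assume T: "T \<in> tableaux_of_shape n lam"
  then have dT: "dom T = diagram lam" and ran: "ran T \<subseteq> {1..n}" and cs: "column_strict T"
    by (auto simp: tableaux_of_shape_def)
  have "finite ((\<lambda>(r, c). r + c) ` diagram lam)" by (intro finite_imageI finite_diagram)
  then obtain N where "\<forall>x\<in>(\<lambda>(r, c). r + c) ` diagram lam. x < N"
      by (metis finite_nat_set_iff_bounded)
  then have "diagram lam \<subseteq> {..<Suc N} \<times> {..<Suc N}" by fastforce
  \<comment> \<open>A straight tableau is a skew one with empty inner shape, so the conversion made
    for rectification applies.\<close>
  then have "skew (Suc N) {} T"
    using dT cs down_closed_diagram[OF lam] by (auto simp: skew_def down_closed_def[of "{}"])
  then obtain L where L: "tab L" "T = tab_map L" using straight_tab_map[of "Suc N" T] by auto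
  have letters: "set (word L) \<subseteq> {1..n}" using ran L ran_tab_map by simp
  then have "length L \<le> n" using tab_length_le[OF L(1), of 1 n] by simp
  then have "diagram (shape_weight n L) = diagram lam" using dT L dom_tab_map diagram_shape_weight
      by simp
  \<comment> \<open>A partition is recovered from its diagram by counting boxes row by row.\<close>
  moreover have "\<kappa> = lam" if d: "diagram \<kappa> = diagram lam" "\<kappa> \<in> partitions n" for \<kappa>
  proof (rule poly_mapping_eqI)
    fix r
    have nonneg: "0 \<le> Poly_Mapping.lookup \<nu> r" if "\<nu> \<in> partitions n" for \<nu>
      using that by (cases "r \<in> {1..n}") (auto simp: partitions_def dominant_iff weights_lookup)
    have "Poly_Mapping.lookup \<nu> r = int (card {c. (r, c) \<in> diagram \<nu>})" if "\<nu> \<in> partitions n" for \<nu>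
    proof -
      have "{c. (r, c) \<in> diagram \<nu>} = {1..nat (Poly_Mapping.lookup \<nu> r)}"
        by (auto simp: diagram_def)
      then show ?thesis using nonneg[OF that] by simp
    qed
    then show "Poly_Mapping.lookup \<kappa> r = Poly_Mapping.lookup lam r" using d lam by simp
  qed
  ultimately show "\<exists>L. tab L \<and> set (word L) \<subseteq> {1..n} \<and> shape_weight n L = lam \<and> T = tab_map L"
    using L letters shape_weight_partitions by blast
next
  assume "\<exists>L. tab L \<and> set (word L) \<subseteq> {1..n} \<and> shape_weight n L = lam \<and> T = tab_map L"
  then obtain L where L: "tab L" "set (word L) \<subseteq> {1..n}" "shape_weight n L = lam" "T = tab_map L"
      by blast
  have "length L \<le> n" using tab_length_le[OF L(1,2)] by simp
  then show "T \<in> tableaux_of_shape n lam"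
    using L diagram_shape_weight dom_tab_map ran_tab_map column_strict_tab_map[OF tab_wtab[OF L(1)]]
    by (auto simp: tableaux_of_shape_def)
qed

lemma tab_map_tableaux: "tab L \<Longrightarrow> set (word L) \<subseteq> {1..n} \<Longrightarrow> tab_map L \<in> tableaux n"
  using tableaux_of_shape_iff[of "shape_weight n L" n "tab_map L"] shape_weight_partitions[of L n]
  unfolding tableaux_def by blast

lemma tableaux_of_shape_weight_eq:
  assumes "lam \<in> partitions n" and m: "\<And>j. j \<in> {1..n} \<Longrightarrow> Poly_Mapping.lookup \<mu> j = int (m j)"
  shows "tableaux_of_shape_weight n lam \<mu> = tab_map ` {L \<in> weight_tabs n m 1. shape_weight n L =
      lam}"
proof -
  have "T \<in> tableaux_of_shape_weight n lam \<mu> \<longleftrightarrow> (\<exists>L. L \<in> weight_tabs n m 1 \<and>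
      shape_weight n L = lam \<and> T = tab_map L)" for T
    unfolding tableaux_of_shape_weight_def weight_tabs_def weight_words_def mem_Collect_eq
      tableaux_of_shape_iff[OF assms(1)]
    using m by (auto simp: wt_tab_map)
  then show ?thesis by blast
qed

lemma tableaux_ge_tab_map:
  assumes m: "\<And>j. j \<in> {1..<n} \<Longrightarrow> m (Suc j) \<le> m j" and "1 \<le> i" "L \<in> weight_tabs n m i"
  shows "tab_map L \<in> tableaux_ge n i"
proof -
  have L: "tab L" "set (word L) \<subseteq> {i..n}" "\<And>j. j \<in> {i..n} \<Longrightarrow> count_list (word L) j = m j"
    using assms(3) by (auto simp: weight_tabs_def weight_words_def)
  have "set (word L) \<subseteq> {1..n}" using L(2) assms(2) by auto
  then have "tab_map L \<in> tableaux n" using L(1) by (intro tab_map_tableaux)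
  moreover have "count_list (word L) j = 0" if "j < i" for j
    using L(2) that by (auto simp: count_list_0_iff)
  moreover have "count_list (word L) (Suc j) \<le> count_list (word L) j" if "j \<in> {i..<n}" for j
    using L(3)[of j] L(3)[of "Suc j"] m[of j] that assms(2) by auto
  ultimately show ?thesis by (auto simp: tableaux_ge_def wt_tab_map)
qed

text \<open>A word \<open>w\<close> may be replaced by \<open>word (ptab w)\<close>, which turns the
  rotation of \<open>x # w\<close> into a cyclage of tableaux. That \<open>m\<close> decreases
  weakly supplies the memberships in \<open>tableaux_ge\<close>.\<close>

lemma list_charge_tab_map:
  assumes "charge n ch" and m: "\<And>j. j \<in> {1..<n} \<Longrightarrow> m (Suc j) \<le> m j"
  shows "list_charge n m (\<lambda>L. ch (tab_map L))"
proof
  interpret charge n ch by fact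
  fix i L assume i: "1 \<le> i" "i \<le> n" and L: "L \<in> weight_tabs n m (Suc i)"
  have t: "tab L" using L by (simp add: weight_tabs_def)
  have s: "tab_map L \<star> one_row i (m i) = tab_map (ptab (word L @ replicate (m i) i))"
    by (rule plactic_one_row(1)[OF t])
  have "word L @ replicate (m i) i \<in> weight_words n m i"
  proof -
    have W: "set (word L) \<subseteq> {Suc i..n}" "\<And>j. j \<in> {Suc i..n} \<Longrightarrow> count_list (word L) j = m j"
      using L by (auto simp: weight_tabs_def weight_words_def)
    have "count_list (word L) i = 0" using W(1) by (auto simp: count_list_0_iff)
    moreover have "count_list (replicate (m i) i) j = (if j = i then m i else 0)" for j
      by (simp add: count_list_mset)
    ultimately have "count_list (word L @ replicate (m i) i) j = m j" if "j \<in> {i..n}" for j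
      using that W(2)[of j] by (cases "j = i") auto
    then show ?thesis using W(1) i by (auto simp: weight_words_def)
  qed
  then have "tab_map L \<star> one_row i (m i) \<in> tableaux_ge n i"
    unfolding s using m i by (intro tableaux_ge_tab_map ptab_weight_tabs)
  moreover have "tab_map L \<in> tableaux_ge n (i + 1)"
    unfolding Suc_eq_plus1[symmetric] using m L by (intro tableaux_ge_tab_map) auto
  ultimately show "ch (tab_map (ptab (word L @ replicate (m i) i))) = ch (tab_map L)"
    using charge_row[OF i] s by metis
next
  interpret charge n ch by fact
  fix i x w assume i: "1 \<le> i" "i \<le> n" and x: "x \<noteq> i" and w: "x # w \<in> weight_words n m i"
  have sub: "set (x # w) \<subseteq> {i..n}" using w by (simp add: weight_words_def)
  have wT: "word (ptab w) @ [x] \<approx> w @ [x]" "[x] @ word (ptab w) \<approx> [x] @ w"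
    by (intro knuth_append word_ptab knuth_refl)+
  have T: "tab_map (ptab w) \<star> letter x = tab_map (ptab (w @ [x]))"
    "letter x \<star> tab_map (ptab w) = tab_map (ptab (x # w))"
    using plactic_one_row(1)[OF tab_ptab, of w x 1] plactic_one_row(2)[OF tab_ptab, of x 1 w]
      ptab_cong[OF wT(1)] ptab_cong[OF wT(2)] by simp_all
  have "tab_map (ptab w) \<in> tableaux n"
    using sub i by (intro tab_map_tableaux) (auto simp: set_ptab)
  moreover have "letter x \<star> tab_map (ptab w) \<in> tableaux_ge n i"
    unfolding T(2) using m i w by (intro tableaux_ge_tab_map ptab_weight_tabs)
  moreover have "1 \<le> x" "x \<le> n" using sub i by auto
  ultimately show "ch (tab_map (ptab (w @ [x]))) = Suc (ch (tab_map (ptab (x # w))))"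
    using charge_cyclage[OF i _ _ x, of "tab_map (ptab w)"] unfolding T by simp
qed

section \<open>Kostka-Foulkes polynomials as signed sums\<close>

text \<open>The coefficient of \<open>x^(\<lambda>+\<delta>)\<close> in the alternant of \<beta>,
  extended to all sequences \<beta>, so that translations and transpositions of the argument can be
  formed freely.\<close>

definition signed_coeff :: "nat \<Rightarrow> weight \<Rightarrow> (nat \<Rightarrow> int) \<Rightarrow> int" where
  "signed_coeff n lam \<beta> = (\<Sum>w | w permutes {1..n}.
     if \<forall>j\<in>{1..n}. \<beta> (inv w j) = shifted n lam j then sign w else 0)"

lemma lookup_alternant:
  assumes "\<nu> \<in> weights n" "lam \<in> weights n"
  shows "Poly_Mapping.lookup (alternant n (\<nu> + delta n)) (lam + delta n) =
      signed_coeff n lam (shifted n \<nu>)"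
  unfolding alternant_def signed_coeff_def lookup_sum
proof (rule sum.cong[OF refl])
  fix w assume "w \<in> {w. w permutes {1..n}}"
  then have w: "w permutes {1..n}" by simp
  have W: "perm_act w (\<nu> + delta n) \<in> weights n" "lam + delta n \<in> weights n"
    using assms by (simp_all only: perm_act_weights[OF w] weights_add delta_weights)
  have "perm_act w (\<nu> + delta n) = lam + delta n \<longleftrightarrow>
      (\<forall>j\<in>{1..n}. Poly_Mapping.lookup (perm_act w (\<nu> + delta n)) j = Poly_Mapping.lookup (lam +
          delta n) j)"
    using W unfolding weights_lookup by (metis poly_mapping_eqI)
  also have "\<dots> \<longleftrightarrow> (\<forall>j\<in>{1..n}. shifted n \<nu> (inv w j) = shifted n lam j)"
    by (simp add: lookup_perm_act[OF w] shifted_def lookup_add)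
  finally show "Poly_Mapping.lookup (Poly_Mapping.single (perm_act w (\<nu> +
      delta n)) (sign w)) (lam + delta n) =
      (if \<forall>j\<in>{1..n}. shifted n \<nu> (inv w j) = shifted n lam j then sign w else 0)"
    by (simp add: lookup_single when_def)
qed

lemma alternating_signed_coeff: "alternating n 1 (signed_coeff n lam)"
  unfolding alternating_def
proof (intro ballI allI impI)
  fix a c \<beta> assume ac: "a \<in> {1..n}" "c \<in> {1..n}" "a \<noteq> c"
  let ?t = "Transposition.transpose a c"
  have t: "?t permutes {1..n}" using ac by (intro permutes_swap_id)
  have tt: "w \<circ> ?t \<circ> ?t = w" for w :: "nat \<Rightarrow> nat" by (simp add: fun_eq_iff)
  have iw: "inv (w \<circ> ?t) = ?t \<circ> inv w" if "w permutes {1..n}" for w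
    using o_inv_distrib[of w ?t] permutes_bij[OF that] permutes_bij[OF t] by simp
  have sg: "sign (w \<circ> ?t) = - sign w" if "w permutes {1..n}" for w
  proof -
    have "permutation w" "permutation ?t" using that t
        by (auto intro: permutation_permutes[THEN iffD2])
    then show ?thesis using ac by (simp add: sign_compose sign_swap_id)
  qed
  have "signed_coeff n lam (\<beta> \<circ> ?t) = (\<Sum>w | w permutes {1..n}.
      if \<forall>j\<in>{1..n}. \<beta> (inv w j) = shifted n lam j then - sign w else 0)"
    unfolding signed_coeff_def
  proof (rule sum.reindex_bij_witness[where i = "\<lambda>w. w \<circ> ?t" and j = "\<lambda>w. w \<circ> ?t"])
    fix w assume "w \<in> {w. w permutes {1..n}}"
    then have w: "w permutes {1..n}" by simp
    show "w \<circ> ?t \<in> {w. w permutes {1..n}}" using permutes_compose[OF t w] by simp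
    show "(if \<forall>j\<in>{1..n}. \<beta> (inv (w \<circ> ?t) j) = shifted n lam j then - sign (w \<circ> ?t) else 0) =
      (if \<forall>j\<in>{1..n}. (\<beta> \<circ> ?t) (inv w j) = shifted n lam j then sign w else 0)"
      unfolding iw[OF w] sg[OF w] by simp
  qed (use tt permutes_compose[OF t] in auto)
  also have "\<dots> = - signed_coeff n lam \<beta>"
    unfolding signed_coeff_def sum_negf[symmetric] by (intro sum.cong) auto
  finally show "signed_coeff n lam (\<beta> \<circ> ?t) = - signed_coeff n lam \<beta>" .
qed

text \<open>\<lambda> + \<delta> has no negative coordinate, so no rearrangement of such a \<beta>
  equals it.\<close>

lemma vanishing_signed_coeff:
  assumes "lam \<in> partitions n"
  shows "vanishing n 1 (signed_coeff n lam)"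
  unfolding vanishing_def signed_coeff_def
proof (intro allI impI sum.neutral ballI)
  fix \<beta> w assume "\<exists>j\<in>{1..n}. \<beta> j < (0::int)" "w \<in> {w. w permutes {1..n}}"
  then obtain j where j: "j \<in> {1..n}" "\<beta> j < 0" and w: "w permutes {1..n}" by auto
  have wj: "w j \<in> {1..n}" using j permutes_in_image[OF w] by simp
  then have "0 \<le> Poly_Mapping.lookup lam (w j)" using assms by (auto simp: partitions_def)
  then have "0 \<le> shifted n lam (w j)" by (simp add: shifted_def lookup_delta)
  moreover have "inv w (w j) = j" by (rule permutes_inverses(2)[OF w])
  ultimately have "\<beta> (inv w (w j)) \<noteq> shifted n lam (w j)" using j by simp
  then have "\<not> (\<forall>j\<in>{1..n}. \<beta> (inv w j) = shifted n lam j)" using wj by blast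
  then show "(if \<forall>j\<in>{1..n}. \<beta> (inv w j) = shifted n lam j then sign w else 0) = 0" by simp
qed

section \<open>Support of the formal symbols\<close>

definition fps_weights :: "nat \<Rightarrow> (weight \<Rightarrow>\<^sub>0 int) fps \<Rightarrow> bool" where
  "fps_weights n f \<longleftrightarrow> (\<forall>k. Poly_Mapping.keys (fps_nth f k) \<subseteq> weights n)"

lemma keys_mult_weights:
  "Poly_Mapping.keys p \<subseteq> weights n \<Longrightarrow> Poly_Mapping.keys q \<subseteq> weights n \<Longrightarrow>
    Poly_Mapping.keys (p * q :: weight \<Rightarrow>\<^sub>0 int) \<subseteq> weights n"
  using keys_mult[of p q] weights_add by fastforce

lemma keys_sum_weights:
  "(\<And>x. x \<in> A \<Longrightarrow> Poly_Mapping.keys (g x) \<subseteq> weights n) \<Longrightarrow>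
    Poly_Mapping.keys (\<Sum>x\<in>A. g x :: weight \<Rightarrow>\<^sub>0 int) \<subseteq> weights n"
proof (induction A rule: infinite_finite_induct)
  case (insert x A)
  then have "Poly_Mapping.keys (g x + sum g A) \<subseteq> weights n"
    using Poly_Mapping.keys_add[of "g x" "sum g A"] by blast
  then show ?case using insert by simp
qed simp_all

lemma fps_weights_mult: "fps_weights n f \<Longrightarrow> fps_weights n g \<Longrightarrow> fps_weights n (f * g)"
  unfolding fps_weights_def fps_mult_nth by (intro allI keys_sum_weights keys_mult_weights) auto

lemma fps_weights_prod: "(\<And>x. x \<in> A \<Longrightarrow> fps_weights n (f x)) \<Longrightarrow> fps_weights n (\<Prod>x\<in>A. f x)"
proof (induction A rule: infinite_finite_induct)
  have "fps_weights n 1" by (auto simp: fps_weights_def weights_lookup simp flip: single_one)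
  then show "fps_weights n (prod f A)" if "infinite A" for A using that by simp
  show "fps_weights n (prod f {})" using \<open>fps_weights n 1\<close> by simp
qed (simp add: fps_weights_mult)

text \<open>All symbols that occur have their index in \<open>weights n\<close>, where
  \<open>schur_mult\<close> guarantees that the quotient exists.\<close>

lemma keys_raised:
  assumes "\<mu> \<in> weights n"
  shows "Poly_Mapping.keys (fps_nth (raised n \<mu> 1) k) \<subseteq> weights n"
proof -
  have "fps_weights n (raising_geom a b)" if "(a, b) \<in> index_pairs n 1" for a b
  proof -
    have "Poly_Mapping.single a x - Poly_Mapping.single b x \<in> weights n" for x
      using that by (auto simp: weights_lookup index_pairs_def lookup_minus lookup_single when_def)
    then show ?thesis by (simp add: fps_weights_def raising_geom_def raising_monom_power)
  qed
  then have "fps_weights n (\<Prod>(a, b)\<in>index_pairs n 1. raising_geom a b)"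
    by (intro fps_weights_prod) auto
  moreover have "fps_weights n (fps_const (Poly_Mapping.single \<mu> 1))"
    using assms by (simp add: fps_weights_def)
  ultimately show ?thesis using fps_weights_mult unfolding raised_def fps_weights_def by blast
qed

lemma kostka_foulkes_nth:
  assumes "\<mu> \<in> weights n" "lam \<in> dominant n"
  shows "fps_nth (kostka_foulkes n lam \<mu>) k = eval_at n (signed_coeff n lam) (fps_nth (raised n \<mu>
      1) k)"
proof -
  have "index_pairs n 1 = {(i, j). 1 \<le> i \<and> i < j \<and> j \<le> n}" by (simp add: index_pairs_def)
  then have "fps_nth (kostka_foulkes n lam \<mu>) k = schur_coeff n (lin (schur n) (fps_nth (raised n \<mu>
      1) k)) lam"
    by (simp add: kostka_foulkes_def hall_littlewood_Q_def eval_schur_def lin_def raised_def)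
  also have "\<dots> = lin (\<lambda>\<nu>. Poly_Mapping.lookup (alternant n (\<nu> + delta n)) (lam +
      delta n)) (fps_nth (raised n \<mu> 1) k)"
    using assms by (intro schur_coeff_lin keys_raised)
  also have "\<dots> = eval_at n (signed_coeff n lam) (fps_nth (raised n \<mu> 1) k)"
    unfolding eval_at_def lin_def using assms keys_raised[OF assms(1), of k]
    by (intro sum.cong refl) (auto simp: lookup_alternant dominant_iff subset_iff)
  finally show ?thesis .
qed

theorem theorem4p12:
  fixes n :: nat and lam \<mu> :: weight and ch :: "tableau \<Rightarrow> nat"
  assumes "n \<ge> 1"
    and "lam \<in> partitions n"
    and "\<mu> \<in> partitions n"
    and "charge n ch"
  shows "kostka_foulkes n lam \<mu> =
    fps_of_poly (\<Sum>b\<in>tableaux_of_shape_weight n lam \<mu>. monom 1 (ch b))"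
proof (rule fps_ext)
  fix k
  define m where "m j = nat (Poly_Mapping.lookup \<mu> j)" for j
  define c where "c L = ch (tab_map L)" for L
  have lam: "lam \<in> dominant n" and mu: "\<mu> \<in> weights n" using assms
      by (auto simp: partitions_def dominant_iff)
  have m: "Poly_Mapping.lookup \<mu> j = int (m j)" if "j \<in> {1..n}" for j
    using assms(3) that by (auto simp: m_def partitions_def)
  have "m (Suc j) \<le> m j" if "j \<in> {1..<n}" for j
    using assms(3) that by (auto simp: m_def partitions_def dominant_def intro: nat_mono)
  then interpret list_charge n m c
    unfolding c_def using list_charge_tab_map[OF assms(4)] by blast
  have c0: "c [] = 0"
  proof -
    have "tab_map [] = Map.empty" by (auto simp: tab_map_def)
    then show ?thesis using charge.charge_empty[OF assms(4)] by (simp add: c_def)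
  qed
  \<comment> \<open>For \<open>i = 1\<close> the shape fills all coordinates, so
    \<open>with_rows\<close> is a dominant weight plus \<delta>, and \<open>signed_coeff\<close>
    merely compares it with \<lambda> + \<delta>.\<close>
  have val: "signed_coeff n lam (with_rows n (shifted n \<mu>) 1 (int \<circ> sh P)) = (if shape_weight n P =
      lam then 1 else 0)"
    if P: "P \<in> weight_tabs n m 1" for P
  proof -
    have sw: "shape_weight n P \<in> dominant n"
      using P shape_weight_partitions[of P n] by (auto simp: weight_tabs_def partitions_def)
    have "with_rows n (shifted n \<mu>) 1 (int \<circ> sh P) = shifted n (shape_weight n P)"
      using mu by (auto simp: fun_eq_iff with_rows_def shifted_def lookup_shape_weight lookup_delta
          weights_lookup)
    then show ?thesis
      using lookup_alternant[of "shape_weight n P" n lam] lookup_alternant_dominant[OF sw lam] sw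
          lam
      by (simp add: dominant_iff)
  qed
  have "fps_nth (kostka_foulkes n lam \<mu>) k =
      (\<Sum>P\<in>weight_tabs n m 1. if c P = k then signed_coeff n lam (with_rows n (shifted n \<mu>) 1 (int \<circ>
          sh P)) else 0)"
    unfolding kostka_foulkes_nth[OF mu lam]
    using assms(1) by (intro eval_at_charge c0 m alternating_signed_coeff vanishing_signed_coeff
        assms(2)) auto
  also have "\<dots> = (\<Sum>P\<in>weight_tabs n m 1. if shape_weight n P = lam then (if c P =
      k then 1 else 0) else 0)"
    using val by (intro sum.cong) auto
  also have "\<dots> = (\<Sum>P\<in>{P \<in> weight_tabs n m 1. shape_weight n P = lam}. if c P = k then 1 else 0)"
    by (rule sum.inter_filter[OF finite_weight_tabs, symmetric])
  also have "\<dots> = (\<Sum>b\<in>tableaux_of_shape_weight n lam \<mu>. if ch b = k then 1 else 0)"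
  proof -
    have "inj_on tab_map {P \<in> weight_tabs n m 1. shape_weight n P = lam}"
      by (rule inj_onI) (auto simp: weight_tabs_def intro: tab_map_inj)
    then show ?thesis
      using tableaux_of_shape_weight_eq[where m = m and \<mu> = \<mu>, OF assms(2)] m
      by (simp add: sum.reindex c_def)
  qed
  also have "\<dots> = fps_nth (fps_of_poly (\<Sum>b\<in>tableaux_of_shape_weight n lam \<mu>. monom 1 (ch b))) k"
    by (simp add: coeff_sum)
  finally show "fps_nth (kostka_foulkes n lam \<mu>) k =
      fps_nth (fps_of_poly (\<Sum>b\<in>tableaux_of_shape_weight n lam \<mu>. monom 1 (ch b))) k" .
qed

end
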